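(* Let $\zeta$ be a $U_2$-number with $w_1(\zeta)=w\in[1,\infty)$. Then \[\lambda_n(\zeta)=\frac{w+1-n}{n}\ \ \text{for } 1\le n\le\frac{w+1}{2},\qquad \lambda_n(\zeta)=\lambda_{n,2}(\zeta)=1\ \ \text{for } n\ge\frac{w+1}{2}.\] In particular, if $w=1$ then $\lambda_n(\zeta)=1$ for all $n\ge1$. The sequences of the form \[\Big(w,\frac{w-1}{2},\frac{w-2}{3},\dots,\frac{w+1-\lfloor\frac{w+1}{2}\rfloor}{\lfloor\frac{w+1}{2}\rfloor},1,1,1,\dots\Big),\qquad w\ge1,\] (i.e. the $n$-th term is $(w+1-n)/n$ for $1\le n\le\lfloor (w+1)/2\rfloor$ and $1$ afterwards) are exactly the sequences $(\lambda_n(\zeta))_{n\ge1}$ arising from $U_2$-numbers $\zeta$; in particular all of them belong to the joint spectrum of $(\lambda_n)_{n\ge1}$. Conversely, the sequences of this form with $w\in[1,\infty]$ (for $w=\infty$ meaning the constant sequence $\infty$) are exactly those sequences in the joint spectrum of $(\lambda_n)_{n\ge1}$ satisfying $\lambda_n>\frac12$ for all $n\ge1$.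
   Context: $H(P)$ is the maximum modulus of the coefficients of $P\in\mathbb{Z}[T]$. $w_n(\zeta)$: supremum of $w$ such that $0<|P(\zeta)|\le H(P)^{-w}$ has infinitely many solutions $P\in\mathbb{Z}[T]$ of degree $\le n$; $\zeta$ is a $U_2$-number if $w_1(\zeta)<\infty$ and $w_2(\zeta)=\infty$. For $1\le j\le n+1$, $\lambda_{n,j}(\zeta)$ is the supremum of $\lambda$ such that $1\le|x|\le X$, $\max_{1\le i\le n}|\zeta^ix-y_i|\le X^{-\lambda}$ has $j$ linearly independent integer solutions $(x,y_1,\dots,y_n)$ for arbitrarily large $X$; $\lambda_n=\lambda_{n,1}$. The joint spectrum of $(\lambda_n)_{n\ge1}$ is the set $\{(\lambda_n(\zeta))_{n\ge1}:\zeta\in\mathbb{R}\}$. *)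

theory Defs
  imports Complex_Main "HOL-Library.Extended_Real" "HOL-Library.FuncSet"
    "HOL-Computational_Algebra.Polynomial"
begin

definition height :: "int poly \<Rightarrow> int" where
  "height P = Max ((\<lambda>i. \<bar>coeff P i\<bar>) ` {..degree P})"

definition w_exp :: "nat \<Rightarrow> real \<Rightarrow> ereal" where
  "w_exp n \<zeta> = (SUP w \<in> {w :: real.
      infinite {P :: int poly. degree P \<le> n \<and>
        0 < \<bar>poly (map_poly of_int P) \<zeta>\<bar> \<and>
        \<bar>poly (map_poly of_int P) \<zeta>\<bar> \<le> real_of_int (height P) powr (- w)}}. ereal w)"

definition U2_number :: "real \<Rightarrow> bool" where
  "U2_number \<zeta> \<longleftrightarrow> w_exp 1 \<zeta> < \<infinity> \<and> w_exp 2 \<zeta> = \<infinity>"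

text \<open>An integer vector \<open>(x, y\<^sub>1, \<dots>, y\<^sub>n)\<close> is encoded as \<open>v :: nat \<Rightarrow> int\<close> with
  \<open>x = v 0\<close> and \<open>y\<^sub>i = v i\<close>; only the entries with index at most \<open>n\<close> are relevant.\<close>

definition lin_indep :: "nat \<Rightarrow> nat \<Rightarrow> (nat \<Rightarrow> nat \<Rightarrow> int) \<Rightarrow> bool" where
  "lin_indep n j v \<longleftrightarrow>
    (\<forall>c :: nat \<Rightarrow> real. (\<forall>i\<le>n. (\<Sum>k<j. c k * of_int (v k i)) = 0) \<longrightarrow> (\<forall>k<j. c k = 0))"

definition approx_sol :: "nat \<Rightarrow> real \<Rightarrow> real \<Rightarrow> real \<Rightarrow> (nat \<Rightarrow> int) \<Rightarrow> bool" where
  "approx_sol n \<zeta> l X v \<longleftrightarrow>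
    1 \<le> \<bar>v 0\<bar> \<and> real_of_int \<bar>v 0\<bar> \<le> X \<and>
    (\<forall>i\<in>{1..n}. \<bar>\<zeta> ^ i * of_int (v 0) - of_int (v i)\<bar> \<le> X powr (- l))"

definition lam_exp_j :: "nat \<Rightarrow> nat \<Rightarrow> real \<Rightarrow> ereal" where
  "lam_exp_j n j \<zeta> = (SUP l \<in> {l :: real.
      \<exists>\<^sub>F X in at_top. \<exists>v. (\<forall>k<j. approx_sol n \<zeta> l X (v k)) \<and> lin_indep n j v}. ereal l)"

definition lam_exp :: "nat \<Rightarrow> real \<Rightarrow> ereal" where
  "lam_exp n \<zeta> = lam_exp_j n 1 \<zeta>"

text \<open>Sequences indexed by \<open>n \<ge> 1\<close> are functions that are \<open>undefined\<close> at index 0.\<close>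

definition lam_seq :: "real \<Rightarrow> nat \<Rightarrow> ereal" where
  "lam_seq \<zeta> = (\<lambda>n\<in>{1..}. lam_exp n \<zeta>)"

definition joint_spectrum :: "(nat \<Rightarrow> ereal) set" where
  "joint_spectrum = range lam_seq"

definition U2_seq :: "real \<Rightarrow> nat \<Rightarrow> ereal" where
  "U2_seq w = (\<lambda>n\<in>{1..}.
      if int n \<le> \<lfloor>(w + 1) / 2\<rfloor> then ereal ((w + 1 - real n) / real n) else 1)"

end

theory Submission
  imports Defs "HOL-Analysis.Kronecker_Approximation_Theorem"
begin

text \<open>
  For an integer vector \<open>x\<close> close to \<open>x\<^sub>0 (1, \<zeta>, \<dots>, \<zeta>\<^sup>n)\<close>, everything is read off from vanishing Hankel minors
  of \<open>x\<close>. If the approximation exponent exceeds 1, all minors of order 2 vanish, so \<open>x\<close> is geometric with some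
  ratio \<open>p / q\<close> and \<open>q\<^sup>n\<close> divides \<open>x\<^sub>0\<close>; hence \<open>\<lambda>\<^sub>n > 1\<close> implies \<open>w\<^sub>1 \<ge> n \<lambda>\<^sub>n + n - 1\<close>, and two independent
  solutions cannot have an exponent above 1. Conversely, good rational approximations yield the geometric
  vectors \<open>q\<^sup>n\<^sup>-\<^sup>i p\<^sup>i\<close>, and a quadratic polynomial \<open>P\<close> that is tiny at \<open>\<zeta>\<close> yields two independent solutions of
  exponent close to 1, namely linear recurrence sequences with characteristic polynomial \<open>P\<close> whose initial
  values are two neighbouring best approximations of \<open>\<zeta>\<close>.

  If \<open>\<lambda>\<^sub>n > 1 / 2\<close> for all \<open>n\<close>, the minors of order 3 vanish, so \<open>x\<close> satisfies a quadratic recurrence with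
  characteristic polynomial \<open>P\<close>. The resultant-like identity for the order 2 minors forces the height of \<open>P\<close>
  to be at most about \<open>x\<^sub>0\<close> to the power \<open>1 / (2 n)\<close>, while \<open>P(\<zeta>)\<close> is at most about \<open>1 / x\<^sub>0\<close>. Letting \<open>n\<close> grow,
  \<open>\<zeta>\<close> is rational, quadratic, a Liouville number or a \<open>U\<^sub>2\<close>-number.

  A \<open>U\<^sub>2\<close>-number with \<open>w\<^sub>1 = w\<close> is a continued fraction consisting of very long blocks of partial quotients 1
  separated by single partial quotients of size about \<open>q\<^sup>w\<^sup>-\<^sup>1\<close>.
\<close>

text \<open>The threshold 1/2 is where minors of order 3 become small: each is a sum of products of
  one entry and two errors, of size X^(1 - 2 \<lambda>) with X = |x_0|. The obstacle is the height
  of the quadratic polynomial P so obtained. Its coefficients are minors of order 2, of size X^(1 -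
  \<lambda>), which alone would give hardly more than w_2 >= 1. What helps is that the recurrence
  holds over many steps: once P is primitive, multiplying the functional behind x by (T - a)^k turns
  the Hankel determinant into t P(a)^k with a nonzero integer t, and this is still a minor of order
  2. So |P(a)| is at most about X^(1 / (2 k)), and the values at -1, 0, 1 determine P. Finiteness of
  w_1 acts twice: it excludes geometric vectors, and it keeps approximation errors of \<zeta> above
  a power of the denominator, so that a tiny P(\<zeta>) can be made negligible against them.\<close>

lemma powr_eventually_dominates:
  fixes C w w' :: real
  assumes "w' < w"
  shows "\<exists>B\<ge>1. \<forall>H\<ge>B. C * H powr (- w) \<le> H powr (- w')"
proof (intro exI conjI allI impI)
  \<comment> \<open>From this height on |C| <= H^(w - w'). The exponents are suprema, so a constant
    factor can be paid for by an arbitrarily small loss of exponent.\<close>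
  define B where "B = max 1 (\<bar>C\<bar> powr (1 / (w - w')))"
  show "1 \<le> B" by (simp add: B_def)
  fix H assume H: "B \<le> H"
  then have H1: "1 \<le> H" by (simp add: B_def)
  have "\<bar>C\<bar> = (\<bar>C\<bar> powr (1 / (w - w'))) powr (w - w')"
    using assms by (simp add: powr_powr)
  also have "\<dots> \<le> H powr (w - w')"
    using H assms by (intro powr_mono2) (auto simp: B_def)
  finally have "C \<le> H powr (w - w')" by linarith
  then have "C * H powr (- w) \<le> H powr (w - w') * H powr (- w)"
    by (intro mult_right_mono) auto
  also have "\<dots> = H powr (- w')" using H1 by (simp add: powr_add [symmetric])
  finally show "C * H powr (- w) \<le> H powr (- w')" .
qed

lemma powr_minus_eventually_small:
  fixes w \<epsilon> :: real
  assumes "0 < w" "0 < \<epsilon>"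
  shows "\<exists>B\<ge>1. \<forall>H\<ge>B. H powr (- w) < \<epsilon>"
proof -
  obtain B where B: "1 \<le> B" "\<forall>H\<ge>B. (2 / \<epsilon>) * H powr (- w) \<le> H powr (- 0)"
    using powr_eventually_dominates [OF assms(1)] by blast
  show ?thesis
  proof (intro exI conjI allI impI)
    show "1 \<le> B" by fact
    fix H assume H: "B \<le> H"
    then have "(2 / \<epsilon>) * H powr (- w) \<le> 1" using B by fastforce
    then show "H powr (- w) < \<epsilon>" using assms(2) by (simp add: field_simps)
  qed
qed

section \<open>Distances from multiples of an irrational number to the integers\<close>

text \<open>Only finitely many \<open>a\<close> occur, and each \<open>a * \<zeta>\<close> keeps a
  positive distance from its nearest integer. Read contrapositively, a small value of |q \<zeta> -
  p| forces q beyond any prescribed bound.\<close>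

lemma irrational_dist:
  fixes \<zeta> B :: real
  assumes "\<zeta> \<notin> \<rat>"
  shows "\<exists>\<delta>>0. \<forall>(a :: int) (b :: int). a \<noteq> 0 \<and> \<bar>real_of_int a\<bar> \<le> B \<longrightarrow> \<delta> \<le> \<bar>a * \<zeta> - b\<bar>"
proof -
  define A where "A = {a :: int. a \<noteq> 0 \<and> \<bar>a\<bar> \<le> \<lfloor>B\<rfloor>}"
  have "A \<subseteq> {- \<lfloor>B\<rfloor>..\<lfloor>B\<rfloor>}" by (auto simp: A_def)
  then have fin: "finite A" by (rule finite_subset) simp
  define f where "f = (\<lambda>a :: int. \<bar>a * \<zeta> - round (a * \<zeta>)\<bar>)"
  have pos: "0 < f a" if "a \<in> A" for a
  proof (rule ccontr)
    assume "\<not> 0 < f a"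
    then have "a * \<zeta> = round (a * \<zeta>)" by (simp add: f_def)
    then have "\<zeta> = round (a * \<zeta>) / a" using that by (simp add: A_def field_simps)
    also have "\<dots> \<in> \<rat>" by simp
    finally show False using assms by simp
  qed
  \<comment> \<open>The inserted 1 covers an empty \<open>A\<close>, which happens for
    \<open>B < 1\<close>.\<close>
  define \<delta> where "\<delta> = Min (insert 1 (f ` A))"
  show ?thesis
  proof (intro exI conjI allI impI)
    show "0 < \<delta>" unfolding \<delta>_def using fin pos by auto
    fix a b :: int assume "a \<noteq> 0 \<and> \<bar>real_of_int a\<bar> \<le> B"
    then have "a \<in> A" by (auto simp: A_def le_floor_iff)
    then have "\<delta> \<le> f a" unfolding \<delta>_def using fin by (intro Min_le) auto
    also have "f a \<le> \<bar>a * \<zeta> - b\<bar>"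
      unfolding f_def using round_diff_minimal by blast
    finally show "\<delta> \<le> \<bar>a * \<zeta> - b\<bar>" .
  qed
qed

lemma irrational_form_nonzero:
  fixes \<zeta> :: real and a b :: int
  assumes "\<zeta> \<notin> \<rat>" "a \<noteq> 0"
  shows "a * \<zeta> - b \<noteq> 0"
proof -
  obtain \<delta> where "0 < \<delta>" "\<forall>b :: int. \<delta> \<le> \<bar>a * \<zeta> - b\<bar>"
    using irrational_dist [OF assms(1), of "\<bar>real_of_int a\<bar>"] assms(2) by blast
  then have "0 < \<bar>a * \<zeta> - b\<bar>" by (meson less_le_trans)
  then show ?thesis by simp
qed

section \<open>The exponents \<open>w\<^sub>n\<close>\<close>

lemma coeff_le_height: "\<bar>coeff P i\<bar> \<le> height P"
proof (cases "i \<le> degree P")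
  case True
  then show ?thesis unfolding height_def by (intro Max_ge) auto
next
  case False
  then have "\<bar>coeff P i\<bar> \<le> \<bar>coeff P 0\<bar>" by (simp add: coeff_eq_0)
  also have "\<dots> \<le> height P" unfolding height_def by (intro Max_ge) auto
  finally show ?thesis .
qed

lemma height_le_iff: "height P \<le> B \<longleftrightarrow> (\<forall>i. \<bar>coeff P i\<bar> \<le> B)"
proof
  assume "\<forall>i. \<bar>coeff P i\<bar> \<le> B"
  then show "height P \<le> B" unfolding height_def by (subst Max_le_iff) auto
qed (meson coeff_le_height order_trans)

lemma height_ge_1: "P \<noteq> 0 \<Longrightarrow> 1 \<le> height P"
  using coeff_le_height [of P "degree P"] leading_coeff_neq_0 [of P] by linarith

lemma poly_of_int_altdef:
  fixes \<zeta> :: real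
  assumes "degree P \<le> n"
  shows "poly (map_poly of_int P) \<zeta> = (\<Sum>i\<le>n. of_int (coeff P i) * \<zeta> ^ i)"
proof -
  have "degree (map_poly of_int P :: real poly) \<le> n"
    using assms map_poly_degree_leq order_trans by blast
  then show ?thesis
    by (subst poly_altdef, intro sum.mono_neutral_cong_left) (auto simp: coeff_map_poly intro!: le_degree)
qed

lemma poly_of_int_degree2:
  fixes \<zeta> :: real
  assumes "degree P \<le> 2"
  shows "poly (map_poly of_int P) \<zeta> = coeff P 0 + coeff P 1 * \<zeta> + coeff P 2 * \<zeta>\<^sup>2"
  using poly_of_int_altdef [OF assms] by (simp add: numeral_2_eq_2)

lemma poly_of_int_degree1:
  fixes \<zeta> :: real
  assumes "degree P \<le> 1"
  shows "poly (map_poly of_int P) \<zeta> = coeff P 0 + coeff P 1 * \<zeta>"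
  using poly_of_int_altdef [OF assms] by simp

text \<open>A polynomial is determined by n + 1 coefficients from a finite interval. This lets
  infinitely many solutions be traded for solutions of arbitrarily large height.\<close>

lemma finite_bounded_height:
  "finite {P :: int poly. degree P \<le> n \<and> height P \<le> B}"
proof -
  have "{P :: int poly. degree P \<le> n \<and> height P \<le> B}
    \<subseteq> Poly ` {xs. set xs \<subseteq> {- B..B} \<and> length xs = Suc n}"
  proof safe
    fix P :: "int poly" assume P: "degree P \<le> n" "height P \<le> B"
    define xs where "xs = map (coeff P) [0..<Suc n]"
    have "P = Poly xs"
    proof (rule poly_eqI)
      fix i show "coeff P i = coeff (Poly xs) i"
        using P(1) by (cases "i < Suc n") (auto simp: xs_def nth_default_def coeff_eq_0 simp del: upt_Suc)
    qed
    moreover have "set xs \<subseteq> {- B..B}"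
      using P(2) by (auto simp: xs_def height_le_iff abs_le_iff minus_le_iff)
    ultimately show "P \<in> Poly ` {xs. set xs \<subseteq> {- B..B} \<and> length xs = Suc n}"
      by (auto simp: xs_def)
  qed
  then show ?thesis by (rule finite_subset) (auto intro!: finite_imageI finite_lists_length_eq)
qed

text \<open>Positive values that become arbitrarily small come from infinitely many polynomials, so
  one polynomial per \<epsilon> is enough. Their heights are unbounded, which absorbs the constant
  \<open>C\<close>.\<close>

lemma w_exp_geI:
  fixes \<zeta> C w :: real
  assumes "\<And>\<epsilon>. 0 < \<epsilon> \<Longrightarrow> \<exists>P :: int poly. degree P \<le> n \<and> 0 < \<bar>poly (map_poly of_int P) \<zeta>\<bar> \<and>
     \<bar>poly (map_poly of_int P) \<zeta>\<bar> < \<epsilon> \<and>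
     \<bar>poly (map_poly of_int P) \<zeta>\<bar> \<le> C * real_of_int (height P) powr (- w)"
  shows "ereal w \<le> w_exp n \<zeta>"
proof (rule dense_le)
  fix y assume "y < ereal w"
  then obtain w' where w': "y < ereal w'" "w' < w" using ereal_dense2 by force
  let ?v = "\<lambda>P :: int poly. \<bar>poly (map_poly of_int P) \<zeta>\<bar>"
  define S where "S = {P :: int poly. degree P \<le> n \<and> 0 < ?v P \<and> ?v P \<le> C * real_of_int (height P) powr (- w)}"
  have inf: "infinite S"
  proof
    assume fin: "finite S"
    define \<epsilon> where "\<epsilon> = Min (insert 1 (?v ` S))"
    have "0 < \<epsilon>" unfolding \<epsilon>_def using fin by (auto simp: S_def)
    then obtain P where "P \<in> S" "?v P < \<epsilon>" using assms unfolding S_def by blast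
    moreover have "\<epsilon> \<le> ?v P" unfolding \<epsilon>_def using fin \<open>P \<in> S\<close> by (intro Min_le) auto
    ultimately show False by simp
  qed
  obtain B where B: "1 \<le> B" "\<forall>H\<ge>B. C * H powr (- w) \<le> H powr (- w')"
    using powr_eventually_dominates [OF w'(2)] by blast
  have "infinite (S - {P. degree P \<le> n \<and> height P \<le> \<lceil>B\<rceil>})"
    using inf finite_bounded_height by (rule Diff_infinite_finite [rotated])
  moreover have "S - {P. degree P \<le> n \<and> height P \<le> \<lceil>B\<rceil>} \<subseteq>
     {P. degree P \<le> n \<and> 0 < ?v P \<and> ?v P \<le> real_of_int (height P) powr (- w')}"
  proof
    fix P assume P: "P \<in> S - {P. degree P \<le> n \<and> height P \<le> \<lceil>B\<rceil>}"
    then have "B \<le> real_of_int (height P)" by (simp add: S_def) linarith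
    from B(2) [rule_format, OF this] P
    show "P \<in> {P. degree P \<le> n \<and> 0 < ?v P \<and> ?v P \<le> real_of_int (height P) powr (- w')}"
      by (auto simp: S_def)
  qed
  ultimately have "infinite {P. degree P \<le> n \<and> 0 < ?v P \<and> ?v P \<le> real_of_int (height P) powr (- w')}"
    using infinite_super by blast
  then have "ereal w' \<le> w_exp n \<zeta>" unfolding w_exp_def by (intro SUP_upper) simp
  then show "y \<le> w_exp n \<zeta>" using w'(1) by simp
qed

lemma w_exp_gtD:
  fixes \<zeta> B w :: real
  assumes "ereal w < w_exp n \<zeta>"
  obtains P :: "int poly" where "degree P \<le> n" "B \<le> height P" "1 \<le> height P"
    "0 < \<bar>poly (map_poly of_int P) \<zeta>\<bar>"
    "\<bar>poly (map_poly of_int P) \<zeta>\<bar> \<le> real_of_int (height P) powr (- w)"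
proof -
  let ?v = "\<lambda>P :: int poly. \<bar>poly (map_poly of_int P) \<zeta>\<bar>"
  obtain w' where w': "w < w'"
    "infinite {P. degree P \<le> n \<and> 0 < ?v P \<and> ?v P \<le> real_of_int (height P) powr (- w')}"
    using assms unfolding w_exp_def less_SUP_iff by auto
  then obtain P where P: "P \<in> {P. degree P \<le> n \<and> 0 < ?v P \<and> ?v P \<le> real_of_int (height P) powr (- w')}
      - {P. degree P \<le> n \<and> height P \<le> \<lceil>B\<rceil>}"
    using Diff_infinite_finite [OF finite_bounded_height [of n "\<lceil>B\<rceil>"] w'(2)]
    by (metis (no_types, lifting) equals0I finite.emptyI)
  then have "P \<noteq> 0" by auto
  then have 1: "1 \<le> height P" by (rule height_ge_1)
  show thesis
  proof
    show "B \<le> height P" using P by simp linarith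
    have "real_of_int (height P) powr (- w') \<le> real_of_int (height P) powr (- w)"
      using 1 w' by (intro powr_mono) auto
    then show "?v P \<le> real_of_int (height P) powr (- w)" using P by auto
  qed (use P 1 in auto)
qed

text \<open>A linear form bounded by 1 has |b| <= |a| |\<zeta>| + 1, so the coefficient of \<zeta>
  controls the height; the height demanded of \<open>P\<close> is what pushes |a| beyond |B|.
  Replacing the height by |a| only weakens the bound, as |a| <= H(P).\<close>

lemma w_exp_1_gtD:
  fixes \<zeta> B w :: real
  assumes "0 < w" and less: "ereal w < w_exp 1 \<zeta>"
  obtains q p :: int where "1 \<le> q" "B \<le> q" "\<bar>q * \<zeta> - p\<bar> \<le> q powr (- w)"
proof -
  obtain P :: "int poly" where P: "degree P \<le> 1" "(\<bar>B\<bar> + 1) * (\<bar>\<zeta>\<bar> + 1) + 1 \<le> height P" "1 \<le> height P"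
    "0 < \<bar>poly (map_poly of_int P) \<zeta>\<bar>"
    "\<bar>poly (map_poly of_int P) \<zeta>\<bar> \<le> real_of_int (height P) powr (- w)"
    by (rule w_exp_gtD [OF less, of "(\<bar>B\<bar> + 1) * (\<bar>\<zeta>\<bar> + 1) + 1"])
  define a b where "a = coeff P 1" and "b = coeff P 0"
  have val: "poly (map_poly of_int P) \<zeta> = b + a * \<zeta>"
    unfolding a_def b_def by (rule poly_of_int_degree1 [OF P(1)])
  have "real_of_int (height P) powr (- w) \<le> 1"
    using P(3) \<open>0 < w\<close> by (simp add: powr_minus ge_one_powr_ge_zero inverse_le_1_iff)
  then have le1: "\<bar>b + a * \<zeta>\<bar> \<le> 1" using P(5) val by linarith
  have "\<bar>real_of_int b\<bar> \<le> \<bar>a\<bar> * \<bar>\<zeta>\<bar> + 1"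
    using le1 abs_mult [of "real_of_int a" \<zeta>] by linarith
  moreover have "real_of_int \<bar>a\<bar> \<le> \<bar>a\<bar> * (\<bar>\<zeta>\<bar> + 1)" by (simp add: algebra_simps)
  moreover have "height P \<le> max \<bar>a\<bar> \<bar>b\<bar>"
  proof (subst height_le_iff, safe)
    fix i show "\<bar>coeff P i\<bar> \<le> max \<bar>a\<bar> \<bar>b\<bar>"
    proof (cases "i \<le> 1")
      case True then show ?thesis unfolding a_def b_def by (cases i) auto
    next
      case False then show ?thesis using P(1) by (simp add: coeff_eq_0)
    qed
  qed
  ultimately have "height P \<le> \<bar>a\<bar> * (\<bar>\<zeta>\<bar> + 1) + 1"
    by (simp add: algebra_simps max_def split: if_splits)
  then have "(\<bar>B\<bar> + 1) * (\<bar>\<zeta>\<bar> + 1) \<le> \<bar>a\<bar> * (\<bar>\<zeta>\<bar> + 1)" using P(2) by linarith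
  then have ge: "\<bar>B\<bar> + 1 \<le> \<bar>a\<bar>" by (simp add: mult_le_cancel_right)
  have "real_of_int (height P) powr (- w) \<le> real_of_int \<bar>a\<bar> powr (- w)"
    using ge \<open>0 < w\<close> coeff_le_height [of P 1] by (intro powr_mono2') (auto simp: a_def)
  then have up: "\<bar>b + a * \<zeta>\<bar> \<le> \<bar>a\<bar> powr (- w)" using P(5) val by simp
  show thesis
  proof
    show "1 \<le> \<bar>a\<bar>" "B \<le> \<bar>a\<bar>" using ge by linarith+
    show "\<bar>\<bar>a\<bar> * \<zeta> - (if 0 < a then - b else b)\<bar> \<le> \<bar>a\<bar> powr (- w)"
      using up by (auto simp: abs_if algebra_simps split: if_splits)
  qed
qed

text \<open>The height of q T - p is at most a constant \<open>K\<close> times q, so a bound in q is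
  one in the height up to the factor K^w. Irrationality keeps the values nonzero.\<close>

lemma w_exp_1_geI:
  fixes \<zeta> C w :: real
  assumes irr: "\<zeta> \<notin> \<rat>" and "0 < w"
    and ex: "\<And>B :: real. \<exists>(q :: int) (p :: int). (1 :: int) \<le> q \<and> B \<le> q \<and> \<bar>q * \<zeta> - p\<bar> \<le> C * q powr (- w)"
  shows "ereal w \<le> w_exp 1 \<zeta>"
proof (rule w_exp_geI)
  fix \<epsilon> :: real assume "0 < \<epsilon>"
  define K where "K = \<bar>\<zeta>\<bar> + \<bar>C\<bar> + 1"
  have K1: "1 \<le> K" by (simp add: K_def)
  obtain B where B: "1 \<le> B" "\<forall>H\<ge>B. H powr (- w) < \<epsilon> / (\<bar>C\<bar> + 1)"
    using powr_minus_eventually_small [of w "\<epsilon> / (\<bar>C\<bar> + 1)"] \<open>0 < w\<close> \<open>0 < \<epsilon>\<close>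
    by (auto simp: add_nonneg_pos)
  obtain q p :: int where qp: "1 \<le> q" "B \<le> q" "\<bar>q * \<zeta> - p\<bar> \<le> C * q powr (- w)"
    using ex by blast
  define P where "P = [:- p, q:]"
  have deg: "degree P \<le> 1" by (simp add: P_def)
  have val: "poly (map_poly of_int P) \<zeta> = q * \<zeta> - p"
    using poly_of_int_degree1 [OF deg] by (simp add: P_def)
  have q1: "real_of_int q powr (- w) \<le> 1"
    using qp(1) \<open>0 < w\<close> by (simp add: powr_minus ge_one_powr_ge_zero inverse_le_1_iff)
  have up: "\<bar>q * \<zeta> - p\<bar> \<le> \<bar>C\<bar> * q powr (- w)"
    using qp(3) by (smt (verit) mult_right_mono powr_ge_zero)
  also have "\<dots> \<le> \<bar>C\<bar> * 1" using q1 by (intro mult_left_mono) auto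
  finally have "\<bar>real_of_int p\<bar> \<le> q * \<bar>\<zeta>\<bar> + \<bar>C\<bar>"
    using qp(1) abs_mult [of "real_of_int q" \<zeta>] by linarith
  also have "\<dots> \<le> K * q" using qp(1) mult_left_mono [of 1 "real_of_int q" "\<bar>C\<bar>"]
    by (simp add: K_def algebra_simps)
  finally have pK: "\<bar>real_of_int p\<bar> \<le> K * q" .
  have qK: "\<bar>real_of_int q\<bar> \<le> K * q" using qp(1) K1 by (simp add: mult_le_cancel_right1)
  have "height P \<in> (\<lambda>i. \<bar>coeff P i\<bar>) ` {..degree P}" unfolding height_def by (rule Max_in) auto
  then obtain i where i: "i \<le> 1" "height P = \<bar>coeff P i\<bar>"
    using deg by (metis (no_types, lifting) atMost_iff imageE order_trans)
  have HK: "real_of_int (height P) \<le> K * q"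
    using pK qK i by (cases i) (auto simp: P_def)
  have H1: "1 \<le> height P" using qp(1) by (intro height_ge_1) (auto simp: P_def)
  have "(K * q) powr (- w) \<le> real_of_int (height P) powr (- w)"
    using HK H1 \<open>0 < w\<close> by (intro powr_mono2') auto
  then have "K powr w * (K powr (- w) * q powr (- w)) \<le> K powr w * real_of_int (height P) powr (- w)"
    unfolding powr_mult by (rule mult_left_mono) simp
  moreover have "K powr w * (K powr (- w) * q powr (- w)) = q powr (- w)"
    using K1 by (simp add: powr_minus)
  ultimately have "q powr (- w) \<le> K powr w * real_of_int (height P) powr (- w)" by simp
  then have "\<bar>C\<bar> * q powr (- w) \<le> \<bar>C\<bar> * (K powr w * real_of_int (height P) powr (- w))"
    by (intro mult_left_mono) auto
  then have fin: "\<bar>q * \<zeta> - p\<bar> \<le> (\<bar>C\<bar> * K powr w) * real_of_int (height P) powr (- w)"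
    using up by (simp add: mult.assoc)
  have "\<bar>C\<bar> * q powr (- w) \<le> \<bar>C\<bar> * (\<epsilon> / (\<bar>C\<bar> + 1))"
    using B(2) [rule_format, OF qp(2)] by (intro mult_left_mono) auto
  also have "\<dots> < \<epsilon>" using \<open>0 < \<epsilon>\<close> by (simp add: field_simps add_pos_nonneg)
  finally have "\<bar>q * \<zeta> - p\<bar> < \<epsilon>" using up by linarith
  moreover have "0 < \<bar>q * \<zeta> - p\<bar>"
    using irrational_form_nonzero [OF irr, of q p] qp(1) by simp
  ultimately show "\<exists>P :: int poly. degree P \<le> 1 \<and> 0 < \<bar>poly (map_poly of_int P) \<zeta>\<bar> \<and>
     \<bar>poly (map_poly of_int P) \<zeta>\<bar> < \<epsilon> \<and>
     \<bar>poly (map_poly of_int P) \<zeta>\<bar> \<le> (\<bar>C\<bar> * K powr w) * real_of_int (height P) powr (- w)"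
    using deg val fin by (intro exI [of _ P]) simp
qed

lemma w_exp_1_leI:
  fixes \<zeta> c w :: real
  assumes "0 \<le> w" "0 < c"
    and ge: "\<And>(q :: int) (p :: int). (1 :: int) \<le> q \<Longrightarrow> c * q powr (- w) \<le> \<bar>q * \<zeta> - p\<bar>"
  shows "w_exp 1 \<zeta> \<le> ereal w"
proof (rule ccontr)
  assume "\<not> w_exp 1 \<zeta> \<le> ereal w"
  then obtain w' where w': "w < w'" "ereal w' < w_exp 1 \<zeta>"
    using ereal_dense2 [of "ereal w" "w_exp 1 \<zeta>"] by (auto simp: not_le)
  obtain B where B: "1 \<le> B" "\<forall>H\<ge>B. H powr (- (w' - w)) < c"
    using powr_minus_eventually_small [of "w' - w" c] w'(1) \<open>0 < c\<close> by auto
  obtain q p :: int where qp: "1 \<le> q" "B \<le> q" "\<bar>q * \<zeta> - p\<bar> \<le> q powr (- w')"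
    by (rule w_exp_1_gtD [OF _ w'(2), of B]) (use w'(1) \<open>0 \<le> w\<close> in auto)
  have "q powr (- w') = q powr (- (w' - w)) * q powr (- w)"
    using qp(1) by (simp add: powr_add [symmetric])
  also have "\<dots> < c * q powr (- w)" using B(2) [rule_format, OF qp(2)] qp(1) by (intro mult_strict_right_mono) auto
  finally show False using ge [OF qp(1), of p] qp(3) by linarith
qed

text \<open>Failure of the hypothesis of \<open>w_exp_1_geI\<close> bounds the form from below for
  all large q; the finitely many smaller q are covered by irrationality. The outcome is an
  irrationality measure uniform in q >= 1.\<close>

lemma w_exp_1_lessD:
  fixes \<zeta> W :: real
  assumes irr: "\<zeta> \<notin> \<rat>" and "0 < W" and less: "w_exp 1 \<zeta> < ereal W"
  shows "\<exists>c>0. c \<le> 1 \<and> (\<forall>(q :: int) (p :: int). (1 :: int) \<le> q \<longrightarrow> c * q powr (- W) \<le> \<bar>q * \<zeta> - p\<bar>)"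
proof -
  have "\<not> (\<forall>B :: real. \<exists>(q :: int) (p :: int). (1 :: int) \<le> q \<and> B \<le> q \<and> \<bar>q * \<zeta> - p\<bar> \<le> 1 * q powr (- W))"
    (is "\<not> ?ex")
  proof
    assume ?ex
    then have "ereal W \<le> w_exp 1 \<zeta>" by (intro w_exp_1_geI [OF irr \<open>0 < W\<close>]) (rule spec)
    then show False using less by simp
  qed
  then obtain B :: real where notex: "\<not> (\<exists>(q :: int) (p :: int). (1 :: int) \<le> q \<and> B \<le> q \<and> \<bar>q * \<zeta> - p\<bar> \<le> 1 * q powr (- W))"
    by blast
  have B: "q powr (- W) < \<bar>q * \<zeta> - p\<bar>" if "1 \<le> q" "B \<le> q" for q p :: int
  proof (rule ccontr)
    assume "\<not> ?thesis"
    then have "(1 :: int) \<le> q \<and> B \<le> q \<and> \<bar>q * \<zeta> - p\<bar> \<le> 1 * q powr (- W)" using that by simp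
    then show False using notex by blast
  qed
  obtain \<delta> where \<delta>: "0 < \<delta>" "\<forall>(a :: int) (b :: int). a \<noteq> 0 \<and> \<bar>real_of_int a\<bar> \<le> B \<longrightarrow> \<delta> \<le> \<bar>a * \<zeta> - b\<bar>"
    using irrational_dist [OF irr, of B] by blast
  show ?thesis
  proof (intro exI conjI allI impI)
    show "0 < min 1 \<delta>" "min 1 \<delta> \<le> 1" using \<delta> by auto
    fix q p :: int assume q: "1 \<le> q"
    show "min 1 \<delta> * q powr (- W) \<le> \<bar>q * \<zeta> - p\<bar>"
    proof (cases "B \<le> q")
      case True
      have "min 1 \<delta> * q powr (- W) \<le> 1 * q powr (- W)" by (intro mult_right_mono) auto
      then show ?thesis using B [OF q True, of p] by simp
    next
      case False
      have "q powr (- W) \<le> 1"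
        using q \<open>0 < W\<close> by (simp add: powr_minus ge_one_powr_ge_zero inverse_le_1_iff)
      then have "min 1 \<delta> * q powr (- W) \<le> min 1 \<delta> * 1" using \<delta>(1) by (intro mult_left_mono) auto
      also have "\<dots> \<le> \<delta>" by simp
      also have "\<dots> \<le> \<bar>q * \<zeta> - p\<bar>" using \<delta>(2) q False by simp
      finally show ?thesis .
    qed
  qed
qed

section \<open>The exponents \<open>\<lambda>\<^sub>n\<close>\<close>

lemma lam_exp_j_geI:
  assumes "\<And>B :: real. \<exists>X\<ge>B. \<exists>v. (\<forall>k<j. approx_sol n \<zeta> l X (v k)) \<and> lin_indep n j v"
  shows "ereal l \<le> lam_exp_j n j \<zeta>"
proof -
  have "\<exists>\<^sub>F X in at_top. \<exists>v. (\<forall>k<j. approx_sol n \<zeta> l X (v k)) \<and> lin_indep n j v"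
    unfolding frequently_def eventually_at_top_linorder using assms by blast
  then show ?thesis unfolding lam_exp_j_def by (intro SUP_upper) simp
qed

lemma lam_exp_j_gtD:
  assumes "ereal l < lam_exp_j n j \<zeta>"
  shows "\<exists>X\<ge>B. \<exists>v. (\<forall>k<j. approx_sol n \<zeta> l X (v k)) \<and> lin_indep n j v"
proof -
  obtain l' where l': "l < l'"
    "\<exists>\<^sub>F X in at_top. \<exists>v. (\<forall>k<j. approx_sol n \<zeta> l' X (v k)) \<and> lin_indep n j v"
    using assms unfolding lam_exp_j_def less_SUP_iff by auto
  obtain X v where X: "max 1 B \<le> X" and v: "\<forall>k<j. approx_sol n \<zeta> l' X (v k)" "lin_indep n j v"
    using l'(2) unfolding frequently_def eventually_at_top_linorder by blast
  have "X powr (- l') \<le> X powr (- l)" using X l'(1) by (intro powr_mono) auto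
  then have "\<forall>k<j. approx_sol n \<zeta> l X (v k)"
    using v(1) unfolding approx_sol_def by (meson order_trans)
  then show ?thesis using X v(2) by auto
qed

lemma lin_indep_1:
  assumes "v 0 0 \<noteq> 0"
  shows "lin_indep n 1 v"
  unfolding lin_indep_def using assms by (auto dest: spec [of _ 0])

lemma lin_indep_2:
  assumes "1 \<le> n" "v 0 0 * v 1 1 \<noteq> v 0 1 * v 1 0"
  shows "lin_indep n 2 v"
  unfolding lin_indep_def
proof safe
  fix c :: "nat \<Rightarrow> real" and k :: nat
  assume eq: "\<forall>i\<le>n. (\<Sum>k<2. c k * real_of_int (v k i)) = 0" and k: "k < 2"
  have e0: "c 0 * v 0 0 + c 1 * v 1 0 = 0" and e1: "c 0 * v 0 1 + c 1 * v 1 1 = 0"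
    using eq [rule_format, of 0] eq [rule_format, of 1] \<open>1 \<le> n\<close>
    by (simp_all add: numeral_2_eq_2)
  define D where "D = real_of_int (v 0 0 * v 1 1 - v 0 1 * v 1 0)"
  have "D \<noteq> 0" using assms(2) by (simp add: D_def del: of_int_mult of_int_diff)
  moreover have "c 0 * D = (c 0 * v 0 0 + c 1 * v 1 0) * v 1 1 - (c 0 * v 0 1 + c 1 * v 1 1) * v 1 0"
    by (simp add: D_def algebra_simps)
  moreover have "c 1 * D = (c 0 * v 0 1 + c 1 * v 1 1) * v 0 0 - (c 0 * v 0 0 + c 1 * v 1 0) * v 0 1"
    by (simp add: D_def algebra_simps)
  ultimately have "c 0 = 0" "c 1 = 0" using e0 e1 by auto
  then show "c k = 0" using k by (cases k) auto
qed

lemma lam_exp_geI: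
  fixes \<zeta> l C :: real
  assumes ex: "\<And>B :: real. \<exists>v :: nat \<Rightarrow> int. 1 \<le> \<bar>v 0\<bar> \<and> B \<le> real_of_int \<bar>v 0\<bar> \<and>
     (\<forall>i\<in>{1..n}. \<bar>\<zeta> ^ i * v 0 - v i\<bar> \<le> C * real_of_int \<bar>v 0\<bar> powr (- l))"
  shows "ereal l \<le> lam_exp n \<zeta>"
proof (rule dense_le)
  fix y assume "y < ereal l"
  then obtain l' where l': "y < ereal l'" "l' < l" using ereal_dense2 by force
  have "ereal l' \<le> lam_exp_j n 1 \<zeta>"
  proof (rule lam_exp_j_geI)
    fix B :: real
    obtain B' where B': "1 \<le> B'" "\<forall>H\<ge>B'. C * H powr (- l) \<le> H powr (- l')"
      using powr_eventually_dominates [OF l'(2)] by blast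
    obtain v :: "nat \<Rightarrow> int" where v: "1 \<le> \<bar>v 0\<bar>" "max B B' \<le> real_of_int \<bar>v 0\<bar>"
      "\<forall>i\<in>{1..n}. \<bar>\<zeta> ^ i * v 0 - v i\<bar> \<le> C * real_of_int \<bar>v 0\<bar> powr (- l)"
      using ex by blast
    have "C * real_of_int \<bar>v 0\<bar> powr (- l) \<le> real_of_int \<bar>v 0\<bar> powr (- l')"
      using v(2) by (intro B'(2) [rule_format]) simp
    then have "approx_sol n \<zeta> l' (real_of_int \<bar>v 0\<bar>) v"
      unfolding approx_sol_def using v by (meson order_refl order_trans)
    moreover have "lin_indep n 1 (\<lambda>_. v)" using v(1) by (intro lin_indep_1) auto
    ultimately show "\<exists>X\<ge>B. \<exists>v. (\<forall>k<1. approx_sol n \<zeta> l' X (v k)) \<and> lin_indep n 1 v"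
      using v(2) by (intro exI [of _ "real_of_int \<bar>v 0\<bar>"] conjI exI [of _ "\<lambda>_. v"]) auto
  qed
  then show "y \<le> lam_exp n \<zeta>" using l'(1) by (simp add: lam_exp_def)
qed

text \<open>The definition measures errors by X, which may exceed |x_0|; since X^(-l) <= |x_0|^(-l)
  for l > 0 the bound survives. Irrationality makes |x_0| large, because the error at index 1 tends
  to 0.\<close>

lemma lam_exp_gtD:
  fixes \<zeta> l B :: real
  assumes irr: "\<zeta> \<notin> \<rat>" and "1 \<le> n" "0 < l" and less: "ereal l < lam_exp n \<zeta>"
  shows "\<exists>v :: nat \<Rightarrow> int. 1 \<le> \<bar>v 0\<bar> \<and> B \<le> real_of_int \<bar>v 0\<bar> \<and>
     (\<forall>i\<in>{1..n}. \<bar>\<zeta> ^ i * v 0 - v i\<bar> \<le> real_of_int \<bar>v 0\<bar> powr (- l))"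
proof -
  obtain \<delta> where \<delta>: "0 < \<delta>" "\<forall>(a :: int) (b :: int). a \<noteq> 0 \<and> \<bar>real_of_int a\<bar> \<le> B \<longrightarrow> \<delta> \<le> \<bar>a * \<zeta> - b\<bar>"
    using irrational_dist [OF irr, of B] by blast
  obtain B' where B': "1 \<le> B'" "\<forall>H\<ge>B'. H powr (- l) < \<delta>"
    using powr_minus_eventually_small [OF \<open>0 < l\<close> \<delta>(1)] by blast
  obtain X v where X: "B' \<le> X" and v: "approx_sol n \<zeta> l X v"
    using lam_exp_j_gtD [of l n 1 \<zeta> B'] less by (auto simp: lam_exp_def)
  have v0: "1 \<le> \<bar>v 0\<bar>" "real_of_int \<bar>v 0\<bar> \<le> X"
    and app: "\<And>i. i \<in> {1..n} \<Longrightarrow> \<bar>\<zeta> ^ i * v 0 - v i\<bar> \<le> X powr (- l)"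
    using v unfolding approx_sol_def by auto
  have "\<bar>v 0 * \<zeta> - v 1\<bar> < \<delta>"
    using app [of 1] \<open>1 \<le> n\<close> B'(2) [rule_format, OF X] by (simp add: mult.commute)
  then have "\<not> \<bar>real_of_int (v 0)\<bar> \<le> B" using \<delta>(2) v0(1) by (metis abs_zero not_less zero_less_one not_le)
  then have "B \<le> real_of_int \<bar>v 0\<bar>" by simp
  moreover have "X powr (- l) \<le> real_of_int \<bar>v 0\<bar> powr (- l)"
    using v0 \<open>0 < l\<close> by (intro powr_mono2') auto
  ultimately show ?thesis using v0(1) app by (meson order_trans)
qed

section \<open>Geometric vectors: comparing \<lambda>_n with w_1\<close>

lemma power_diff_le:
  fixes x y M :: real
  assumes "\<bar>x\<bar> \<le> M" "\<bar>y\<bar> \<le> M" "1 \<le> M"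
  shows "\<bar>x ^ i - y ^ i\<bar> \<le> real i * M ^ i * \<bar>x - y\<bar>"
proof (induction i)
  case (Suc i)
  have "x ^ Suc i - y ^ Suc i = x * (x ^ i - y ^ i) + (x - y) * y ^ i" by (simp add: algebra_simps)
  then have "\<bar>x ^ Suc i - y ^ Suc i\<bar> \<le> \<bar>x\<bar> * \<bar>x ^ i - y ^ i\<bar> + \<bar>x - y\<bar> * \<bar>y\<bar> ^ i"
    by (metis abs_mult abs_triangle_ineq power_abs)
  also have "\<dots> \<le> M * (real i * M ^ i * \<bar>x - y\<bar>) + \<bar>x - y\<bar> * M ^ i"
    using assms Suc by (intro add_mono mult_mono power_mono) auto
  also have "\<bar>x - y\<bar> * M ^ i \<le> \<bar>x - y\<bar> * M ^ Suc i"
    using assms by (intro mult_left_mono power_increasing) auto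
  finally show ?case by (simp add: algebra_simps)
qed simp

text \<open>With x_0 = q^n the errors are at most a constant times q^n |\<zeta> - p / q| <= q^(n - 1
  - w), and q^(n - 1 - w) is x_0 to the power -(w + 1 - n) / n.\<close>

lemma lam_exp_ge_w_exp_1:
  fixes \<zeta> w :: real
  assumes n: "1 \<le> n" and "0 < w" and less: "ereal w < w_exp 1 \<zeta>"
  shows "ereal ((w + 1 - real n) / real n) \<le> lam_exp n \<zeta>"
proof (rule lam_exp_geI)
  fix B :: real
  define M where "M = \<bar>\<zeta>\<bar> + 1"
  have M1: "1 \<le> M" by (simp add: M_def)
  obtain q p :: int where qp: "1 \<le> q" "B \<le> q" "\<bar>q * \<zeta> - p\<bar> \<le> q powr (- w)"
    by (rule w_exp_1_gtD [OF \<open>0 < w\<close> less, of B])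
  define v where "v = (\<lambda>i. q ^ (n - i) * p ^ i)"
  have v0: "\<bar>v 0\<bar> = q ^ n" using qp(1) by (simp add: v_def)
  have q_le: "q \<le> q ^ n" using qp(1) n by (metis power_increasing power_one_right)
  have "real_of_int q powr (- w) \<le> 1"
    using qp(1) \<open>0 < w\<close> by (simp add: powr_minus ge_one_powr_ge_zero inverse_le_1_iff)
  then have "\<bar>\<zeta> - p / q\<bar> \<le> 1"
  proof -
    have "q * \<bar>\<zeta> - p / q\<bar> = \<bar>q * \<zeta> - p\<bar>"
      using qp(1) by (simp add: field_simps abs_if)
    also have "\<dots> \<le> 1" using qp(3) \<open>real_of_int q powr (- w) \<le> 1\<close> by linarith
    also have "\<dots> \<le> q" using qp(1) by simp
    finally show ?thesis using qp(1) by (simp add: mult_le_cancel_left1)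
  qed
  then have pq: "\<bar>p / q\<bar> \<le> M" by (simp add: M_def)
  have "\<bar>\<zeta> ^ i * v 0 - v i\<bar> \<le> (n * M ^ n) * real_of_int \<bar>v 0\<bar> powr (- ((w + 1 - n) / n))"
    if i: "i \<in> {1..n}" for i
  proof -
    have qi: "real_of_int q ^ n = q ^ (n - i) * q ^ i" using i by (simp flip: power_add)
    have "\<zeta> ^ i * v 0 - v i = q ^ n * (\<zeta> ^ i - (p / q) ^ i)"
      using qp(1) by (simp add: v_def qi power_divide field_simps)
    then have "\<bar>\<zeta> ^ i * v 0 - v i\<bar> = q ^ n * \<bar>\<zeta> ^ i - (p / q) ^ i\<bar>"
      using qp(1) by (simp add: abs_mult)
    also have "\<dots> \<le> q ^ n * (real i * M ^ i * \<bar>\<zeta> - p / q\<bar>)"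
      using qp(1) pq M1 by (intro mult_left_mono power_diff_le) (auto simp: M_def)
    also have "\<dots> \<le> q ^ n * (real n * M ^ n * \<bar>\<zeta> - p / q\<bar>)"
      using qp(1) M1 i by (intro mult_left_mono mult_right_mono mult_mono power_increasing) auto
    also have "\<bar>\<zeta> - p / q\<bar> = \<bar>q * \<zeta> - p\<bar> / q"
      using qp(1) by (simp add: field_simps abs_if)
    also have "q ^ n * (real n * M ^ n * (\<bar>q * \<zeta> - p\<bar> / q)) \<le> q ^ n * (real n * M ^ n * (q powr (- w) / q))"
      using qp M1 by (intro mult_left_mono divide_right_mono) auto
    also have "\<dots> = (n * M ^ n) * (q ^ n * q powr (- w) / q)" by simp
    also have "\<dots> = (n * M ^ n) * real_of_int \<bar>v 0\<bar> powr (- ((w + 1 - n) / n))"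
    proof -
      have "real_of_int q ^ n * q powr (- w) / q = real_of_int q powr (real n - w - 1)"
        using qp(1) by (simp add: powr_diff powr_minus powr_add powr_realpow field_simps)
      also have "real n - w - 1 = real n * (- ((w + 1 - n) / n))" using n by simp
      also have "real_of_int q powr \<dots> = real_of_int \<bar>v 0\<bar> powr (- ((w + 1 - n) / n))"
        unfolding v0 powr_powr [symmetric] using qp(1) by (simp add: powr_realpow)
      finally show ?thesis by simp
    qed
    finally show ?thesis .
  qed
  moreover have "1 \<le> \<bar>v 0\<bar>" unfolding v0 using q_le qp(1) by linarith
  moreover have "B \<le> real_of_int \<bar>v 0\<bar>" unfolding v0 using q_le qp(2) by linarith
  ultimately show "\<exists>v :: nat \<Rightarrow> int. 1 \<le> \<bar>v 0\<bar> \<and> B \<le> real_of_int \<bar>v 0\<bar> \<and>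
     (\<forall>i\<in>{1..n}. \<bar>\<zeta> ^ i * v 0 - v i\<bar> \<le> (n * M ^ n) * real_of_int \<bar>v 0\<bar> powr (- ((w + 1 - n) / n)))"
    by blast
qed

text \<open>Let p / q be x_1 / x_0 in lowest terms. Iterating, x_i q^i = x_0 p^i, and at i = n
  coprimality forces q^n to divide x_0.\<close>

lemma geometric_dvd:
  fixes x :: "nat \<Rightarrow> int"
  assumes "x 0 \<noteq> 0" and geo: "\<And>i. i < n \<Longrightarrow> x 0 * x (Suc i) = x 1 * x i"
  obtains p q :: int where "1 \<le> q" "q ^ n dvd x 0" "x 1 * q = x 0 * p"
proof -
  define g where "g = gcd (x 0) (x 1)"
  obtain q p where q: "x 0 = q * g" and p: "x 1 = p * g" and cop: "coprime q p"
    using gcd_coprime_exists [of "x 0" "x 1"] assms(1) unfolding g_def by auto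
  have pow: "x i * q ^ i = x 0 * p ^ i" if "i \<le> n" for i
    using that
  proof (induction i)
    case (Suc i)
    have "x 0 * (x (Suc i) * q ^ Suc i) = (x 1 * q) * (x i * q ^ i)"
      using geo [of i] Suc.prems by (simp add: algebra_simps)
    also have "\<dots> = x 0 * (x 0 * p ^ Suc i)"
    proof -
      have "x 1 * q = x 0 * p" unfolding p q by simp
      then show ?thesis using Suc by simp
    qed
    finally show ?case using assms(1) by simp
  qed simp
  have "q ^ n dvd x 0 * p ^ n" using pow [of n] by (metis dvd_triv_right order_refl)
  then have "q ^ n dvd x 0" using cop by (simp add: coprime_dvd_mult_left_iff)
  \<comment> \<open>Passing to |q| makes the denominator positive; the numerator takes over the
    sign.\<close>
  then have "\<bar>q\<bar> ^ n dvd x 0" by (simp flip: power_abs)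
  moreover have "1 \<le> \<bar>q\<bar>" using q assms(1) by auto
  moreover have "x 1 * \<bar>q\<bar> = x 0 * (p * sgn q)" unfolding p q by (simp add: abs_sgn)
  ultimately show thesis by (intro that)
qed

lemma w_exp_1_ge_of_geometric:
  fixes \<zeta> l :: real
  assumes irr: "\<zeta> \<notin> \<rat>" and n: "1 \<le> n" and "0 < l"
    and ex: "\<And>B :: real. \<exists>x :: nat \<Rightarrow> int. 1 \<le> \<bar>x 0\<bar> \<and> B \<le> real_of_int \<bar>x 0\<bar> \<and>
      (\<forall>i<n. x 0 * x (Suc i) = x 1 * x i) \<and> \<bar>\<zeta> * x 0 - x 1\<bar> \<le> real_of_int \<bar>x 0\<bar> powr (- l)"
  shows "ereal (real n - 1 + real n * l) \<le> w_exp 1 \<zeta>"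
proof (rule w_exp_1_geI [OF irr])
  show "0 < real n - 1 + real n * l" using n \<open>0 < l\<close> by (intro add_nonneg_pos mult_pos_pos) auto
  fix B :: real
  obtain \<delta> where \<delta>: "0 < \<delta>" "\<forall>(a :: int) (b :: int). a \<noteq> 0 \<and> \<bar>real_of_int a\<bar> \<le> B \<longrightarrow> \<delta> \<le> \<bar>a * \<zeta> - b\<bar>"
    using irrational_dist [OF irr, of B] by blast
  obtain B' where B': "1 \<le> B'" "\<forall>H\<ge>B'. H powr (- l) < \<delta>"
    using powr_minus_eventually_small [OF \<open>0 < l\<close> \<delta>(1)] by blast
  obtain x :: "nat \<Rightarrow> int" where x: "1 \<le> \<bar>x 0\<bar>" "B' \<le> real_of_int \<bar>x 0\<bar>"
      "\<forall>i<n. x 0 * x (Suc i) = x 1 * x i" "\<bar>\<zeta> * x 0 - x 1\<bar> \<le> real_of_int \<bar>x 0\<bar> powr (- l)"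
    using ex by blast
  obtain p q :: int where pq: "1 \<le> q" "q ^ n dvd x 0" "x 1 * q = x 0 * p"
    by (rule geometric_dvd [of x n]) (use x(1,3) in auto)
  define X where "X = real_of_int \<bar>x 0\<bar>"
  have X1: "1 \<le> X" using x(1) by (simp add: X_def)
  have "q ^ n \<le> \<bar>x 0\<bar>" using pq x(1) dvd_imp_le_int [of "x 0" "q ^ n"] by simp
  then have qX: "real_of_int q ^ n \<le> X" unfolding X_def by (metis of_int_le_iff of_int_power)
  have "real_of_int q \<le> real_of_int q ^ n" using pq(1) n by (metis of_int_1_le_iff power_increasing power_one_right)
  then have qX1: "real_of_int q \<le> X" using qX by linarith
  have "X * \<bar>q * \<zeta> - p\<bar> = \<bar>q * (\<zeta> * x 0) - x 0 * p\<bar>"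
    by (simp add: X_def abs_mult [symmetric] algebra_simps)
  also have "x 0 * p = x 1 * q" using pq(3) by simp
  also have "\<bar>q * (\<zeta> * x 0) - real_of_int (x 1 * q)\<bar> = q * \<bar>\<zeta> * x 0 - x 1\<bar>"
    using pq(1) by (simp add: abs_mult_pos' algebra_simps)
  also have "\<dots> \<le> q * X powr (- l)" unfolding X_def using x(4) pq(1) by (intro mult_left_mono) auto
  finally have main: "X * \<bar>q * \<zeta> - p\<bar> \<le> q * X powr (- l)" .
  also have "\<dots> \<le> X * X powr (- l)" using qX1 by (intro mult_right_mono) auto
  finally have "\<bar>q * \<zeta> - p\<bar> \<le> X powr (- l)" using X1 by simp
  then have "\<bar>q * \<zeta> - p\<bar> < \<delta>" using B'(2) x(2) by (fastforce simp: X_def)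
  \<comment> \<open>A large x_0 alone does not make q large; the small value of the form
    does.\<close>
  then have "\<not> \<bar>real_of_int q\<bar> \<le> B" using \<delta>(2) pq(1) by (metis not_less not_one_le_zero)
  then have "B \<le> q" using pq(1) by simp
  have "\<bar>q * \<zeta> - p\<bar> \<le> q * X powr (- l) / X" using main X1 by (simp add: field_simps)
  also have "\<dots> = q * X powr (- (l + 1))" 
    using X1 powr_add [of X "- l" "- 1"] by (simp add: powr_minus divide_inverse)
  also have "\<dots> \<le> q * (real_of_int q ^ n) powr (- (l + 1))"
    using qX pq(1) \<open>0 < l\<close> by (intro mult_left_mono powr_mono2') auto
  also have "\<dots> = real_of_int q powr 1 * q powr (- (real n * (l + 1)))"
    using pq(1) by (simp add: powr_powr algebra_simps flip: powr_realpow)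
  also have "\<dots> = 1 * q powr (- (real n - 1 + real n * l))"
    using pq(1) by (simp only: powr_add [symmetric]) (simp add: algebra_simps)
  finally show "\<exists>(q :: int) (p :: int). (1::int) \<le> q \<and> B \<le> q \<and>
      \<bar>q * \<zeta> - p\<bar> \<le> 1 * q powr (- (real n - 1 + real n * l))"
    using pq(1) \<open>B \<le> q\<close> by blast
qed

lemma int_zero_of_small:
  fixes z :: int
  assumes "\<bar>real_of_int z\<bar> < 1"
  shows "z = 0"
  using assms by linarith

lemma w_exp_1_ge_lam_exp:
  fixes \<zeta> l :: real
  assumes irr: "\<zeta> \<notin> \<rat>" and n: "1 \<le> n" and "1 < l" and less: "ereal l < lam_exp n \<zeta>"
  shows "ereal (real n - 1 + real n * l) \<le> w_exp 1 \<zeta>"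
proof (rule w_exp_1_ge_of_geometric [OF irr n])
  show "0 < l" using \<open>1 < l\<close> by simp
  fix B :: real
  define M where "M = (\<bar>\<zeta>\<bar> + 1) ^ n"
  have M1: "1 \<le> M" by (simp add: M_def)
  obtain B' where B': "1 \<le> B'" "\<forall>H\<ge>B'. H powr (- (l - 1)) < 1 / (4 * M)"
    using powr_minus_eventually_small [of "l - 1" "1 / (4 * M)"] \<open>1 < l\<close> M1 by auto
  obtain x :: "nat \<Rightarrow> int" where x: "1 \<le> \<bar>x 0\<bar>" "max B B' \<le> real_of_int \<bar>x 0\<bar>"
     "\<forall>i\<in>{1..n}. \<bar>\<zeta> ^ i * x 0 - x i\<bar> \<le> real_of_int \<bar>x 0\<bar> powr (- l)"
    using lam_exp_gtD [OF irr n \<open>0 < l\<close> less] by blast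
  define X where "X = real_of_int \<bar>x 0\<bar>"
  define e where "e = (\<lambda>i. x i - \<zeta> ^ i * x 0)"
  have X1: "1 \<le> X" using x(1) by (simp add: X_def)
  have e: "\<bar>e i\<bar> \<le> X powr (- l)" if "i \<le> n" for i
    using x(3) that by (cases "i = 0") (auto simp: e_def X_def abs_minus_commute)
  have pow: "\<bar>\<zeta>\<bar> ^ i \<le> M" if "i \<le> n" for i
  proof -
    have "\<bar>\<zeta>\<bar> ^ i \<le> (\<bar>\<zeta>\<bar> + 1) ^ i" by (intro power_mono) auto
    also have "\<dots> \<le> M" unfolding M_def using that by (intro power_increasing) auto
    finally show ?thesis .
  qed
  have "x 0 * x (Suc i) = x 1 * x i" if i: "i < n" for i
  proof -
    \<comment> \<open>The leading terms \<zeta>^(i + 1) x_0^2 cancel; every remaining term carries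
      an error, so the minor has size X^(1 - l).\<close>
    have "real_of_int (x 0 * x (Suc i) - x 1 * x i)
       = x 0 * e (Suc i) - e 1 * \<zeta> ^ i * x 0 - \<zeta> * x 0 * e i - e 1 * e i"
      by (simp add: e_def algebra_simps)
    also have "\<bar>\<dots>\<bar> \<le> \<bar>x 0 * e (Suc i)\<bar> + \<bar>e 1 * \<zeta> ^ i * x 0\<bar> + \<bar>\<zeta> * x 0 * e i\<bar> + \<bar>e 1 * e i\<bar>"
      by linarith
    also have "\<dots> = X * \<bar>e (Suc i)\<bar> + \<bar>e 1\<bar> * \<bar>\<zeta>\<bar> ^ i * X + \<bar>\<zeta>\<bar> * X * \<bar>e i\<bar> + \<bar>e 1\<bar> * \<bar>e i\<bar>"
      by (simp add: X_def abs_mult power_abs)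
    also have "\<dots> \<le> X * X powr (- l) + X powr (- l) * M * X + M * X * X powr (- l) + X * X powr (- l)"
    proof (intro add_mono mult_mono)
      have "X powr (- l) \<le> X powr 0" using X1 \<open>0 < l\<close> by (intro powr_mono) auto
      then show "\<bar>e 1\<bar> \<le> X" using e [of 1] n X1 by simp
    qed (use e [of "Suc i"] e [of 1] e [of i] pow [of i] pow [of 1] i n X1 M1 in auto)
    also have "\<dots> = X * X powr (- l) * (2 + 2 * M)" by (simp add: algebra_simps)
    also have "\<dots> \<le> X * X powr (- l) * (4 * M)" using M1 X1 by (intro mult_left_mono) auto
    also have "X * X powr (- l) = X powr (- (l - 1))" using X1 by (simp add: powr_diff powr_minus field_simps)
    also have "X powr (- (l - 1)) * (4 * M) < 1 / (4 * M) * (4 * M)"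
      using B'(2) x(2) M1 by (intro mult_strict_right_mono) (auto simp: X_def)
    also have "\<dots> = 1" using M1 by simp
    finally show ?thesis using int_zero_of_small by fastforce
  qed
  moreover have "\<bar>\<zeta> * x 0 - x 1\<bar> \<le> real_of_int \<bar>x 0\<bar> powr (- l)" using x(3) n by force
  ultimately show "\<exists>x :: nat \<Rightarrow> int. 1 \<le> \<bar>x 0\<bar> \<and> B \<le> real_of_int \<bar>x 0\<bar> \<and>
      (\<forall>i<n. x 0 * x (Suc i) = x 1 * x i) \<and> \<bar>\<zeta> * x 0 - x 1\<bar> \<le> real_of_int \<bar>x 0\<bar> powr (- l)"
    using x(1,2) by auto
qed

lemma lam_exp_le:
  fixes \<zeta> w :: real
  assumes irr: "\<zeta> \<notin> \<rat>" and n: "1 \<le> n" and w: "w_exp 1 \<zeta> \<le> ereal w"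
  shows "lam_exp n \<zeta> \<le> ereal (max 1 ((w + 1 - real n) / real n))"
proof (rule ccontr)
  assume "\<not> ?thesis"
  then obtain l where l: "ereal (max 1 ((w + 1 - real n) / real n)) < ereal l" "ereal l < lam_exp n \<zeta>"
    using ereal_dense2 by (metis not_le)
  then have "ereal (real n - 1 + real n * l) \<le> w_exp 1 \<zeta>"
    using irr n by (intro w_exp_1_ge_lam_exp) auto
  then have "real n - 1 + real n * l \<le> w" using w by (metis ereal_less_eq(3) order_trans)
  moreover have "w + 1 - real n < real n * l" using l(1) n by (simp add: field_simps)
  ultimately show False by simp
qed

text \<open>The minors are now formed from two solutions rather than inside one. Those involving
  coordinate 0 are at most 2 X^(1 - l) < 1, hence vanish, and the solutions are
  proportional.\<close>

lemma lam_exp_2_le_1: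
  assumes n: "1 \<le> n"
  shows "lam_exp_j n 2 \<zeta> \<le> 1"
proof (rule ccontr)
  assume "\<not> ?thesis"
  then obtain l where l: "1 < ereal l" "ereal l < lam_exp_j n 2 \<zeta>"
    using ereal_dense2 by (metis not_le)
  have l1: "1 < l" using l(1) by simp
  obtain B where B: "1 \<le> B" "\<forall>H\<ge>B. H powr (- (l - 1)) < 1 / 2"
    using powr_minus_eventually_small [of "l - 1" "1 / 2"] l1 by auto
  obtain X v where X: "B \<le> X" and sol: "\<forall>k<2. approx_sol n \<zeta> l X (v k)" and ind: "lin_indep n 2 v"
    using lam_exp_j_gtD [OF l(2)] by blast
  have X1: "1 \<le> X" using B X by simp
  have v0: "1 \<le> \<bar>v k 0\<bar>" "real_of_int \<bar>v k 0\<bar> \<le> X"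
    and app: "i \<in> {1..n} \<Longrightarrow> \<bar>\<zeta> ^ i * v k 0 - v k i\<bar> \<le> X powr (- l)" if "k < 2" for k i
    using sol that unfolding approx_sol_def by auto
  have minor: "v 0 0 * v 1 i = v 1 0 * v 0 i" if i: "i \<le> n" for i
  proof (cases "i = 0")
    case False
    have "real_of_int (v 0 0 * v 1 i - v 1 0 * v 0 i)
      = v 1 0 * (\<zeta> ^ i * v 0 0 - v 0 i) - v 0 0 * (\<zeta> ^ i * v 1 0 - v 1 i)"
      by (simp add: algebra_simps)
    also have "\<bar>\<dots>\<bar> \<le> \<bar>real_of_int (v 1 0)\<bar> * \<bar>\<zeta> ^ i * v 0 0 - v 0 i\<bar> + \<bar>real_of_int (v 0 0)\<bar> * \<bar>\<zeta> ^ i * v 1 0 - v 1 i\<bar>"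
      unfolding abs_mult [symmetric] by linarith
    also have "\<dots> \<le> X * X powr (- l) + X * X powr (- l)"
      using v0 [of 0] v0 [of 1] app [of 0 i] app [of 1 i] False i X1 by (intro add_mono mult_mono) auto
    also have "\<dots> = 2 * X powr (- (l - 1))" using X1 by (simp add: powr_diff powr_minus field_simps)
    also have "\<dots> < 1" using B(2) X by fastforce
    finally show ?thesis using int_zero_of_small by fastforce
  qed simp
  define c where "c = (\<lambda>k :: nat. if k = 0 then real_of_int (v 1 0) else - real_of_int (v 0 0))"
  have "(\<Sum>k<2. c k * real_of_int (v k i)) = 0" if "i \<le> n" for i
    using minor [OF that] by (simp add: numeral_2_eq_2 c_def flip: of_int_mult)
  then have "c 0 = 0" using ind unfolding lin_indep_def by auto
  then show False using v0(1) [of 1] by (simp add: c_def)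
qed

lemma lam_exp_2_le: "lam_exp_j n 2 \<zeta> \<le> lam_exp n \<zeta>"
proof (rule dense_le)
  fix y assume y: "y < lam_exp_j n 2 \<zeta>"
  obtain l where l: "y < ereal l" "ereal l < lam_exp_j n 2 \<zeta>" using ereal_dense2 [OF y] by blast
  have "ereal l \<le> lam_exp_j n 1 \<zeta>"
  proof (rule lam_exp_j_geI)
    fix B :: real
    obtain X and v :: "nat \<Rightarrow> nat \<Rightarrow> int" where X: "B \<le> X" and sol: "\<forall>k<2. approx_sol n \<zeta> l X (v k)"
      using lam_exp_j_gtD [OF l(2)] by blast
    have "approx_sol n \<zeta> l X (v 0)" using sol by simp
    moreover from this have "lin_indep n 1 v" by (intro lin_indep_1) (auto simp: approx_sol_def)
    ultimately show "\<exists>X\<ge>B. \<exists>v. (\<forall>k<1. approx_sol n \<zeta> l X (v k)) \<and> lin_indep n 1 v"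
      using X by (intro exI [of _ X] conjI exI [of _ v]) auto
  qed
  then show "y \<le> lam_exp n \<zeta>" using l(1) by (simp add: lam_exp_def)
qed

section \<open>Elementary bounds for w_n\<close>

text \<open>At a / b a nonzero value of a polynomial of degree at most n is at least b^(-n) in
  absolute value, whatever its height. In particular a \<open>U2_number\<close> is
  irrational.\<close>

lemma w_exp_rational_le_0:
  assumes "\<zeta> \<in> \<rat>"
  shows "w_exp n \<zeta> \<le> 0"
proof (rule ccontr)
  assume "\<not> ?thesis"
  then obtain w where w: "0 < ereal w" "ereal w < w_exp n \<zeta>"
    using ereal_dense2 by (metis not_le)
  obtain a b :: int where ab: "0 < b" "\<zeta> = a / b" using assms by (meson Rats_cases')
  have "\<exists>B\<ge>1. \<forall>H\<ge>B. H powr (- w) < 1 / b ^ n"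
    by (rule powr_minus_eventually_small) (use w(1) ab(1) in auto)
  then obtain B where B: "1 \<le> B" "\<forall>H\<ge>B. H powr (- w) < 1 / b ^ n" by blast
  obtain P :: "int poly" where P: "degree P \<le> n" "B \<le> height P"
    "0 < \<bar>poly (map_poly of_int P) \<zeta>\<bar>"
    "\<bar>poly (map_poly of_int P) \<zeta>\<bar> \<le> real_of_int (height P) powr (- w)"
    by (rule w_exp_gtD [OF w(2), of B])
  define Z where "Z = (\<Sum>i\<le>n. coeff P i * a ^ i * b ^ (n - i))"
  have "b ^ n * poly (map_poly of_int P) \<zeta> = Z"
    unfolding poly_of_int_altdef [OF P(1)] Z_def sum_distrib_left of_int_sum
  proof (rule sum.cong)
    fix i assume "i \<in> {..n}"
    then have "real_of_int b ^ n = b ^ (n - i) * b ^ i" by (simp flip: power_add)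
    then show "real_of_int (b ^ n) * (real_of_int (coeff P i) * \<zeta> ^ i) = real_of_int (coeff P i * a ^ i * b ^ (n - i))"
      using ab(1) by (simp add: ab(2) power_divide)
  qed simp
  then have val: "poly (map_poly of_int P) \<zeta> = Z / b ^ n" using ab(1) by (simp add: field_simps)
  then have "Z \<noteq> 0" using P(3) by auto
  then have "1 \<le> \<bar>real_of_int Z\<bar>" by linarith
  then have "1 / b ^ n \<le> \<bar>poly (map_poly of_int P) \<zeta>\<bar>"
    using ab(1) by (simp add: val divide_right_mono)
  moreover have "real_of_int (height P) powr (- w) < 1 / b ^ n" using B(2) P(2) by blast
  ultimately show False using P(4) by linarith
qed

text \<open>Dirichlet's theorem, with 1 / N below all distances attained by denominators up to
  \<open>B\<close>, yields a denominator beyond \<open>B\<close>.\<close>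

lemma w_exp_1_ge_1:
  assumes irr: "\<zeta> \<notin> \<rat>"
  shows "1 \<le> w_exp 1 \<zeta>"
proof -
  have "ereal 1 \<le> w_exp 1 \<zeta>"
  proof (rule w_exp_1_geI [OF irr])
    fix B :: real
    obtain \<delta> where \<delta>: "0 < \<delta>" "\<forall>(a :: int) (b :: int). a \<noteq> 0 \<and> \<bar>real_of_int a\<bar> \<le> B \<longrightarrow> \<delta> \<le> \<bar>a * \<zeta> - b\<bar>"
      using irrational_dist [OF irr, of B] by blast
    obtain N :: nat where N: "0 < N" "1 / N < \<delta>"
      using \<delta>(1) by (metis gr_zeroI inverse_eq_divide real_arch_inverse)
    obtain p q where pq: "0 < q" "q \<le> int N" "\<bar>of_int q * \<zeta> - of_int p\<bar> < 1 / N"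
      by (rule Dirichlet_approx [OF N(1)])
    have "\<not> \<bar>real_of_int q\<bar> \<le> B"
    proof
      assume "\<bar>real_of_int q\<bar> \<le> B"
      then have "\<delta> \<le> \<bar>q * \<zeta> - p\<bar>" using \<delta>(2) pq(1) by simp
      then show False using pq(3) N(2) by linarith
    qed
    moreover have "1 / N \<le> 1 / real_of_int q"
      using pq(1,2) by (intro divide_left_mono) (auto simp: of_int_le_iff [symmetric, where 'a = real] simp del: of_int_le_iff)
    then have "\<bar>q * \<zeta> - p\<bar> \<le> 1 * q powr (- 1)"
      using pq(1,3) by (simp add: powr_minus_divide)
    ultimately show "\<exists>(q :: int) (p :: int). (1 :: int) \<le> q \<and> B \<le> q \<and> \<bar>q * \<zeta> - p\<bar> \<le> 1 * q powr (- 1)"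
      using pq(1) by (intro exI [of _ q] exI [of _ p]) auto
  qed simp
  then show ?thesis by (simp add: one_ereal_def)
qed

section \<open>Small values of quadratic polynomials\<close>

text \<open>Both pairs have size at most 1 / \<delta> and error at most \<delta>, essentially the
  best balance for independent points. The second completes (a, b) to a unimodular matrix, which
  leaves the freedom of adding multiples of (a, b).\<close>

lemma approx_pair:
  fixes \<zeta> :: real and N :: nat
  assumes irr: "\<zeta> \<notin> \<rat>" and N: "0 < N"
  obtains a b a' b' :: int and \<delta> :: real where
    "1 \<le> a" "a \<le> int N" "0 < \<delta>" "\<delta> < 1 / N" "\<bar>a * \<zeta> - b\<bar> = \<delta>"
    "1 \<le> a'" "a' * \<delta> \<le> 1" "\<bar>a' * \<zeta> - b'\<bar> \<le> \<delta>" "a * b' \<noteq> b * a'"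
proof -
  obtain b a where ab: "coprime b a" "0 < a" "a \<le> int N" "\<bar>of_int a * \<zeta> - of_int b\<bar> < 1 / N"
    by (rule Dirichlet_approx_coprime [OF N])
  define \<delta> where "\<delta> = \<bar>a * \<zeta> - b\<bar>"
  have \<delta>0: "0 < \<delta>" unfolding \<delta>_def using irrational_form_nonzero [OF irr, of a b] ab(2) by simp
  define \<sigma> :: int where "\<sigma> = (if 0 \<le> a * \<zeta> - b then 1 else - 1)"
  have \<sigma>: "a * \<zeta> - b = \<sigma> * \<delta>" by (simp add: \<sigma>_def \<delta>_def)
  obtain u v where uv: "u * a + v * b = 1"
    using bezout_int [of a b] ab(1) by (auto simp: coprime_iff_gcd_eq_1 gcd.commute)
  \<comment> \<open>This multiple puts a' between 1 / \<delta> - a and 1 / \<delta>, so |a' \<delta>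
    - 1| <= a \<delta>; the determinant identity turns this into the error bound.\<close>
  define t where "t = \<lfloor>(1 / \<delta> + \<sigma> * v) / a\<rfloor>"
  define a' b' where "a' = - \<sigma> * v + t * a" and "b' = \<sigma> * u + t * b"
  have det: "a' * b - a * b' = - \<sigma>"
  proof -
    have "a' * b - a * b' = - \<sigma> * (u * a + v * b)" unfolding a'_def b'_def by (simp add: algebra_simps)
    then show ?thesis using uv by simp
  qed
  have "t * a \<le> 1 / \<delta> + \<sigma> * v" "1 / \<delta> + \<sigma> * v < (t + 1) * a"
    using ab(2) floor_divide_lower [of "real_of_int a" "1 / \<delta> + \<sigma> * v"]
      floor_divide_upper [of "real_of_int a" "1 / \<delta> + \<sigma> * v"] unfolding t_def by auto
  then have a'_up: "real_of_int a' \<le> 1 / \<delta>" and a'_low: "1 / \<delta> - a < a'"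
    unfolding a'_def by (simp_all add: algebra_simps)
  have "\<delta> < 1 / N" unfolding \<delta>_def by (rule ab(4))
  then have "real N < 1 / \<delta>" using N \<delta>0 by (simp add: field_simps)
  moreover have "real_of_int a \<le> real N" using ab(3) by linarith
  ultimately have "0 < real_of_int a'" using a'_low by linarith
  then have a'1: "1 \<le> a'" by linarith
  have a'd: "a' * \<delta> \<le> 1" using a'_up \<delta>0 by (simp add: field_simps)
  have "1 - a * \<delta> < a' * \<delta>" using a'_low \<delta>0 by (simp add: field_simps)
  then have bnd: "\<bar>a' * \<delta> - 1\<bar> \<le> a * \<delta>" using a'd by linarith
  have "a * (a' * \<zeta> - b') = a' * (a * \<zeta> - b) + real_of_int (a' * b - a * b')"
    by (simp add: algebra_simps)
  also have "\<dots> = \<sigma> * (a' * \<delta> - 1)" unfolding det \<sigma> by (simp add: algebra_simps)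
  finally have "\<bar>a * (a' * \<zeta> - b')\<bar> = \<bar>a' * \<delta> - 1\<bar>" by (simp add: abs_mult \<sigma>_def)
  then have "a * \<bar>a' * \<zeta> - b'\<bar> \<le> a * \<delta>" using bnd ab(2) by (simp add: abs_mult)
  then have "\<bar>a' * \<zeta> - b'\<bar> \<le> \<delta>" using ab(2) by simp
  moreover have "a * b' \<noteq> b * a'" using det by (auto simp: \<sigma>_def mult.commute split: if_splits)
  ultimately show thesis using ab \<delta>0 a'1 a'd by (intro that [of a \<delta> b a' b']) (auto simp: \<delta>_def)
qed

section \<open>Integer vectors from quadratic recurrences\<close>

text \<open>If y_0 = a, y_1 = b and p2 y_(i+2) + p1 y_(i+1) + p0 y_i = 0, this is p2^i y_i, the
  factor clearing the denominators.\<close>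

fun quad_rec :: "int \<Rightarrow> int \<Rightarrow> int \<Rightarrow> int \<Rightarrow> int \<Rightarrow> nat \<Rightarrow> int" where
  "quad_rec p0 p1 p2 a b 0 = a"
| "quad_rec p0 p1 p2 a b (Suc 0) = p2 * b"
| "quad_rec p0 p1 p2 a b (Suc (Suc i)) =
     - (p1 * quad_rec p0 p1 p2 a b (Suc i) + p0 * p2 * quad_rec p0 p1 p2 a b i)"

text \<open>The errors against (p2 \<zeta>)^i a satisfy the same recurrence with inhomogeneity
  p2^(i+1) \<zeta>^i a P(\<zeta>), up to sign, for P = p0 + p1 T + p2 T^2. Three terms contribute at
  each step, hence the 3 in the growth rate.\<close>

lemma quad_rec_error:
  fixes \<zeta> H :: real and p0 p1 p2 a b :: int
  assumes H: "1 \<le> H" "\<bar>p0\<bar> \<le> H" "\<bar>p1\<bar> \<le> H" "\<bar>p2\<bar> \<le> H"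
  shows "\<bar>quad_rec p0 p1 p2 a b i - (p2 * \<zeta>) ^ i * a\<bar>
    \<le> (3 * (1 + \<bar>\<zeta>\<bar>) * H\<^sup>2) ^ i * (\<bar>a * \<zeta> - b\<bar> + \<bar>a\<bar> * \<bar>p0 + p1 * \<zeta> + p2 * \<zeta>\<^sup>2\<bar>)"
proof (induction i rule: induct_nat_012)
  define G where "G = 3 * (1 + \<bar>\<zeta>\<bar>) * H\<^sup>2"
  define E where "E = \<bar>a * \<zeta> - b\<bar> + \<bar>a\<bar> * \<bar>p0 + p1 * \<zeta> + p2 * \<zeta>\<^sup>2\<bar>"
  define f where "f = (\<lambda>i. quad_rec p0 p1 p2 a b i - (p2 * \<zeta>) ^ i * a)"
  have E0: "0 \<le> E" by (simp add: E_def)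
  have HH: "H \<le> H\<^sup>2" using H(1) by (simp add: power2_eq_square)
  have HG: "3 * H\<^sup>2 \<le> G" using H(1) by (simp add: G_def mult_le_cancel_right1 algebra_simps)
  have HG1: "3 * H \<le> G" using HG HH by linarith
  have G1: "1 \<le> G" using HG1 H(1) by linarith
  {
    case 0
    then show ?case by simp
  next
    case 1
    have "\<bar>f 1\<bar> = \<bar>p2\<bar> * \<bar>a * \<zeta> - b\<bar>"
      by (simp add: f_def abs_mult [symmetric] abs_minus_commute algebra_simps)
    also have "\<dots> \<le> G * E" using H G1 HG1 by (intro mult_mono) (auto simp: E_def)
    finally show ?case by (simp add: f_def G_def E_def)
  next
    case (ge2 i)
    have HE: "real_of_int \<bar>a\<bar> * \<bar>p0 + p1 * \<zeta> + p2 * \<zeta>\<^sup>2\<bar> \<le> E" by (simp add: E_def)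
    have IH: "\<bar>f i\<bar> \<le> G ^ i * E" "\<bar>f (Suc i)\<bar> \<le> G ^ Suc i * E"
      using ge2 by (simp_all add: f_def G_def E_def)
    have "f (Suc (Suc i)) = - (p1 * f (Suc i)) - p0 * p2 * f i
        - p2 ^ Suc i * \<zeta> ^ i * (a * (p0 + p1 * \<zeta> + p2 * \<zeta>\<^sup>2))"
      by (simp add: f_def algebra_simps power2_eq_square power_mult_distrib)
    then have "\<bar>f (Suc (Suc i))\<bar> \<le> \<bar>p1 * f (Suc i)\<bar> + \<bar>p0 * p2 * f i\<bar>
        + \<bar>p2 ^ Suc i * \<zeta> ^ i * (a * (p0 + p1 * \<zeta> + p2 * \<zeta>\<^sup>2))\<bar>" by linarith
    also have "\<dots> = \<bar>real_of_int p1\<bar> * \<bar>f (Suc i)\<bar> + \<bar>real_of_int p0\<bar> * \<bar>real_of_int p2\<bar> * \<bar>f i\<bar>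
        + \<bar>real_of_int p2\<bar> ^ Suc i * \<bar>\<zeta>\<bar> ^ i * (\<bar>a\<bar> * \<bar>p0 + p1 * \<zeta> + p2 * \<zeta>\<^sup>2\<bar>)"
      by (simp add: abs_mult power_abs)
    also have "\<dots> \<le> H * (G ^ Suc i * E) + H * H * (G ^ i * E) + H ^ Suc i * (1 + \<bar>\<zeta>\<bar>) ^ i * E"
      using H IH E0 G1 HE by (intro add_mono mult_mono power_mono) simp_all
    also have "\<dots> \<le> G / 3 * (G ^ Suc i * E) + G / 3 * (G ^ Suc i * E) + G / 3 * (G ^ Suc i * E)"
    proof (intro add_mono)
      show "H * (G ^ Suc i * E) \<le> G / 3 * (G ^ Suc i * E)"
        using HG1 G1 E0 by (intro mult_right_mono) auto
      show "H * H * (G ^ i * E) \<le> G / 3 * (G ^ Suc i * E)"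
      proof -
        have "H * H * (G ^ i * E) \<le> G / 3 * (G ^ i * E)"
          using HG G1 E0 by (intro mult_right_mono) (auto simp: power2_eq_square)
        also have "\<dots> \<le> G / 3 * (G ^ Suc i * E)"
          using G1 E0 by (intro mult_left_mono mult_right_mono power_increasing) auto
        finally show ?thesis .
      qed
      show "H ^ Suc i * (1 + \<bar>\<zeta>\<bar>) ^ i * E \<le> G / 3 * (G ^ Suc i * E)"
      proof -
        have "(1 + \<bar>\<zeta>\<bar>) * H \<le> (1 + \<bar>\<zeta>\<bar>) * H\<^sup>2" using HH by (intro mult_left_mono) auto
        also have "\<dots> \<le> 3 * ((1 + \<bar>\<zeta>\<bar>) * H\<^sup>2)" by simp
        also have "\<dots> = G" by (simp add: G_def)
        finally have "((1 + \<bar>\<zeta>\<bar>) * H) ^ i \<le> G ^ i" using H(1) by (intro power_mono) auto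
        also have "\<dots> \<le> G ^ Suc i" using G1 by (intro power_increasing) auto
        finally have *: "((1 + \<bar>\<zeta>\<bar>) * H) ^ i \<le> G ^ Suc i" .
        have "H ^ Suc i * (1 + \<bar>\<zeta>\<bar>) ^ i * E = H * (((1 + \<bar>\<zeta>\<bar>) * H) ^ i * E)"
          by (simp add: power_mult_distrib)
        also have "\<dots> \<le> G / 3 * (G ^ Suc i * E)"
          using HG1 G1 E0 H(1) * by (intro mult_mono mult_right_mono) auto
        finally show ?thesis .
      qed
    qed
    also have "\<dots> = G ^ Suc (Suc i) * E" by simp
    finally show ?case by (simp add: f_def G_def E_def)
  }
qed

lemma quadratic_vector:
  fixes \<zeta> H :: real and p0 p1 p2 a b :: int
  assumes H: "1 \<le> H" "\<bar>p0\<bar> \<le> H" "\<bar>p1\<bar> \<le> H" "\<bar>p2\<bar> \<le> H" and n: "1 \<le> n"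
  shows "\<exists>v :: nat \<Rightarrow> int. v 0 = p2 ^ n * a \<and> v 1 = p2 ^ n * b \<and>
    (\<forall>i\<in>{1..n}. \<bar>\<zeta> ^ i * v 0 - v i\<bar> \<le>
      (3 * (1 + \<bar>\<zeta>\<bar>) * H\<^sup>2) ^ n * (\<bar>a * \<zeta> - b\<bar> + \<bar>a\<bar> * \<bar>p0 + p1 * \<zeta> + p2 * \<zeta>\<^sup>2\<bar>))"
proof (intro exI conjI ballI)
  define s where "s = quad_rec p0 p1 p2 a b"
  \<comment> \<open>For the rational sequence y_i with \<open>s i\<close> = p2^i y_i this is p2^n
    y_i, one common factor for all coordinates.\<close>
  define v where "v = (\<lambda>i. p2 ^ (n - i) * s i)"
  define G where "G = 3 * (1 + \<bar>\<zeta>\<bar>) * H\<^sup>2"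
  define E where "E = \<bar>a * \<zeta> - b\<bar> + \<bar>a\<bar> * \<bar>p0 + p1 * \<zeta> + p2 * \<zeta>\<^sup>2\<bar>"
  show "v 0 = p2 ^ n * a" by (simp add: v_def s_def)
  show "v 1 = p2 ^ n * b" using n by (simp add: v_def s_def power_eq_if)
  have "H \<le> H\<^sup>2" using H(1) by (simp add: power2_eq_square)
  moreover have "H\<^sup>2 \<le> G" using H(1) by (simp add: G_def mult_le_cancel_right1 algebra_simps)
  ultimately have HG: "H \<le> G" by linarith
  fix i assume i: "i \<in> {1..n}"
  have pn: "real_of_int p2 ^ n = p2 ^ (n - i) * p2 ^ i" using i by (simp flip: power_add)
  have "\<zeta> ^ i * v 0 - v i = - (p2 ^ (n - i) * (s i - (p2 * \<zeta>) ^ i * a))"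
    by (simp add: v_def s_def pn power_mult_distrib algebra_simps)
  then have "\<bar>\<zeta> ^ i * v 0 - v i\<bar> = \<bar>real_of_int p2\<bar> ^ (n - i) * \<bar>s i - (p2 * \<zeta>) ^ i * a\<bar>"
    by (simp add: abs_mult power_abs)
  also have "\<dots> \<le> G ^ (n - i) * (G ^ i * E)"
  proof (intro mult_mono power_mono)
    show "\<bar>real_of_int p2\<bar> \<le> G" using H(4) HG by linarith
    show "\<bar>s i - (p2 * \<zeta>) ^ i * a\<bar> \<le> G ^ i * E"
      using quad_rec_error [OF H, of a b i \<zeta>] by (simp add: G_def E_def s_def)
    show "0 \<le> G ^ (n - i)" using HG H(1) by simp
  qed auto
  also have "\<dots> = G ^ n * E" using i by (simp flip: power_add mult.assoc)
  finally show "\<bar>\<zeta> ^ i * v 0 - v i\<bar> \<le>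
      (3 * (1 + \<bar>\<zeta>\<bar>) * H\<^sup>2) ^ n * (\<bar>a * \<zeta> - b\<bar> + \<bar>a\<bar> * \<bar>p0 + p1 * \<zeta> + p2 * \<zeta>\<^sup>2\<bar>)"
    by (simp add: G_def E_def)
qed

section \<open>Independent solutions from small quadratic polynomials\<close>

text \<open>The value at \<zeta> may be 0, so U_2-numbers and quadratic irrationals are treated
  alike. \<open>H\<close> is a bound for the coefficients rather than the height, and can therefore
  grow while the polynomial stays fixed.\<close>

definition small_quadratics :: "real \<Rightarrow> bool" where
  "small_quadratics \<zeta> \<longleftrightarrow> (\<forall>(M :: real) (B :: real). \<exists>H\<ge>B. \<exists>(p0 :: int) (p1 :: int) (p2 :: int). p2 \<noteq> 0 \<and>
     \<bar>real_of_int p0\<bar> \<le> H \<and> \<bar>real_of_int p1\<bar> \<le> H \<and> \<bar>real_of_int p2\<bar> \<le> H \<and>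
     \<bar>real_of_int p0 + real_of_int p1 * \<zeta> + real_of_int p2 * \<zeta>\<^sup>2\<bar> \<le> H powr (- M))"

text \<open>For coefficients up to H take approximations of quality \<delta> <= H^(-m) with m large,
  so that powers of H with exponents depending only on n are negligible against \<delta>. Finite w_1
  keeps \<delta> above a fixed power of H, so P(\<zeta>) can be pushed below \<delta>^2.\<close>

lemma lam_exp_2_ge_1:
  fixes \<zeta> :: real
  assumes irr: "\<zeta> \<notin> \<rat>" and n: "1 \<le> n" and w1: "w_exp 1 \<zeta> < \<infinity>" and sq: "small_quadratics \<zeta>"
  shows "1 \<le> lam_exp_j n 2 \<zeta>"
proof (rule dense_le)
  fix y :: ereal assume "y < 1"
  then have "max y 0 < 1" by simp
  then obtain l where l: "max y 0 < ereal l" "ereal l < 1" using ereal_dense2 by blast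
  then have l01: "0 < l" "l < 1" by auto
  obtain W0 where "w_exp 1 \<zeta> < ereal W0" using ereal_dense2 [OF w1] by blast
  define W where "W = max W0 1"
  have W: "1 \<le> W" "w_exp 1 \<zeta> < ereal W"
    using \<open>w_exp 1 \<zeta> < ereal W0\<close> by (auto simp: W_def less_max_iff_disj)
  have "\<exists>c>0. c \<le> 1 \<and> (\<forall>(q :: int) (p :: int). (1 :: int) \<le> q \<longrightarrow> c * q powr (- W) \<le> \<bar>q * \<zeta> - p\<bar>)"
    using W by (intro w_exp_1_lessD [OF irr]) auto
  then obtain c where c: "0 < c" "\<forall>(q :: int) (p :: int). (1 :: int) \<le> q \<longrightarrow> c * q powr (- W) \<le> \<bar>q * \<zeta> - p\<bar>"
    by blast
  define K where "K = 2 * (3 * (1 + \<bar>\<zeta>\<bar>)) ^ n"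
  \<comment> \<open>The factor \<delta>^(1 - l) <= H^(-m (1 - l)) has to absorb H^(3 n + 1): H^(2 n
    + 1) stems from the error bound and its constant, H^n from X^(-l).\<close>
  obtain m :: nat where m: "(3 * real n + 1) / (1 - l) \<le> real m" using real_arch_simple by blast
  then have m1: "3 * real n + 1 \<le> real m * (1 - l)" using l01 by (simp add: field_simps)
  have "ereal l \<le> lam_exp_j n 2 \<zeta>"
  proof (rule lam_exp_j_geI)
    fix B :: real
    \<comment> \<open>As a <= H^(m + 1), the irrationality measure gives \<delta>^2 >= c^2 H^(-2 W
      (m + 1)); the extra 1 pays for c^2, since 1 / c^2 <= H.\<close>
    define M where "M = 2 * W * (real m + 1) + 1"
    define B0 where "B0 = max (max B 2) (max K (1 / c\<^sup>2))"
    obtain H p0 p1 p2 where HB: "B0 \<le> H" and p2: "p2 \<noteq> 0"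
      and pH: "\<bar>real_of_int p0\<bar> \<le> H" "\<bar>real_of_int p1\<bar> \<le> H" "\<bar>real_of_int p2\<bar> \<le> H"
      and PH: "\<bar>real_of_int p0 + real_of_int p1 * \<zeta> + real_of_int p2 * \<zeta>\<^sup>2\<bar> \<le> H powr (- M)"
      using sq unfolding small_quadratics_def by blast
    have H: "2 \<le> H" "B \<le> H" "K \<le> H" "1 / c\<^sup>2 \<le> H" using HB by (auto simp: B0_def)
    have Hm: "1 \<le> H ^ m" using H(1) by simp
    define N where "N = nat \<lceil>H ^ m\<rceil>"
    have N: "H ^ m \<le> real N" "real N \<le> H ^ m + 1"
      using Hm by (simp_all add: N_def)
    then have "0 < N" using Hm by simp
    then obtain a b a' b' :: int and \<delta> :: real where
      a: "1 \<le> a" "a \<le> int N" and \<delta>: "0 < \<delta>" "\<delta> < 1 / N" and ab: "\<bar>a * \<zeta> - b\<bar> = \<delta>"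
      and a': "1 \<le> a'" "a' * \<delta> \<le> 1" "\<bar>a' * \<zeta> - b'\<bar> \<le> \<delta>" and det: "a * b' \<noteq> b * a'"
      by (rule approx_pair [OF irr])
    have aN: "real_of_int a \<le> real N" using a(2) by linarith
    have "real N * \<delta> < 1" using \<delta> \<open>0 < N\<close> by (simp add: field_simps)
    then have N\<delta>: "real N < 1 / \<delta>" using \<delta>(1) by (simp add: field_simps)
    have \<delta>m: "\<delta> \<le> H powr (- real m)"
    proof -
      have "\<delta> \<le> 1 / N" using \<delta>(2) by simp
      also have "\<dots> \<le> 1 / H ^ m" using N(1) Hm by (intro divide_left_mono) auto
      also have "\<dots> = H powr (- real m)" using H(1) by (simp add: powr_minus_divide powr_realpow)
      finally show ?thesis .
    qed
    define V where "V = \<bar>p0 + p1 * \<zeta> + p2 * \<zeta>\<^sup>2\<bar>"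
    have V: "V \<le> \<delta>\<^sup>2"
    proof -
      have "real_of_int a \<le> H ^ m + 1" using aN N(2) by linarith
      also have "\<dots> \<le> 2 * H ^ m" using Hm by simp
      also have "\<dots> \<le> H * H ^ m" using H(1) by (intro mult_right_mono) auto
      also have "\<dots> = H powr (real m + 1)" using H(1) by (simp add: powr_add powr_realpow)
      finally have "(H powr (real m + 1)) powr (- W) \<le> real_of_int a powr (- W)"
        using a(1) W(1) by (intro powr_mono2') auto
      then have "c * (H powr (real m + 1)) powr (- W) \<le> c * real_of_int a powr (- W)"
        using c(1) by (intro mult_left_mono) auto
      also have "\<dots> \<le> \<delta>" using c(2) a(1) ab by metis
      finally have "(c * (H powr (real m + 1)) powr (- W))\<^sup>2 \<le> \<delta>\<^sup>2"
        using c(1) by (intro power_mono) auto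
      moreover have "(c * (H powr (real m + 1)) powr (- W))\<^sup>2 = c\<^sup>2 * H powr (- (2 * W * (real m + 1)))"
        by (simp add: power2_eq_square powr_powr powr_add [symmetric] algebra_simps)
      moreover have "H powr (- M) \<le> c\<^sup>2 * H powr (- (2 * W * (real m + 1)))"
      proof -
        have "H powr (- M) = H powr (- (2 * W * (real m + 1))) * H powr (- 1)"
          unfolding powr_add [symmetric] M_def by simp
        moreover have "H powr (- 1) \<le> c\<^sup>2" using H(1,4) c(1) by (simp add: powr_minus_divide field_simps)
        ultimately show ?thesis by (metis mult.commute mult_left_mono powr_ge_zero)
      qed
      ultimately show ?thesis using PH unfolding V_def by linarith
    qed
    \<comment> \<open>This bounds the first coordinates p2^n r, where r <= 1 / \<delta>.\<close>
    define X where "X = H ^ n / \<delta>"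
    have Hn: "1 \<le> H ^ n" using H(1) by simp
    have BX: "B \<le> X"
    proof -
      have "H = H ^ 1" by simp
      also have "\<dots> \<le> H ^ n" using H(1) n by (intro power_increasing) auto
      also have "\<dots> = H ^ n * 1" by simp
      also have "\<dots> \<le> H ^ n * (1 / \<delta>)" using Hn N\<delta> N(1) Hm by (intro mult_left_mono) linarith+
      finally show ?thesis using H(2) by (simp add: X_def)
    qed
    have small: "(3 * (1 + \<bar>\<zeta>\<bar>) * H\<^sup>2) ^ n * (2 * \<delta>) \<le> X powr (- l)"
    proof -
      have "(3 * (1 + \<bar>\<zeta>\<bar>) * H\<^sup>2) ^ n * (2 * \<delta>) = K * (H ^ (2 * n) * \<delta>)"
        by (simp add: K_def power_mult_distrib power_mult [symmetric] mult_ac)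
      also have "\<dots> \<le> H * (H ^ (2 * n) * \<delta>)" using H(1,3) \<delta>(1) by (intro mult_right_mono) auto
      also have "\<dots> = H powr (2 * real n + 1) * (\<delta> powr (1 - l) * \<delta> powr l)"
      proof -
        have "\<delta> powr (1 - l) * \<delta> powr l = \<delta>" using \<delta>(1) by (simp flip: powr_add)
        moreover have "H powr (2 * real n + 1) = H ^ (2 * n) * H"
          using H(1) powr_realpow [of H "2 * n"] by (simp add: powr_add)
        ultimately show ?thesis by simp
      qed
      also have "\<dots> \<le> H powr (2 * real n + 1) * (H powr (- (3 * real n + 1)) * \<delta> powr l)"
      proof (intro mult_left_mono mult_right_mono)
        have "\<delta> powr (1 - l) \<le> (H powr (- real m)) powr (1 - l)"
          using \<delta>m \<delta>(1) l01 by (intro powr_mono2) auto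
        also have "\<dots> = H powr (- (real m * (1 - l)))" by (simp add: powr_powr)
        also have "\<dots> \<le> H powr (- (3 * real n + 1))" using m1 H(1) by (intro powr_mono) auto
        finally show "\<delta> powr (1 - l) \<le> H powr (- (3 * real n + 1))" .
      qed auto
      also have "\<dots> = H powr (- real n) * \<delta> powr l"
        by (simp add: powr_add [symmetric] mult.assoc [symmetric])
      also have "\<dots> \<le> H powr (- (real n * l)) * \<delta> powr l"
        using H(1) l01 by (intro mult_right_mono powr_mono) (auto simp: mult_left_le)
      also have "\<dots> = X powr (- l)"
      proof -
        have "H powr (- (real n * l)) = (H ^ n) powr (- l)"
          using H(1) by (simp add: powr_powr flip: powr_realpow)
        then show ?thesis using H(1) \<delta>(1) by (simp add: X_def powr_divide powr_minus field_simps)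
      qed
      finally show ?thesis .
    qed
    have sol: "\<exists>v. v 0 = p2 ^ n * r \<and> v 1 = p2 ^ n * s \<and> approx_sol n \<zeta> l X v"
      if r: "1 \<le> r" "r * \<delta> \<le> 1" "\<bar>r * \<zeta> - s\<bar> \<le> \<delta>" for r s :: int
    proof -
      have "1 \<le> H" using H(1) by simp
      then obtain v :: "nat \<Rightarrow> int" where v: "v 0 = p2 ^ n * r" "v 1 = p2 ^ n * s"
        "\<forall>i\<in>{1..n}. \<bar>\<zeta> ^ i * v 0 - v i\<bar> \<le> (3 * (1 + \<bar>\<zeta>\<bar>) * H\<^sup>2) ^ n * (\<bar>r * \<zeta> - s\<bar> + \<bar>r\<bar> * V)"
        using quadratic_vector [of H p0 p1 p2 n r s \<zeta>] pH n unfolding V_def by auto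
      have "r * V \<le> r * \<delta>\<^sup>2" using V r(1) by (intro mult_left_mono) auto
      also have "\<dots> = (r * \<delta>) * \<delta>" by (simp add: power2_eq_square)
      also have "\<dots> \<le> 1 * \<delta>" using r(2) \<delta>(1) by (intro mult_right_mono) auto
      finally have "\<bar>r * \<zeta> - s\<bar> + \<bar>r\<bar> * V \<le> 2 * \<delta>" using r by simp
      then have "(3 * (1 + \<bar>\<zeta>\<bar>) * H\<^sup>2) ^ n * (\<bar>r * \<zeta> - s\<bar> + \<bar>r\<bar> * V) \<le> (3 * (1 + \<bar>\<zeta>\<bar>) * H\<^sup>2) ^ n * (2 * \<delta>)"
        by (intro mult_left_mono) auto
      then have err: "\<forall>i\<in>{1..n}. \<bar>\<zeta> ^ i * v 0 - v i\<bar> \<le> X powr (- l)"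
        using v(3) small by force
      have "v 0 \<noteq> 0" using v(1) p2 r(1) by simp
      then have "1 \<le> \<bar>v 0\<bar>" by linarith
      moreover have "real_of_int \<bar>v 0\<bar> = \<bar>real_of_int p2\<bar> ^ n * r" using v(1) r(1) by (simp add: abs_mult power_abs)
      moreover have "\<bar>real_of_int p2\<bar> ^ n * r \<le> H ^ n * (1 / \<delta>)"
        using pH(3) r \<delta>(1) H(1) by (intro mult_mono power_mono) (auto simp: field_simps)
      ultimately have "approx_sol n \<zeta> l X v"
        unfolding approx_sol_def using err by (auto simp: X_def)
      then show ?thesis using v by blast
    qed
    have "real_of_int a < 1 / \<delta>" using aN N\<delta> by linarith
    then have "a * \<delta> \<le> 1" using \<delta>(1) by (simp add: field_simps)
    then obtain v where v: "v 0 = p2 ^ n * a" "v 1 = p2 ^ n * b" "approx_sol n \<zeta> l X v"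
      using sol [of a b] a(1) ab by auto
    obtain v' where v': "v' 0 = p2 ^ n * a'" "v' 1 = p2 ^ n * b'" "approx_sol n \<zeta> l X v'"
      using sol [of a' b'] a' by auto
    define u where "u = (\<lambda>k :: nat. if k = 0 then v else v')"
    have "lin_indep n 2 u"
    proof (rule lin_indep_2 [OF n])
      show "u 0 0 * u 1 1 \<noteq> u 0 1 * u 1 0"
      proof
        assume "u 0 0 * u 1 1 = u 0 1 * u 1 0"
        then have "(p2 ^ n * p2 ^ n) * (a * b') = (p2 ^ n * p2 ^ n) * (b * a')"
          using v v' by (simp add: u_def mult_ac)
        then show False using det p2 by simp
      qed
    qed
    moreover have "\<forall>k<2. approx_sol n \<zeta> l X (u k)" using v(3) v'(3) by (simp add: u_def)
    ultimately show "\<exists>X\<ge>B. \<exists>v. (\<forall>k<2. approx_sol n \<zeta> l X (v k)) \<and> lin_indep n 2 v"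
      using BX by blast
  qed
  then show "y \<le> lam_exp_j n 2 \<zeta>" using l(1) by (meson less_imp_le max.strict_boundedE order_trans)
qed

text \<open>The polynomials witnessing w_2 might have degree below 2. A linear one with coefficients
  up to H is at least c H^(-W) at \<zeta>, a nonzero constant at least 1, so exponents from W + 1 on
  exclude both once H > 1 / c.\<close>

lemma small_quadratics_of_w_exp_2:
  fixes \<zeta> :: real
  assumes irr: "\<zeta> \<notin> \<rat>" and w1: "w_exp 1 \<zeta> < \<infinity>" and w2: "w_exp 2 \<zeta> = \<infinity>"
  shows "small_quadratics \<zeta>"
  unfolding small_quadratics_def
proof (intro allI)
  fix M B :: real
  obtain W0 where "w_exp 1 \<zeta> < ereal W0" using ereal_dense2 [OF w1] by blast
  define W where "W = max W0 1"
  have W: "1 \<le> W" "w_exp 1 \<zeta> < ereal W"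
    using \<open>w_exp 1 \<zeta> < ereal W0\<close> by (auto simp: W_def less_max_iff_disj)
  have "\<exists>c>0. c \<le> 1 \<and> (\<forall>(q :: int) (p :: int). (1 :: int) \<le> q \<longrightarrow> c * q powr (- W) \<le> \<bar>q * \<zeta> - p\<bar>)"
    using W by (intro w_exp_1_lessD [OF irr]) auto
  then obtain c where c: "0 < c" "c \<le> 1" "\<forall>(q :: int) (p :: int). (1 :: int) \<le> q \<longrightarrow> c * q powr (- W) \<le> \<bar>q * \<zeta> - p\<bar>"
    by blast
  define M' where "M' = max M (W + 1)"
  have less: "ereal M' < w_exp 2 \<zeta>" using w2 by simp
  obtain P :: "int poly" where P: "degree P \<le> 2" "max B (1 / c + 1) \<le> height P" "1 \<le> height P"
    "0 < \<bar>poly (map_poly of_int P) \<zeta>\<bar>"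
    "\<bar>poly (map_poly of_int P) \<zeta>\<bar> \<le> real_of_int (height P) powr (- M')"
    by (rule w_exp_gtD [OF less, of "max B (1 / c + 1)"])
  define H where "H = real_of_int (height P)"
  define p0 p1 p2 where "p0 = coeff P 0" and "p1 = coeff P 1" and "p2 = coeff P 2"
  have H: "1 \<le> H" "B \<le> H" "1 / c + 1 \<le> H" using P by (auto simp: H_def)
  have val: "poly (map_poly of_int P) \<zeta> = p0 + p1 * \<zeta> + p2 * \<zeta>\<^sup>2"
    unfolding p0_def p1_def p2_def by (rule poly_of_int_degree2 [OF P(1)])
  have pH: "\<bar>real_of_int p0\<bar> \<le> H" "\<bar>real_of_int p1\<bar> \<le> H" "\<bar>real_of_int p2\<bar> \<le> H"
    unfolding H_def p0_def p1_def p2_def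
    by (metis coeff_le_height of_int_abs of_int_le_iff)+
  have up: "\<bar>p0 + p1 * \<zeta> + p2 * \<zeta>\<^sup>2\<bar> \<le> H powr (- M')" using P(5) val by (simp add: H_def)
  also have "\<dots> \<le> H powr (- M)" using H(1) by (intro powr_mono) (auto simp: M'_def)
  finally have upM: "\<bar>p0 + p1 * \<zeta> + p2 * \<zeta>\<^sup>2\<bar> \<le> H powr (- M)" .
  have "p2 \<noteq> 0"
  proof
    assume p2: "p2 = 0"
    have "H powr (- M') \<le> H powr (- W - 1)" using H(1) by (intro powr_mono) (auto simp: M'_def)
    also have "\<dots> = H powr (- W) / H" using H(1) by (simp add: powr_diff)
    also have "\<dots> < c * H powr (- W)"
      using H c(1) by (simp add: field_simps)
    finally have lt: "\<bar>p0 + p1 * \<zeta>\<bar> < c * H powr (- W)" using up p2 by simp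
    show False
    proof (cases "p1 = 0")
      case True
      then have "p0 \<noteq> 0" using P(4) val p2 by auto
      then have "1 \<le> \<bar>real_of_int p0\<bar>" by linarith
      moreover have "c * H powr (- W) \<le> 1 * 1"
        using c H(1) W(1) by (intro mult_mono) (auto simp: powr_minus ge_one_powr_ge_zero inverse_le_1_iff)
      ultimately show False using lt True by simp
    next
      case False
      have "c * \<bar>p1\<bar> powr (- W) \<le> \<bar>\<bar>p1\<bar> * \<zeta> - (- sgn p1 * p0)\<bar>"
        using c(3) False by (metis abs_sgn int_one_le_iff_zero_less zero_less_abs_iff)
      also have "\<bar>p1\<bar> * \<zeta> - (- sgn p1 * p0) = real_of_int (sgn p1) * (p0 + p1 * \<zeta>)"
      proof -
        have "real_of_int \<bar>p1\<bar> = real_of_int (p1 * sgn p1)" by (simp only: abs_sgn)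
        then show ?thesis by (simp add: algebra_simps)
      qed
      also have "\<bar>\<dots>\<bar> = \<bar>p0 + p1 * \<zeta>\<bar>" using False by (simp add: abs_mult sgn_if)
      finally have "c * \<bar>p1\<bar> powr (- W) \<le> \<bar>p0 + p1 * \<zeta>\<bar>" .
      moreover have "c * H powr (- W) \<le> c * \<bar>p1\<bar> powr (- W)"
        using c(1) False pH(2) W(1) by (intro mult_left_mono powr_mono2') auto
      ultimately show False using lt by linarith
    qed
  qed
  then show "\<exists>H\<ge>B. \<exists>(p0 :: int) (p1 :: int) (p2 :: int). p2 \<noteq> 0 \<and>
     \<bar>real_of_int p0\<bar> \<le> H \<and> \<bar>real_of_int p1\<bar> \<le> H \<and> \<bar>real_of_int p2\<bar> \<le> H \<and>
     \<bar>real_of_int p0 + real_of_int p1 * \<zeta> + real_of_int p2 * \<zeta>\<^sup>2\<bar> \<le> H powr (- M)"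
    using H(2) pH upM by blast
qed

lemma small_quadratics_of_root:
  fixes \<zeta> :: real and p0 p1 p2 :: int
  assumes "p2 \<noteq> 0" "p0 + p1 * \<zeta> + p2 * \<zeta>\<^sup>2 = 0"
  shows "small_quadratics \<zeta>"
  unfolding small_quadratics_def
proof (intro allI)
  fix M B :: real
  define H where "H = max B (max \<bar>real_of_int p0\<bar> (max \<bar>real_of_int p1\<bar> \<bar>real_of_int p2\<bar>))"
  have "B \<le> H" "\<bar>real_of_int p0\<bar> \<le> H" "\<bar>real_of_int p1\<bar> \<le> H" "\<bar>real_of_int p2\<bar> \<le> H"
    unfolding H_def by (simp_all add: le_max_iff_disj)
  then show "\<exists>H\<ge>B. \<exists>(p0 :: int) (p1 :: int) (p2 :: int). p2 \<noteq> 0 \<and>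
     \<bar>real_of_int p0\<bar> \<le> H \<and> \<bar>real_of_int p1\<bar> \<le> H \<and> \<bar>real_of_int p2\<bar> \<le> H \<and>
     \<bar>real_of_int p0 + real_of_int p1 * \<zeta> + real_of_int p2 * \<zeta>\<^sup>2\<bar> \<le> H powr (- M)"
    using assms by (intro exI [of _ H] conjI exI [of _ p0] exI [of _ p1] exI [of _ p2]) auto
qed

text \<open>Liouville's inequality in degree 2: the homogenised polynomial takes a nonzero integer
  value at (p, q), and this value is p - q \<zeta> times a cofactor that is at most K q when |q
  \<zeta> - p| < 1.\<close>

lemma w_exp_1_quadratic:
  fixes \<zeta> :: real and p0 p1 p2 :: int
  assumes irr: "\<zeta> \<notin> \<rat>" and p2: "p2 \<noteq> 0" and root: "p0 + p1 * \<zeta> + p2 * \<zeta>\<^sup>2 = 0"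
  shows "w_exp 1 \<zeta> \<le> ereal 1"
proof -
  define K where "K = \<bar>real_of_int p1\<bar> + 2 * \<bar>real_of_int p2\<bar> * \<bar>\<zeta>\<bar> + \<bar>real_of_int p2\<bar>"
  have K1: "1 \<le> K" using p2 unfolding K_def by (intro add_increasing) auto
  show ?thesis
  proof (rule w_exp_1_leI)
    show "0 < 1 / K" using K1 by simp
    fix q p :: int assume q: "1 \<le> q"
    define Z where "Z = p0 * q\<^sup>2 + p1 * p * q + p2 * p\<^sup>2"
    have p0: "real_of_int p0 = - p1 * \<zeta> - p2 * \<zeta>\<^sup>2" using root by simp
    have Z: "Z = (p - q * \<zeta>) * (p1 * q + p2 * (p + q * \<zeta>))"
      by (simp add: Z_def p0 algebra_simps power2_eq_square)
    have "Z \<noteq> 0"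
    proof
      assume "Z = 0"
      moreover have "p - q * \<zeta> \<noteq> 0" using irrational_form_nonzero [OF irr, of q p] q by auto
      moreover have "p1 * q + p2 * (p + q * \<zeta>) \<noteq> 0"
        using irrational_form_nonzero [OF irr, of "p2 * q" "- (p1 * q + p2 * p)"] q p2
        by (simp add: algebra_simps)
      ultimately show False using Z by simp
    qed
    then have Z1: "1 \<le> \<bar>real_of_int Z\<bar>" by linarith
    have "1 / K * q powr (- 1) = 1 / (K * q)" using q by (simp add: powr_minus_divide)
    also have "\<dots> \<le> \<bar>q * \<zeta> - p\<bar>"
    proof (cases "1 \<le> \<bar>q * \<zeta> - p\<bar>")
      case True
      have "1 \<le> K * q" using mult_mono [of 1 K 1 "real_of_int q"] K1 q by simp
      then have "1 / (K * q) \<le> 1" by simp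
      then show ?thesis using True by linarith
    next
      case False
      have "\<bar>real_of_int p\<bar> \<le> q * \<bar>\<zeta>\<bar> + q"
        using False q abs_mult [of "real_of_int q" \<zeta>] by linarith
      then have "\<bar>p + q * \<zeta>\<bar> \<le> 2 * q * \<bar>\<zeta>\<bar> + q"
        using q abs_mult [of "real_of_int q" \<zeta>] by linarith
      then have "\<bar>real_of_int p2\<bar> * \<bar>p + q * \<zeta>\<bar> \<le> \<bar>real_of_int p2\<bar> * (2 * q * \<bar>\<zeta>\<bar> + q)"
        by (intro mult_left_mono) auto
      moreover have "\<bar>p1 * q + p2 * (p + q * \<zeta>)\<bar> \<le> \<bar>real_of_int p1\<bar> * q + \<bar>real_of_int p2\<bar> * \<bar>p + q * \<zeta>\<bar>"
        using q abs_triangle_ineq [of "real_of_int p1 * q" "p2 * (p + q * \<zeta>)"] by (simp add: abs_mult)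
      ultimately have "\<bar>p1 * q + p2 * (p + q * \<zeta>)\<bar> \<le> K * q"
        by (simp add: K_def algebra_simps)
      then have "\<bar>p - q * \<zeta>\<bar> * \<bar>p1 * q + p2 * (p + q * \<zeta>)\<bar> \<le> \<bar>p - q * \<zeta>\<bar> * (K * q)"
        by (intro mult_left_mono) auto
      then have "1 \<le> \<bar>p - q * \<zeta>\<bar> * (K * q)" using Z1 Z by (simp add: abs_mult)
      then show ?thesis using K1 q by (simp add: field_simps abs_minus_commute)
    qed
    finally show "1 / K * q powr (- 1) \<le> \<bar>q * \<zeta> - p\<bar>" .
  qed simp
qed

section \<open>Construction of \<open>U\<^sub>2\<close>-numbers\<close>

text \<open>Denominators of the convergents of [0; a 0, a 1, ...] with the index raised by one: the
  recursion starts from the formal convergent 1 / 0, followed by 0 / 1.\<close>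

fun cf_den :: "(nat \<Rightarrow> int) \<Rightarrow> nat \<Rightarrow> int" where
  "cf_den a 0 = 0"
| "cf_den a (Suc 0) = 1"
| "cf_den a (Suc (Suc k)) = a k * cf_den a (Suc k) + cf_den a k"

fun cf_num :: "(nat \<Rightarrow> int) \<Rightarrow> nat \<Rightarrow> int" where
  "cf_num a 0 = 1"
| "cf_num a (Suc 0) = 0"
| "cf_num a (Suc (Suc k)) = a k * cf_num a (Suc k) + cf_num a k"

declare cf_den.simps(3) [simp del] cf_num.simps(3) [simp del]

locale cont_frac =
  fixes a :: "nat \<Rightarrow> int"
  assumes a_pos: "1 \<le> a k"
begin

abbreviation "q \<equiv> cf_den a"
abbreviation "p \<equiv> cf_num a"

lemma det: "p (Suc k) * q k - p k * q (Suc k) = (- 1) ^ Suc k"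
proof (induction k)
  case (Suc k)
  have "p (Suc (Suc k)) * q (Suc k) - p (Suc k) * q (Suc (Suc k)) = - (p (Suc k) * q k - p k * q (Suc k))"
    by (simp add: cf_den.simps(3) cf_num.simps(3) algebra_simps)
  then show ?case using Suc by simp
qed simp

lemma den_pos: "0 \<le> q k" "1 \<le> q (Suc k)"
proof -
  have "0 \<le> q k \<and> 1 \<le> q (Suc k)"
  proof (induction k)
    case (Suc k)
    have "1 * 1 \<le> a k * q (Suc k)" using a_pos [of k] Suc by (intro mult_mono) auto
    then show ?case using Suc by (simp add: cf_den.simps(3))
  qed simp
  then show "0 \<le> q k" "1 \<le> q (Suc k)" by auto
qed

lemma den_step: "q (Suc k) + q k \<le> q (Suc (Suc k))"
  using a_pos [of k] den_pos(2) [of k] mult_right_mono [of 1 "a k" "q (Suc k)"]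
  by (simp add: cf_den.simps(3))

lemma den_mono: "q k \<le> q (Suc k)"
proof (cases k)
  case (Suc j)
  then show ?thesis using den_step [of j] den_pos(1) [of j] by simp
qed simp

text \<open>Linear growth is weak but sufficient: the blocks constructed later are so long that
  their mere length beats the powers required.\<close>

lemma den_ge: "int k \<le> q (Suc k)"
proof (induction k)
  case (Suc k)
  show ?case
  proof (cases k)
    case 0
    then show ?thesis using den_pos(2) [of 1] by simp
  next
    case (Suc j)
    then show ?thesis using den_step [of k] den_pos(2) [of j] Suc.IH by simp
  qed
qed simp

lemma num_bounds: "0 \<le> p (Suc k) \<and> p (Suc k) \<le> q (Suc k)"
proof (induction k rule: induct_nat_012)
  case (ge2 k)
  have "0 \<le> a (Suc k) * p (Suc (Suc k))" "a (Suc k) * p (Suc (Suc k)) \<le> a (Suc k) * q (Suc (Suc k))"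
    using a_pos [of "Suc k"] ge2 by (auto intro!: mult_left_mono)
  then show ?case using ge2 by (simp add: cf_den.simps(3) cf_num.simps(3) [of a "Suc k"])
qed (use a_pos [of 0] in \<open>auto simp: cf_den.simps(3) cf_num.simps(3)\<close>)

text \<open>The series of differences of consecutive convergents, which \<open>det\<close> evaluates
  up to sign as 1 / (q_k q_(k+1)).\<close>

definition cf_lim :: real where
  "cf_lim = (\<Sum>i. (- 1) ^ i * (1 / (q (Suc i) * q (Suc (Suc i)))))"

text \<open>q_k \<zeta> - p_k alternates in sign. Removing the sign by an explicit factor instead of
  an absolute value keeps the recursion and the determinant identity linear.\<close>

definition e :: "nat \<Rightarrow> real" where
  "e k = (- 1) ^ Suc k * (q k * cf_lim - p k)"

lemma partial_sum: "(\<Sum>i<k. (- 1) ^ i * (1 / (q (Suc i) * q (Suc (Suc i))))) = p (Suc k) / q (Suc k)"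
proof (induction k)
  case (Suc k)
  have "real_of_int (p (Suc (Suc k)) * q (Suc k) - p (Suc k) * q (Suc (Suc k))) = (- 1) ^ Suc (Suc k)"
    unfolding det by simp
  then have "p (Suc (Suc k)) / q (Suc (Suc k)) - p (Suc k) / q (Suc k) = (- 1) ^ k * (1 / (q (Suc k) * q (Suc (Suc k))))"
    using den_pos(2) [of k] den_pos(2) [of "Suc k"] by (simp add: field_simps)
  then show ?case using Suc by simp
qed simp

text \<open>Leibniz criterion: the terms decrease to 0, so the limit lies between the partial sums
  of even and of odd length.\<close>

lemma e_nonneg: "0 \<le> e k"
proof -
  define t where "t = (\<lambda>i. 1 / real_of_int (q (Suc i) * q (Suc (Suc i))))"
  have qpos: "0 < real_of_int (q (Suc i))" for i using den_pos(2) [of i] by linarith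
  have t0: "0 \<le> t i" for i unfolding t_def using qpos [of i] qpos [of "Suc i"] by simp
  have mono: "t (Suc i) \<le> t i" for i
  proof -
    have "q (Suc i) * q (Suc (Suc i)) \<le> q (Suc (Suc i)) * q (Suc (Suc (Suc i)))"
      using den_mono [of "Suc i"] den_mono [of "Suc (Suc i)"] den_pos(1) [of "Suc i"] den_pos(1) [of "Suc (Suc i)"]
      by (intro mult_mono) auto
    moreover have "0 < q (Suc i) * q (Suc (Suc i))" using den_pos(2) [of i] den_pos(2) [of "Suc i"] by simp
    ultimately show ?thesis unfolding t_def by (intro divide_left_mono mult_pos_pos) (auto simp del: of_int_mult)
  qed
  have lim0: "t \<longlonglongrightarrow> 0"
  proof (rule tendsto_sandwich)
    show "\<forall>\<^sub>F i in sequentially. 0 \<le> t i" using t0 by simp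
    show "\<forall>\<^sub>F i in sequentially. t i \<le> inverse (real (Suc i))"
    proof (intro always_eventually allI)
      fix i
      have "1 * int (Suc i) \<le> q (Suc i) * q (Suc (Suc i))"
        using den_pos(2) [of i] den_ge [of "Suc i"] by (intro mult_mono) auto
      then have "real_of_int (1 * int (Suc i)) \<le> real_of_int (q (Suc i) * q (Suc (Suc i)))"
        by (simp only: of_int_le_iff)
      then have "real (Suc i) \<le> real_of_int (q (Suc i) * q (Suc (Suc i)))" by (simp del: of_int_mult)
      then show "t i \<le> inverse (real (Suc i))"
        unfolding t_def inverse_eq_divide by (intro divide_left_mono) auto
    qed
    show "(\<lambda>i. inverse (real (Suc i))) \<longlonglongrightarrow> 0" by (rule LIMSEQ_inverse_real_of_nat)
  qed simp
  have lo: "p (Suc (2 * n)) / q (Suc (2 * n)) \<le> cf_lim" and hi: "cf_lim \<le> p (Suc (2 * n + 1)) / q (Suc (2 * n + 1))" for n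
    using summable_Leibniz'(2) [of t n, OF lim0 t0 mono] summable_Leibniz'(4) [of t n, OF lim0 t0 mono]
    unfolding t_def partial_sum by (simp_all add: cf_lim_def)
  show ?thesis
  proof (cases "k = 0")
    case True
    then show ?thesis by (simp add: e_def)
  next
    case False
    then obtain j where j: "k = Suc j" by (cases k) auto
    show ?thesis
    proof (cases "even j")
      case True
      then obtain n where n: "j = 2 * n" by blast
      have "real_of_int (p (Suc j)) \<le> q (Suc j) * cf_lim"
        using lo [of n] qpos [of j] by (simp add: n field_simps)
      then show ?thesis using True by (simp add: e_def j)
    next
      case False
      then obtain n where n: "j = 2 * n + 1" by (rule oddE)
      have "q (Suc j) * cf_lim \<le> real_of_int (p (Suc j))"
        using hi [of n] qpos [of j] unfolding n by (simp add: field_simps)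
      then show ?thesis using False by (simp add: e_def j)
    qed
  qed
qed

lemma e_rec: "e k = a k * e (Suc k) + e (Suc (Suc k))"
  by (simp add: e_def cf_den.simps(3) cf_num.simps(3) algebra_simps)

text \<open>This is \<open>det\<close> with \<zeta> inserted. Both summands are nonnegative and the
  second does not exceed the first, so e_k lies between 1 / (2 q_(k+1)) and 1 / q_(k+1).\<close>

lemma e_det: "q (Suc k) * e k + q k * e (Suc k) = 1"
proof -
  have "q (Suc k) * e k + q k * e (Suc k) = (- 1) ^ Suc k * real_of_int (p (Suc k) * q k - p k * q (Suc k))"
    by (simp add: e_def algebra_simps)
  also have "\<dots> = 1" unfolding det by (simp flip: power_add)
  finally show ?thesis .
qed

lemma e_pos: "0 < e k"
proof (rule ccontr)
  assume "\<not> 0 < e k"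
  then have "e k = 0" using e_nonneg [of k] by simp
  then have "a k * e (Suc k) + e (Suc (Suc k)) = 0" using e_rec [of k] by linarith
  moreover have "0 \<le> a k * e (Suc k)" using a_pos [of k] e_nonneg [of "Suc k"] by simp
  ultimately have "a k * e (Suc k) = 0" using e_nonneg [of "Suc (Suc k)"] by linarith
  then have "e (Suc k) = 0" using a_pos [of k] by simp
  then show False using e_det [of k] \<open>e k = 0\<close> by simp
qed

lemma e_decr: "e (Suc k) \<le> e k"
proof -
  have "1 * e (Suc k) \<le> a k * e (Suc k)" using a_pos [of k] e_pos [of "Suc k"] by (intro mult_right_mono) auto
  then show ?thesis using e_rec [of k] e_pos [of "Suc (Suc k)"] by simp
qed

lemma e_upper: "q (Suc k) * e k \<le> 1"
  using e_det [of k] den_pos(1) [of k] e_pos [of "Suc k"] by (smt (verit) mult_nonneg_nonneg of_int_0_le_iff)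

lemma e_lower: "1 \<le> 2 * q (Suc k) * e k"
proof -
  have "q k * e (Suc k) \<le> q (Suc k) * e k"
    using den_mono [of k] den_pos [of k] e_decr [of k] e_pos [of "Suc k"] by (intro mult_mono) auto
  then show ?thesis using e_det [of k] by simp
qed

lemma form_abs: "\<bar>q k * cf_lim - p k\<bar> = e k"
proof -
  have "e k = \<bar>e k\<bar>" using e_pos [of k] by simp
  also have "\<dots> = \<bar>q k * cf_lim - p k\<bar>" unfolding e_def by (simp add: abs_mult power_abs)
  finally show ?thesis by simp
qed

text \<open>For a limit m / n every n e_k would be a positive integer, while e_k < 1 / n as soon as
  q_(k+1) > n.\<close>

lemma cf_lim_irrational: "cf_lim \<notin> \<rat>"
proof
  assume "cf_lim \<in> \<rat>"
  then obtain m n :: int where mn: "0 < n" "cf_lim = m / n" by (meson Rats_cases')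
  define k where "k = nat n + 1"
  have nl: "n * cf_lim = m" using mn by simp
  have "n * e k = \<bar>n * (q k * cf_lim - p k)\<bar>" using mn(1) by (simp add: abs_mult form_abs)
  also have "n * (q k * cf_lim - p k) = q k * (n * cf_lim) - p k * n" by (simp add: algebra_simps)
  also have "\<dots> = real_of_int (q k * m - p k * n)" by (simp add: nl)
  finally have ne: "n * e k = real_of_int \<bar>q k * m - p k * n\<bar>" by (simp only: of_int_abs)
  have "0 < n * e k" using mn e_pos [of k] by simp
  then have "0 < \<bar>q k * m - p k * n\<bar>" unfolding ne by (simp only: of_int_0_less_iff)
  then have "1 \<le> n * e k" unfolding ne by (simp only: of_int_1_le_iff int_one_le_iff_zero_less)
  also have "\<dots> < real_of_int (q (Suc k)) * e k"
    using den_ge [of k] mn e_pos [of k] by (intro mult_strict_right_mono) (auto simp: k_def)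
  also have "\<dots> \<le> 1" by (rule e_upper)
  finally show False by simp
qed

lemma coprime_num_den: "coprime (p k) (q k)"
proof (rule coprimeI)
  fix c assume "c dvd p k" "c dvd q k"
  then have "c dvd p (Suc k) * q k - p k * q (Suc k)" by simp
  then have "c dvd (- 1) ^ Suc k * (- 1) ^ Suc k" unfolding det by (rule dvd_mult2)
  then show "is_unit c" by (simp flip: power_mult_distrib)
qed

text \<open>Compare s / r with the convergent for the least k with e_k < 1 / (2 r); minimality gives
  q_k <= 2 r. If the fractions differ, their nonzero determinant yields a bound of order 1 / r. If
  they agree, the error is at least e_k >= 1 / (2 q_(k+1)), and there the growth hypothesis
  enters.\<close>

lemma approx_lower:
  fixes C w :: real and r s :: int
  assumes C: "1 \<le> C" and w: "1 \<le> w" and growth: "\<And>k. q (Suc (Suc k)) \<le> C * q (Suc k) powr w" and r: "1 \<le> r"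
  shows "1 / (4 * C) * r powr (- w) \<le> \<bar>r * cf_lim - s\<bar>"
proof -
  have ex: "\<exists>k. e k < 1 / (2 * r)"
  proof (intro exI)
    define k where "k = nat (2 * r) + 1"
    have "real_of_int (2 * r) < q (Suc k)" using den_ge [of k] r by (simp add: k_def)
    then have "2 * r * e k < q (Suc k) * e k" using e_pos [of k] by (intro mult_strict_right_mono) auto
    then have "2 * r * e k < 1" using e_upper [of k] by linarith
    then show "e k < 1 / (2 * r)" using r by (simp add: field_simps)
  qed
  define k where "k = (LEAST k. e k < 1 / (2 * r))"
  have k: "e k < 1 / (2 * r)" unfolding k_def using ex by (rule LeastI_ex)
  have "k \<noteq> 0"
  proof
    assume "k = 0"
    then have "1 < 1 / (2 * real_of_int r)" using k by (simp add: e_def)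
    then show False using r by (simp add: field_simps)
  qed
  then obtain j where j: "k = Suc j" by (cases k) auto
  have "\<not> e j < 1 / (2 * r)" using not_less_Least [of j "\<lambda>k. e k < 1 / (2 * r)"] j by (simp add: k_def)
  then have "q k * (1 / (2 * r)) \<le> q k * e j" using den_pos(1) [of k] by (intro mult_left_mono) auto
  also have "\<dots> \<le> 1" using e_upper [of j] j by simp
  finally have q2r: "q k \<le> 2 * real_of_int r" using r by (simp add: field_simps)
  have qk: "1 \<le> q k" using den_pos(2) [of j] j by simp
  show ?thesis
  proof (cases "r * p k = s * q k")
    case False
    then have "1 \<le> \<bar>r * p k - s * q k\<bar>" by linarith
    then have "1 \<le> \<bar>real_of_int (r * p k - s * q k)\<bar>" by linarith
    also have "real_of_int (r * p k - s * q k) = q k * (r * cf_lim - s) - r * (q k * cf_lim - p k)"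
      by (simp add: algebra_simps)
    also have "\<bar>\<dots>\<bar> \<le> \<bar>q k * (r * cf_lim - s)\<bar> + \<bar>r * (q k * cf_lim - p k)\<bar>" by linarith
    also have "\<dots> = q k * \<bar>r * cf_lim - s\<bar> + r * e k"
      using qk r by (simp add: abs_mult form_abs)
    also have "r * e k < 1 / 2" using k r by (simp add: field_simps)
    finally have "1 / 2 < q k * \<bar>r * cf_lim - s\<bar>" by simp
    also have "\<dots> \<le> 2 * r * \<bar>r * cf_lim - s\<bar>" using q2r by (intro mult_right_mono) auto
    finally have "1 / (4 * r) \<le> \<bar>r * cf_lim - s\<bar>" using r by (simp add: field_simps)
    moreover have "1 / (4 * C) * r powr (- w) \<le> 1 / 4 * r powr (- 1)"
      using C w r by (intro mult_mono powr_mono) (auto simp: field_simps)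
    ultimately show ?thesis using r by (simp add: powr_minus_divide)
  next
    case True
    then have "q k dvd r * p k" by simp
    then have "q k dvd r" using coprime_num_den [of k] by (simp add: coprime_dvd_mult_left_iff coprime_commute)
    then have qr: "q k \<le> r" using r by (simp add: zdvd_imp_le)
    have "real_of_int (r * p k) = real_of_int (s * q k)" using True by simp
    then have "q k * (r * cf_lim - s) = r * (q k * cf_lim - p k)" by (simp add: algebra_simps)
    then have "q k * \<bar>r * cf_lim - s\<bar> = r * e k"
      using qk r by (metis abs_mult abs_of_pos form_abs int_one_le_iff_zero_less of_int_0_less_iff)
    also have "\<dots> \<ge> q k * e k" using qr e_pos [of k] by (intro mult_right_mono) auto
    finally have ek: "e k \<le> \<bar>r * cf_lim - s\<bar>" using qk by (simp add: mult_le_cancel_left)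
    have "q (Suc k) \<le> C * q k powr w" using growth [of j] j by simp
    also have "\<dots> \<le> C * r powr w" using C w qk qr by (intro mult_left_mono powr_mono2) auto
    finally have qC: "q (Suc k) \<le> C * r powr w" .
    have "1 \<le> 2 * q (Suc k) * e k" by (rule e_lower)
    also have "\<dots> \<le> 2 * (C * r powr w) * e k" using qC e_pos [of k] by (intro mult_right_mono mult_left_mono) auto
    finally have "1 / (2 * C) * r powr (- w) \<le> e k" using C r by (simp add: powr_minus_divide field_simps)
    moreover have "1 / (4 * C) * r powr (- w) \<le> 1 / (2 * C) * r powr (- w)"
      using C by (intro mult_right_mono divide_left_mono) auto
    ultimately show ?thesis using ek by linarith
  qed
qed

text \<open>Along a block of partial quotients equal to 1 the form \<open>D\<^sub>i\<^sup>2 + D\<^sub>i D\<^sub>i\<^sub>+\<^sub>1 - D\<^sub>i\<^sub>+\<^sub>1\<^sup>2\<close>, where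
  \<open>D\<^sub>i = q\<^sub>i \<zeta> - p\<^sub>i\<close>, only changes its sign, so its value at the start of the block, which is a
  quadratic polynomial in \<open>\<zeta>\<close> of small height, is as small as its value at the end.\<close>

lemma quadratic_form_block:
  assumes "\<And>i. k < i \<Longrightarrow> i < k + Suc d \<Longrightarrow> a i = 1"
  shows "\<bar>(e (Suc k))\<^sup>2 - e (Suc k) * e (Suc (Suc k)) - (e (Suc (Suc k)))\<^sup>2\<bar>
    = \<bar>(e (k + Suc d))\<^sup>2 - e (k + Suc d) * e (Suc (k + Suc d)) - (e (Suc (k + Suc d)))\<^sup>2\<bar>"
  using assms
proof (induction d)
  case (Suc d)
  define i where "i = k + Suc d"
  have "a i = 1" using Suc.prems [of i] by (simp add: i_def)
  then have ei: "e i = e (Suc i) + e (Suc (Suc i))" using e_rec [of i] by simp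
  have "(e (Suc i))\<^sup>2 - e (Suc i) * e (Suc (Suc i)) - (e (Suc (Suc i)))\<^sup>2
     = - ((e i)\<^sup>2 - e i * e (Suc i) - (e (Suc i))\<^sup>2)"
    unfolding ei by (simp add: power2_eq_square algebra_simps)
  then show ?case using Suc by (simp add: i_def)
qed simp

text \<open>The height is governed by the denominator at the start of the block, the value by the
  one at its end. A quotient of at least 2 after the block gives E > 2 E', beyond the golden ratio,
  so the form does not vanish.\<close>

lemma small_quadratic:
  assumes "k < k'" and ones: "\<And>i. k < i \<Longrightarrow> i < k' \<Longrightarrow> a i = 1" and big: "2 \<le> a k'"
  shows "\<exists>P :: int poly. degree P \<le> 2 \<and> height P \<le> 6 * (q (Suc (Suc k)))\<^sup>2 \<and>
    0 < \<bar>poly (map_poly of_int P) cf_lim\<bar> \<and> \<bar>poly (map_poly of_int P) cf_lim\<bar> \<le> 1 / (q (Suc k'))\<^sup>2"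
proof -
  define x y x' y' where "x = q (Suc k)" and "y = p (Suc k)" and "x' = q (Suc (Suc k))" and "y' = p (Suc (Suc k))"
  \<comment> \<open>Coefficients of (x T - y)^2 + (x T - y) (x' T - y') - (x' T - y')^2. The bound 6
    is the sum of the absolute coefficients in c1.\<close>
  define c0 c1 c2 where "c0 = y\<^sup>2 + y * y' - y'\<^sup>2" and "c1 = - (2 * x * y + x * y' + x' * y - 2 * x' * y')"
    and "c2 = x\<^sup>2 + x * x' - x'\<^sup>2"
  define P where "P = [:c0, c1, c2:]"
  have deg: "degree P \<le> 2" by (simp add: P_def)
  have le: "0 \<le> y" "y \<le> x'" "0 \<le> y'" "y' \<le> x'" "0 \<le> x" "x \<le> x'"
    using num_bounds [of k] num_bounds [of "Suc k"] den_mono [of "Suc k"] den_pos(1) [of "Suc k"]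
    unfolding x_def y_def x'_def y'_def by linarith+
  have prod: "0 \<le> u * v \<and> u * v \<le> x'\<^sup>2" if "0 \<le> u" "u \<le> x'" "0 \<le> v" "v \<le> x'" for u v :: int
    using that mult_mono [of u x' v x'] by (simp add: power2_eq_square)
  have "0 \<le> x'" using le by linarith
  note le = le this order_refl [of x']
  have prods: "0 \<le> y * y \<and> y * y \<le> x'\<^sup>2" "0 \<le> y * y' \<and> y * y' \<le> x'\<^sup>2" "0 \<le> y' * y' \<and> y' * y' \<le> x'\<^sup>2"
    "0 \<le> x * y \<and> x * y \<le> x'\<^sup>2" "0 \<le> x * y' \<and> x * y' \<le> x'\<^sup>2" "0 \<le> x' * y \<and> x' * y \<le> x'\<^sup>2"
    "0 \<le> x' * y' \<and> x' * y' \<le> x'\<^sup>2" "0 \<le> x * x \<and> x * x \<le> x'\<^sup>2" "0 \<le> x * x' \<and> x * x' \<le> x'\<^sup>2"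
    using prod le by blast+
  have "\<bar>c0\<bar> \<le> 6 * x'\<^sup>2"
    using prods(1-3) unfolding c0_def power2_eq_square [of y] power2_eq_square [of y'] by linarith
  moreover have "\<bar>c1\<bar> \<le> 6 * x'\<^sup>2"
    using prods(4-7) unfolding c1_def mult.assoc by linarith
  moreover have "\<bar>c2\<bar> \<le> 6 * x'\<^sup>2"
    using prods(8,9) unfolding c2_def power2_eq_square [of x] by linarith
  ultimately have ht: "height P \<le> 6 * x'\<^sup>2"
    by (auto simp: height_le_iff P_def coeff_pCons split: nat.splits)
  define s :: real where "s = (- 1) ^ Suc (Suc k)"
  have ss: "s * s = 1" by (simp add: s_def flip: power_add)
  have D: "x * cf_lim - y = s * e (Suc k)" "x' * cf_lim - y' = - s * e (Suc (Suc k))"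
    unfolding e_def x_def y_def x'_def y'_def s_def by (simp_all add: mult.assoc [symmetric] flip: power_add)
  have "poly (map_poly of_int P) cf_lim = c0 + c1 * cf_lim + c2 * cf_lim\<^sup>2"
    using poly_of_int_degree2 [OF deg, of cf_lim] by (simp add: P_def numeral_2_eq_2)
  also have "\<dots> = (x * cf_lim - y)\<^sup>2 + (x * cf_lim - y) * (x' * cf_lim - y') - (x' * cf_lim - y')\<^sup>2"
    by (simp add: c0_def c1_def c2_def power2_eq_square algebra_simps)
  also have "\<dots> = (s * s) * ((e (Suc k))\<^sup>2 - e (Suc k) * e (Suc (Suc k)) - (e (Suc (Suc k)))\<^sup>2)"
    unfolding D by (simp add: power2_eq_square algebra_simps)
  also have "\<dots> = (e (Suc k))\<^sup>2 - e (Suc k) * e (Suc (Suc k)) - (e (Suc (Suc k)))\<^sup>2" by (simp add: ss)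
  finally have val: "poly (map_poly of_int P) cf_lim = (e (Suc k))\<^sup>2 - e (Suc k) * e (Suc (Suc k)) - (e (Suc (Suc k)))\<^sup>2" .
  define d where "d = k' - Suc k"
  have d: "k' = k + Suc d" using assms(1) by (simp add: d_def)
  have val': "\<bar>poly (map_poly of_int P) cf_lim\<bar> = \<bar>(e k')\<^sup>2 - e k' * e (Suc k') - (e (Suc k'))\<^sup>2\<bar>"
    unfolding val d by (rule quadratic_form_block) (use ones d in auto)
  define E E' where "E = e k'" and "E' = e (Suc k')"
  have E': "0 < E'" by (simp add: E'_def e_pos)
  have "2 * E' \<le> a k' * E'" using big E' by (intro mult_right_mono) auto
  then have EE: "2 * E' < E" using e_rec [of k'] e_pos [of "Suc (Suc k')"] by (simp add: E_def E'_def)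
  have "E' * E' < E * (E - E')" using EE E' by (intro mult_strict_mono) auto
  then have pos: "0 < E\<^sup>2 - E * E' - E'\<^sup>2" by (simp add: power2_eq_square algebra_simps)
  have "0 \<le> E * E'" using E' EE by simp
  then have "E\<^sup>2 - E * E' - E'\<^sup>2 \<le> E\<^sup>2" using zero_le_power2 [of E'] by linarith
  also have "\<dots> \<le> (1 / q (Suc k'))\<^sup>2"
    using e_upper [of k'] den_pos(2) [of k'] E' EE by (intro power_mono) (auto simp: E_def field_simps)
  also have "\<dots> = 1 / (q (Suc k'))\<^sup>2" by (simp add: power_divide)
  finally have "E\<^sup>2 - E * E' - E'\<^sup>2 \<le> 1 / (q (Suc k'))\<^sup>2" .
  then show ?thesis using deg ht pos val' unfolding x'_def E_def E'_def
    by (intro exI [of _ P]) auto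
qed

end

section \<open>Choice of the partial quotients\<close>

text \<open>Partial quotients and denominators depend on each other, so the denominators are defined
  by recursion and the quotients read off afterwards. The added 1 makes the quotients at positions
  in \<open>S\<close> at least 2 even for w = 1.\<close>

fun U2_den :: "nat set \<Rightarrow> real \<Rightarrow> nat \<Rightarrow> int" where
  "U2_den S w 0 = 0"
| "U2_den S w (Suc 0) = 1"
| "U2_den S w (Suc (Suc k)) =
     (if k \<in> S then \<lceil>U2_den S w (Suc k) powr (w - 1)\<rceil> + 1 else 1) * U2_den S w (Suc k) + U2_den S w k"

text \<open>A bound for the denominators that does not involve \<open>S\<close>, so that the
  positions can be chosen before the denominators are known. The recursion mirrors q_(k+2) <= 4
  q_(k+1)^w.\<close>

fun U2_bound :: "real \<Rightarrow> nat \<Rightarrow> real" where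
  "U2_bound w 0 = 1"
| "U2_bound w (Suc k) = 4 * U2_bound w k powr w"

text \<open>The base of the power bounds the height H of the quadratic polynomial of the block
  starting here. Denominators grow at least linearly, so a block longer than its j-th power makes
  the value at most H^(-j).\<close>

fun U2_pos :: "real \<Rightarrow> nat \<Rightarrow> nat" where
  "U2_pos w 0 = 0"
| "U2_pos w (Suc j) = U2_pos w j + 1 + nat \<lceil>(6 * (U2_bound w (U2_pos w j + 1))\<^sup>2) ^ j\<rceil>"

lemma U2_number_exists:
  fixes w :: real
  assumes w: "1 \<le> w"
  shows "\<exists>\<zeta>. U2_number \<zeta> \<and> w_exp 1 \<zeta> = ereal w"
proof -
  define S where "S = range (U2_pos w)"
  define a where "a = (\<lambda>k. if k \<in> S then \<lceil>U2_den S w (Suc k) powr (w - 1)\<rceil> + 1 else 1)"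
  have ceil0: "0 \<le> \<lceil>x powr y\<rceil>" for x y :: real
    by (rule order_trans [of _ "\<lceil>0 :: real\<rceil>"]) (simp, intro ceiling_mono, simp)
  have a1: "1 \<le> a k" for k
    using ceil0 [of "real_of_int (U2_den S w (Suc k))" "w - 1"] by (simp add: a_def)
  interpret cont_frac a by unfold_locales (rule a1)
  have den: "U2_den S w k = q k" for k
    by (induction k rule: induct_nat_012) (simp_all add: a_def cf_den.simps(3))
  have a_S: "q (Suc k) powr (w - 1) \<le> a k \<and> 2 \<le> a k" if "k \<in> S" for k
  proof -
    have ak: "a k = \<lceil>q (Suc k) powr (w - 1)\<rceil> + 1" using that by (simp add: a_def den)
    have "0 < real_of_int (q (Suc k)) powr (w - 1)" using den_pos(2) [of k] by simp
    then have "0 < \<lceil>q (Suc k) powr (w - 1)\<rceil>" by simp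
    then show ?thesis unfolding ak using le_of_int_ceiling [of "q (Suc k) powr (w - 1)"]
      by (intro conjI) linarith+
  qed
  \<comment> \<open>The 4 collects x^(w - 1) from the quotient, 2 from rounding it up and adding 1,
    and 1 from the last summand, all compared with x^(w - 1) >= 1.\<close>
  have growth: "q (Suc (Suc k)) \<le> 4 * q (Suc k) powr w" for k
  proof -
    define x where "x = real_of_int (q (Suc k))"
    have x1: "1 \<le> x" using den_pos(2) [of k] by (simp add: x_def)
    have x0: "1 \<le> x powr (w - 1)" using x1 w by (simp add: ge_one_powr_ge_zero)
    have "a k \<le> x powr (w - 1) + 2"
    proof (cases "k \<in> S")
      case True
      then have "a k = \<lceil>x powr (w - 1)\<rceil> + 1" unfolding x_def den [symmetric] by (simp add: a_def)
      then show ?thesis using of_int_ceiling_le_add_one [of "x powr (w - 1)"] by linarith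
    next
      case False
      then have "a k = 1" by (simp add: a_def)
      then show ?thesis by (simp add: add_nonneg_nonneg)
    qed
    then have "a k * x + q k \<le> (x powr (w - 1) + 2) * x + x"
      using x1 den_mono [of k] by (intro add_mono mult_right_mono) (auto simp: x_def)
    also have "\<dots> = (x powr (w - 1) + 3) * x" by (simp add: algebra_simps)
    also have "\<dots> \<le> (4 * x powr (w - 1)) * x" using x0 x1 by (intro mult_right_mono) auto
    also have "\<dots> = 4 * x powr w" using x1 by (simp add: powr_diff)
    finally show ?thesis by (simp add: cf_den.simps(3) x_def)
  qed
  have bound: "q (Suc k) \<le> U2_bound w k" for k
  proof (induction k)
    case (Suc k)
    have "q (Suc (Suc k)) \<le> 4 * q (Suc k) powr w" by (rule growth)
    also have "\<dots> \<le> 4 * U2_bound w k powr w"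
      using Suc w den_pos(1) [of "Suc k"] by (intro mult_left_mono powr_mono2) auto
    finally show ?case by simp
  qed simp
  have up: "w_exp 1 cf_lim \<le> ereal w"
  proof (rule w_exp_1_leI)
    show "1 / (4 * 4) * r powr (- w) \<le> \<bar>r * cf_lim - s\<bar>" if "1 \<le> r" for r s :: int
      using w that growth by (intro approx_lower) auto
  qed (use w in auto)
  have strict: "strict_mono (U2_pos w)" by (rule strict_mono_Suc_iff [THEN iffD2]) simp
  have lo: "ereal w \<le> w_exp 1 cf_lim"
  proof (rule w_exp_1_geI [OF cf_lim_irrational])
    fix B :: real
    define j where "j = nat \<lceil>B\<rceil>"
    define k where "k = U2_pos w j"
    have kS: "k \<in> S" by (simp add: k_def S_def)
    have "j \<le> k" unfolding k_def using strict by (rule strict_mono_imp_increasing)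
    then have "int j \<le> q (Suc k)" using den_ge [of k] by linarith
    then have Bq: "B \<le> q (Suc k)" unfolding j_def by linarith
    define x where "x = real_of_int (q (Suc k))"
    have x1: "1 \<le> x" using den_pos(2) [of k] by (simp add: x_def)
    \<comment> \<open>At positions in \<open>S\<close> the next denominator is at least q_(k+1)^w,
      so this convergent attains the exponent w.\<close>
    have "x powr w = x powr (w - 1) * x" using x1 by (simp add: powr_diff)
    also have "\<dots> \<le> a k * x" using a_S [OF kS] x1 by (intro mult_right_mono) (auto simp: x_def)
    also have "\<dots> \<le> q (Suc (Suc k))" using den_pos(1) [of k] by (simp add: cf_den.simps(3) x_def)
    finally have "x powr w * e (Suc k) \<le> q (Suc (Suc k)) * e (Suc k)"
      using e_pos [of "Suc k"] by (intro mult_right_mono) auto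
    also have "\<dots> \<le> 1" by (rule e_upper)
    finally have "e (Suc k) \<le> x powr (- w)" using x1 by (simp add: powr_minus_divide field_simps)
    then have "\<bar>q (Suc k) * cf_lim - p (Suc k)\<bar> \<le> 1 * q (Suc k) powr (- w)"
      unfolding form_abs by (simp add: x_def)
    then show "\<exists>(q :: int) (p :: int). (1 :: int) \<le> q \<and> B \<le> q \<and> \<bar>q * cf_lim - p\<bar> \<le> 1 * q powr (- w)"
      using den_pos(2) [of k] Bq by blast
  qed (use w in auto)
  have "w_exp 2 cf_lim = \<infinity>"
  proof (rule ereal_top)
    fix M :: real
    show "ereal M \<le> w_exp 2 cf_lim"
    proof (rule w_exp_geI)
      fix \<epsilon> :: real assume "0 < \<epsilon>"
      \<comment> \<open>The block starting at position j reaches the exponent j; 1 / \<epsilon> < j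
        makes the value small as well, since the denominator at its end exceeds j.\<close>
      define j where "j = nat \<lceil>max M (1 / \<epsilon> + 1)\<rceil>"
      have j: "M \<le> real j" "1 / \<epsilon> < real j" unfolding j_def by linarith+
      define k k' where "k = U2_pos w j" and "k' = U2_pos w (Suc j)"
      have kk': "k < k'" unfolding k_def k'_def using strict by (rule strict_monoD) simp
      have "a i = 1" if "k < i" "i < k'" for i
      proof -
        have "i \<notin> S"
        proof
          assume "i \<in> S"
          then obtain m where m: "i = U2_pos w m" by (auto simp: S_def)
          then have "j < m" "m < Suc j" using that strict 
            by (auto simp: k_def k'_def strict_mono_less simp del: U2_pos.simps)
          then show False by simp
        qed
        then show ?thesis by (simp add: a_def)
      qed
      moreover have "2 \<le> a k'" using a_S unfolding S_def k'_def by blast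
      ultimately obtain P :: "int poly" where P: "degree P \<le> 2" "height P \<le> 6 * (q (Suc (Suc k)))\<^sup>2"
        "0 < \<bar>poly (map_poly of_int P) cf_lim\<bar>"
        "\<bar>poly (map_poly of_int P) cf_lim\<bar> \<le> 1 / (q (Suc k'))\<^sup>2"
        using small_quadratic [OF kk'] by blast
      have "P \<noteq> 0" using P(3) by auto
      then have H1: "1 \<le> height P" by (rule height_ge_1)
      define x where "x = real_of_int (q (Suc k'))"
      have x1: "1 \<le> x" using den_pos(2) [of k'] by (simp add: x_def)
      have kx: "real k' \<le> x" using den_ge [of k'] by (simp add: x_def)
      have "1 / x\<^sup>2 \<le> 1 / x" using x1 by (intro divide_left_mono) (auto simp: power2_eq_square)
      then have Px: "\<bar>poly (map_poly of_int P) cf_lim\<bar> \<le> 1 / x" using P(4) by (simp add: x_def)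
      have "Suc j \<le> k'" unfolding k'_def using strict by (rule strict_mono_imp_increasing)
      then have "1 / \<epsilon> < x" using j(2) kx by linarith
      then have "1 / x < \<epsilon>" using \<open>0 < \<epsilon>\<close> x1 by (simp add: field_simps)
      then have small: "\<bar>poly (map_poly of_int P) cf_lim\<bar> < \<epsilon>" using Px by linarith
      have "real_of_int (height P) \<le> 6 * (real_of_int (q (Suc (Suc k))))\<^sup>2"
        using P(2) by (metis of_int_le_iff of_int_mult of_int_numeral of_int_power)
      also have "\<dots> \<le> 6 * (U2_bound w (k + 1))\<^sup>2"
        using bound [of "k + 1"] den_pos(1) [of "Suc (Suc k)"] by (intro mult_left_mono power_mono) auto
      finally have "real_of_int (height P) ^ j \<le> (6 * (U2_bound w (k + 1))\<^sup>2) ^ j"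
        using H1 by (intro power_mono) auto
      also have "\<dots> \<le> real k'" 
        unfolding k_def k'_def U2_pos.simps(2) [of w j]
        using real_nat_ceiling_ge [of "(6 * (U2_bound w (U2_pos w j + 1))\<^sup>2) ^ j"] by linarith
      also have "\<dots> \<le> x" by (rule kx)
      finally have Hx: "real_of_int (height P) powr j \<le> x" using H1 by (simp add: powr_realpow)
      have "1 / x \<le> 1 / real_of_int (height P) powr j"
        using Hx H1 x1 by (intro divide_left_mono) auto
      also have "\<dots> = real_of_int (height P) powr (- real j)" by (simp add: powr_minus_divide)
      also have "\<dots> \<le> real_of_int (height P) powr (- M)" using H1 j(1) by (intro powr_mono) auto
      finally have "\<bar>poly (map_poly of_int P) cf_lim\<bar> \<le> 1 * real_of_int (height P) powr (- M)"
        using Px by simp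
      then show "\<exists>P :: int poly. degree P \<le> 2 \<and> 0 < \<bar>poly (map_poly of_int P) cf_lim\<bar> \<and>
         \<bar>poly (map_poly of_int P) cf_lim\<bar> < \<epsilon> \<and>
         \<bar>poly (map_poly of_int P) cf_lim\<bar> \<le> 1 * real_of_int (height P) powr (- M)"
        using P(1,3) small by blast
    qed
  qed
  moreover have "w_exp 1 cf_lim = ereal w" using up lo by (rule antisym)
  ultimately show ?thesis unfolding U2_number_def by (intro exI [of _ cf_lim]) simp
qed

section \<open>Hankel determinants\<close>

text \<open>Take for a the product of the primes of m that do not divide u. Every prime of m then
  divides exactly one of u and a v: a prime dividing u divides neither a nor, by hypothesis,
  v.\<close>

lemma exists_coprime_shift:
  fixes u v m :: int
  assumes m: "m \<noteq> 0" and g: "\<forall>d. d dvd u \<longrightarrow> d dvd v \<longrightarrow> d dvd m \<longrightarrow> is_unit d"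
  shows "\<exists>a. coprime (u + a * v) m"
proof -
  define A where "A = {l \<in> prime_factors m. \<not> l dvd u}"
  have fin: "finite A" by (simp add: A_def)
  define a where "a = \<Prod>A"
  have "coprime (u + a * v) m"
  proof (rule ccontr)
    assume "\<not> coprime (u + a * v) m"
    then obtain l where l: "prime l" "l dvd u + a * v" "l dvd m"
      using prime_divisor_exists [of "gcd (u + a * v) m"] m by (auto simp: coprime_iff_gcd_eq_1)
    show False
    proof (cases "l dvd u")
      case True
      then have "l dvd a * v" using l(2) by (simp add: dvd_add_right_iff)
      moreover have "\<not> l dvd v" using g True l(1,3) not_prime_unit by blast
      ultimately have "l dvd a" using l(1) by (simp add: prime_dvd_mult_iff)
      then obtain l' where l': "l' \<in> A" "l dvd l'"
        using prime_dvd_prod_iff [OF fin l(1), of "\<lambda>x. x"] by (auto simp: a_def)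
      then have "l = l'" using l(1) by (intro primes_dvd_imp_eq) (auto simp: A_def in_prime_factors_iff)
      then show False using l' True by (simp add: A_def)
    next
      case False
      then have "l \<in> A" using l m by (auto simp: A_def in_prime_factors_iff)
      then have "l dvd a" unfolding a_def using fin by (rule dvd_prodI [rotated])
      then have "l dvd u" using l(2) by (simp add: dvd_add_left_iff)
      then show False using False by simp
    qed
  qed
  then show ?thesis by blast
qed

text \<open>Reading \<open>x\<close> as the linear functional \<open>T\<^sup>i \<mapsto> x\<^sub>i\<close> on polynomials, \<open>shift_seq a x l i\<close> is its value
  at \<open>T\<^sup>i (T - a)\<^sup>l\<close>.\<close>

fun shift_seq :: "int \<Rightarrow> (nat \<Rightarrow> int) \<Rightarrow> nat \<Rightarrow> nat \<Rightarrow> int" where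
  "shift_seq a x 0 i = x i"
| "shift_seq a x (Suc l) i = shift_seq a x l (Suc i) - a * shift_seq a x l i"

definition hankel2 :: "(nat \<Rightarrow> int) \<Rightarrow> int" where
  "hankel2 y = y 0 * y 2 - y 1 * y 1"

text \<open>With P = p0 + p1 T + p2 T^2, the functional behind x kills T^i P for i <= k, hence also
  T^i (T - a)^l P while the degree i + l of the cofactor is at most k.\<close>

lemma shift_seq_rec:
  assumes "\<forall>i\<le>k. p0 * x i + p1 * x (Suc i) + p2 * x (Suc (Suc i)) = 0" and "i + l \<le> k"
  shows "p0 * shift_seq a x l i + p1 * shift_seq a x l (Suc i) + p2 * shift_seq a x l (Suc (Suc i)) = 0"
  using assms(2)
proof (induction l arbitrary: i)
  case 0
  then show ?case using assms(1) by simp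
next
  case (Suc l)
  define y where "y = shift_seq a x l"
  have e1: "p0 * y i + p1 * y (Suc i) + p2 * y (Suc (Suc i)) = 0"
    and e2: "p0 * y (Suc i) + p1 * y (Suc (Suc i)) + p2 * y (Suc (Suc (Suc i))) = 0"
    using Suc.IH [of i] Suc.IH [of "Suc i"] Suc.prems by (simp_all add: y_def)
  have "p0 * shift_seq a x (Suc l) i + p1 * shift_seq a x (Suc l) (Suc i) + p2 * shift_seq a x (Suc l) (Suc (Suc i))
    = (p0 * y (Suc i) + p1 * y (Suc (Suc i)) + p2 * y (Suc (Suc (Suc i)))) - a * (p0 * y i + p1 * y (Suc i) + p2 * y (Suc (Suc i)))"
    by (simp add: y_def algebra_simps)
  then show ?case using e1 e2 by simp
qed

text \<open>One shift multiplies the Hankel determinant by P(a) / p2, the product of a - \<theta>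
  over the two roots \<theta> of P, that is, the norm of T - a modulo P.\<close>

lemma hankel2_shift_seq:
  assumes rec: "\<forall>i\<le>k. p0 * x i + p1 * x (Suc i) + p2 * x (Suc (Suc i)) = 0" and "l \<le> k"
  shows "p2 ^ l * hankel2 (shift_seq a x l) = (p0 + p1 * a + p2 * a\<^sup>2) ^ l * hankel2 x"
  using assms(2)
proof (induction l)
  case 0
  then show ?case by (simp add: hankel2_def)
next
  case (Suc l)
  define y where "y = shift_seq a x l"
  define E0 E1 where "E0 = p0 * y 0 + p1 * y 1 + p2 * y 2" and "E1 = p0 * y 1 + p1 * y 2 + p2 * y 3"
  have E: "E0 = 0" "E1 = 0"
    using shift_seq_rec [OF rec, of 0 l a] shift_seq_rec [OF rec, of 1 l a] Suc.prems
    by (simp_all add: E0_def E1_def y_def numeral_2_eq_2 numeral_3_eq_3)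
  \<comment> \<open>A polynomial identity: the difference is a combination of the two instances
    \<open>E0\<close>, \<open>E1\<close> of the recurrence.\<close>
  have "p2 * hankel2 (shift_seq a x (Suc l)) - (p0 + p1 * a + p2 * a\<^sup>2) * hankel2 y
      = (y 1 * E1 - y 2 * E0) - a * (y 0 * E1 - y 1 * E0)"
    by (simp add: hankel2_def y_def E0_def E1_def numeral_2_eq_2 numeral_3_eq_3 algebra_simps)
  then have step: "p2 * hankel2 (shift_seq a x (Suc l)) = (p0 + p1 * a + p2 * a\<^sup>2) * hankel2 y"
    using E by simp
  have "p2 ^ Suc l * hankel2 (shift_seq a x (Suc l)) = p2 ^ l * (p2 * hankel2 (shift_seq a x (Suc l)))" by simp
  also have "\<dots> = (p0 + p1 * a + p2 * a\<^sup>2) * (p2 ^ l * hankel2 y)" unfolding step by simp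
  also have "\<dots> = (p0 + p1 * a + p2 * a\<^sup>2) ^ Suc l * hankel2 x" using Suc by (simp add: y_def)
  finally show ?case .
qed

text \<open>Choosing a shift \<open>a\<close> with \<open>P(a)\<close> coprime to the leading coefficient \<open>p2\<close>, the previous identity shows
  that \<open>p2 ^ k\<close> divides the Hankel determinant of \<open>x\<close>.\<close>

lemma hankel2_shift_seq_eq:
  assumes rec: "\<forall>i\<le>k. p0 * x i + p1 * x (Suc i) + p2 * x (Suc (Suc i)) = 0" and p2: "p2 \<noteq> 0"
    and prim: "\<forall>d. d dvd p0 \<longrightarrow> d dvd p1 \<longrightarrow> d dvd p2 \<longrightarrow> is_unit d" and nz: "hankel2 x \<noteq> 0"
  obtains t :: int where "t \<noteq> 0" "\<forall>a. hankel2 (shift_seq a x k) = t * (p0 + p1 * a + p2 * a\<^sup>2) ^ k"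
proof -
  \<comment> \<open>It suffices to treat a linear expression, as P(b) and p0 + b p1 agree modulo
    p2.\<close>
  obtain b where b: "coprime (p0 + b * p1) p2" using exists_coprime_shift [OF p2 prim] by blast
  have "coprime (p0 + p1 * b + p2 * b\<^sup>2) p2"
  proof -
    have "gcd p2 (b\<^sup>2 * p2 + (p0 + b * p1)) = gcd p2 (p0 + b * p1)" by (rule gcd_add_mult)
    moreover have "b\<^sup>2 * p2 + (p0 + b * p1) = p0 + p1 * b + p2 * b\<^sup>2" by simp
    ultimately show ?thesis using b by (simp add: coprime_iff_gcd_eq_1 gcd.commute)
  qed
  then have cop: "coprime (p2 ^ k) ((p0 + p1 * b + p2 * b\<^sup>2) ^ k)" by (simp add: coprime_commute)
  have "p2 ^ k dvd (p0 + p1 * b + p2 * b\<^sup>2) ^ k * hankel2 x"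
    using hankel2_shift_seq [OF rec, of k b] by (metis dvd_triv_left order_refl)
  then have "p2 ^ k dvd hankel2 x" using cop by (simp add: coprime_dvd_mult_right_iff)
  then obtain t where t: "hankel2 x = p2 ^ k * t" by blast
  show thesis
  proof (rule that [of t], use t nz in simp, intro allI)
    fix a
    have "p2 ^ k * hankel2 (shift_seq a x k) = p2 ^ k * (t * (p0 + p1 * a + p2 * a\<^sup>2) ^ k)"
      using hankel2_shift_seq [OF rec, of k a] by (simp add: t mult_ac)
    then show "hankel2 (shift_seq a x k) = t * (p0 + p1 * a + p2 * a\<^sup>2) ^ k" using p2 by simp
  qed
qed

text \<open>Restricting a to -1, 0, 1 limits the loss to a factor 2 per shift; these three values
  are enough to recover a quadratic polynomial.\<close>

lemma shift_seq_bounds: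
  fixes K \<epsilon> \<zeta> :: real
  assumes a: "\<bar>a\<bar> \<le> 1"
    and K: "\<forall>i\<le>N. \<bar>real_of_int (x i)\<bar> \<le> K" and e: "\<forall>i<N. \<bar>x (Suc i) - \<zeta> * x i\<bar> \<le> \<epsilon>"
  shows "i + l \<le> N \<Longrightarrow> \<bar>shift_seq a x l i\<bar> \<le> 2 ^ l * K"
    and "i + l < N \<Longrightarrow> \<bar>shift_seq a x l (Suc i) - \<zeta> * shift_seq a x l i\<bar> \<le> 2 ^ l * \<epsilon>"
proof -
  have a': "\<bar>real_of_int a\<bar> \<le> 1" using a by linarith
  have comb: "\<bar>u - a * v\<bar> \<le> 2 * M" if "\<bar>u\<bar> \<le> M" "\<bar>v\<bar> \<le> M" for u v M :: real
  proof -
    have "\<bar>a * v\<bar> \<le> 1 * M" unfolding abs_mult using a' that by (intro mult_mono) auto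
    then show ?thesis using that(1) by linarith
  qed
  show "i + l \<le> N \<Longrightarrow> \<bar>shift_seq a x l i\<bar> \<le> 2 ^ l * K"
  proof (induction l arbitrary: i)
    case 0
    then show ?case using K by simp
  next
    case (Suc l)
    have "\<bar>real_of_int (shift_seq a x l (Suc i)) - real_of_int a * real_of_int (shift_seq a x l i)\<bar> \<le> 2 * (2 ^ l * K)"
      using Suc.IH [of "Suc i"] Suc.IH [of i] Suc.prems by (intro comb) auto
    then show ?case by simp
  qed
  show "i + l < N \<Longrightarrow> \<bar>shift_seq a x l (Suc i) - \<zeta> * shift_seq a x l i\<bar> \<le> 2 ^ l * \<epsilon>"
  proof (induction l arbitrary: i)
    case 0
    then show ?case using e by simp
  next
    case (Suc l)
    define g where "g = (\<lambda>i. shift_seq a x l (Suc i) - \<zeta> * shift_seq a x l i)"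
    have "\<bar>g (Suc i) - a * g i\<bar> \<le> 2 * (2 ^ l * \<epsilon>)"
      using Suc.IH [of "Suc i"] Suc.IH [of i] Suc.prems by (intro comb) (auto simp: g_def)
    also have "g (Suc i) - a * g i = shift_seq a x (Suc l) (Suc i) - \<zeta> * shift_seq a x (Suc l) i"
      by (simp add: g_def algebra_simps)
    finally show ?case by simp
  qed
qed

section \<open>Vanishing minors of order 3 and the height of the recurrence\<close>

text \<open>The expression is the determinant with rows (x_i, x_(i+1), x_(i+2)), (x_j, x_(j+1),
  x_(j+2)), (x_(j+1), x_(j+2), x_(j+3)), expanded along the first row. Subtracting \<zeta> times the
  preceding column from the last two columns leaves six terms, each one entry times two
  errors.\<close>

lemma hankel3_vanishes:
  fixes K \<epsilon> \<zeta> :: real and x :: "nat \<Rightarrow> int"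
  assumes K: "\<forall>i\<le>N. \<bar>real_of_int (x i)\<bar> \<le> K" and e: "\<forall>i<N. \<bar>x (Suc i) - \<zeta> * x i\<bar> \<le> \<epsilon>"
    and small: "6 * K * \<epsilon>\<^sup>2 < 1" and i: "i + 2 \<le> N" and j: "j + 3 \<le> N"
  shows "(x (j + 1) * x (j + 3) - x (j + 2) * x (j + 2)) * x i
     + (x (j + 1) * x (j + 2) - x j * x (j + 3)) * x (Suc i)
     + (x j * x (j + 2) - x (j + 1) * x (j + 1)) * x (Suc (Suc i)) = 0" (is "?Z = 0")
proof (rule int_zero_of_small)
  define f where "f = (\<lambda>i. x (Suc i) - \<zeta> * x i)"
  have f: "\<bar>f m\<bar> \<le> \<epsilon>" if "m < N" for m using e that by (simp add: f_def)
  have K0: "0 \<le> K" using K [rule_format, of 0] by simp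
  have e0: "0 \<le> \<epsilon>" using f [of 0] i by simp
  have tri: "\<bar>x m * (f u * f v)\<bar> \<le> K * \<epsilon>\<^sup>2" if "m \<le> N" "u < N" "v < N" for m u v
    unfolding abs_mult power2_eq_square using K [rule_format, OF that(1)] f [OF that(2)] f [OF that(3)] K0 e0
    by (intro mult_mono) auto
  have "real_of_int ?Z = x i * (f j * f (j + 2)) - x i * (f (j + 1) * f (j + 1)) - x j * (f i * f (j + 2))
      + x (j + 1) * (f i * f (j + 1)) + x j * (f (Suc i) * f (j + 1)) - x (j + 1) * (f (Suc i) * f j)"
    by (simp add: f_def numeral_2_eq_2 numeral_3_eq_3 algebra_simps)
  moreover have "\<bar>x i * (f j * f (j + 2))\<bar> \<le> K * \<epsilon>\<^sup>2" "\<bar>x i * (f (j + 1) * f (j + 1))\<bar> \<le> K * \<epsilon>\<^sup>2"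
    "\<bar>x j * (f i * f (j + 2))\<bar> \<le> K * \<epsilon>\<^sup>2" "\<bar>x (j + 1) * (f i * f (j + 1))\<bar> \<le> K * \<epsilon>\<^sup>2"
    "\<bar>x j * (f (Suc i) * f (j + 1))\<bar> \<le> K * \<epsilon>\<^sup>2" "\<bar>x (j + 1) * (f (Suc i) * f j)\<bar> \<le> K * \<epsilon>\<^sup>2"
    using i j by (auto intro!: tri simp del: abs_mult)
  ultimately have "\<bar>real_of_int ?Z\<bar> \<le> 6 * (K * \<epsilon>\<^sup>2)" by linarith
  then show "\<bar>real_of_int ?Z\<bar> < 1" using small by linarith
qed

text \<open>A nonzero minor of order 2 supplies the recurrence through the minors of order 3, and
  dividing by the common factor makes P primitive. The shifted Hankel determinant is then t P(a)^k
  with |t| >= 1, yet still of size K \<epsilon>: the minors bound the k-th power of P(a), not merely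
  P(a).\<close>

lemma hankel_quadratic:
  fixes K \<epsilon> \<zeta> :: real and x :: "nat \<Rightarrow> int"
  assumes k: "1 \<le> k"
    and K: "\<forall>i\<le>k + 2. \<bar>real_of_int (x i)\<bar> \<le> K" and e: "\<forall>i<k + 2. \<bar>x (Suc i) - \<zeta> * x i\<bar> \<le> \<epsilon>"
    and small: "6 * K * \<epsilon>\<^sup>2 < 1" and nz: "\<And>i. i \<le> k \<Longrightarrow> x i \<noteq> 0"
    and ngeo: "\<not> (\<forall>i<k + 1. x 0 * x (Suc i) = x 1 * x i)"
  obtains p0 p1 p2 :: int where "p2 \<noteq> 0" "p0 * x 0 + p1 * x 1 + p2 * x 2 = 0"
    "\<forall>a. \<bar>a\<bar> \<le> 1 \<longrightarrow> \<bar>real_of_int (p0 + p1 * a + p2 * a\<^sup>2)\<bar> ^ k \<le> 2 * 4 ^ k * (K * \<epsilon>)"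
proof -
  have K0: "0 \<le> K" using K [rule_format, of 0] by simp
  have e0: "0 \<le> \<epsilon>" using e [rule_format, of 0] by simp
  \<comment> \<open>If all these minors vanished, cancelling the nonzero entries would make x
    geometric.\<close>
  have "\<exists>j<k. x j * x (Suc (Suc j)) \<noteq> x (Suc j) * x (Suc j)"
  proof (rule ccontr)
    assume "\<not> ?thesis"
    then have sq: "x j * x (Suc (Suc j)) = x (Suc j) * x (Suc j)" if "j < k" for j using that by blast
    have "x 0 * x (Suc i) = x 1 * x i" if "i \<le> k" for i
      using that
    proof (induction i)
      case (Suc i)
      have "x i * (x 0 * x (Suc (Suc i))) = x 0 * (x i * x (Suc (Suc i)))" by simp
      also have "\<dots> = (x 0 * x (Suc i)) * x (Suc i)" using sq [of i] Suc.prems by simp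
      also have "\<dots> = x i * (x 1 * x (Suc i))" using Suc by simp
      finally show ?case using nz [of i] Suc.prems by simp
    qed simp
    then show False using ngeo by simp
  qed
  then obtain j where j: "j < k" "x j * x (Suc (Suc j)) \<noteq> x (Suc j) * x (Suc j)" by blast
  define A0 A1 A2 where "A0 = x (j + 1) * x (j + 3) - x (j + 2) * x (j + 2)"
    and "A1 = x (j + 1) * x (j + 2) - x j * x (j + 3)" and "A2 = x j * x (j + 2) - x (j + 1) * x (j + 1)"
  have A2: "A2 \<noteq> 0" using j(2) by (simp add: A2_def)
  have Arec: "A0 * x i + A1 * x (Suc i) + A2 * x (Suc (Suc i)) = 0" if "i \<le> k" for i
    unfolding A0_def A1_def A2_def
    by (rule hankel3_vanishes [OF K e small]) (use that j in auto)
  define g where "g = gcd A0 (gcd A1 A2)"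
  have g0: "g \<noteq> 0" using A2 by (simp add: g_def)
  obtain p0 p1 p2 where p: "A0 = g * p0" "A1 = g * p1" "A2 = g * p2"
    using gcd_dvd1 [of A0 "gcd A1 A2"] gcd_dvd2 [of A0 "gcd A1 A2"] gcd_dvd1 [of A1 A2] gcd_dvd2 [of A1 A2]
    unfolding g_def [symmetric] by (meson dvdE dvd_trans)
  have p2: "p2 \<noteq> 0" using A2 p by auto
  have prim: "\<forall>d. d dvd p0 \<longrightarrow> d dvd p1 \<longrightarrow> d dvd p2 \<longrightarrow> is_unit d"
  proof (intro allI impI)
    fix d assume d: "d dvd p0" "d dvd p1" "d dvd p2"
    have "g * d dvd A0" "g * d dvd A1" "g * d dvd A2" unfolding p using d by (auto intro: mult_dvd_mono)
    then have "g * d dvd g" unfolding g_def by (metis gcd_greatest)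
    then show "is_unit d" using g0 by simp
  qed
  have rec: "\<forall>i\<le>k. p0 * x i + p1 * x (Suc i) + p2 * x (Suc (Suc i)) = 0"
  proof (intro allI impI)
    fix i assume that: "i \<le> k"
    have "g * (p0 * x i + p1 * x (Suc i) + p2 * x (Suc (Suc i))) = 0"
      using Arec [OF that] by (simp add: p algebra_simps)
    then show "p0 * x i + p1 * x (Suc i) + p2 * x (Suc (Suc i)) = 0" using g0 by simp
  qed
  \<comment> \<open>The recurrence multiplies consecutive minors by p0 / p2, so vanishing at index 0
    would spread to j.\<close>
  have "hankel2 x \<noteq> 0"
  proof
    assume h: "hankel2 x = 0"
    have "x i * x (Suc (Suc i)) = x (Suc i) * x (Suc i)" if "i \<le> k" for i
      using that
    proof (induction i)
      case 0
      then show ?case using h by (simp add: hankel2_def numeral_2_eq_2)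
    next
      case (Suc i)
      define y0 y1 y2 y3 where "y0 = x i" and "y1 = x (Suc i)" and "y2 = x (Suc (Suc i))" and "y3 = x (Suc (Suc (Suc i)))"
      have "p2 * (y1 * y3 - y2 * y2) - p0 * (y0 * y2 - y1 * y1)
        = y1 * (p0 * y1 + p1 * y2 + p2 * y3) - y2 * (p0 * y0 + p1 * y1 + p2 * y2)"
        by (simp add: algebra_simps)
      then have "p2 * (y1 * y3 - y2 * y2) = 0"
        using rec [rule_format, of i] rec [rule_format, of "Suc i"] Suc by (simp add: y0_def y1_def y2_def y3_def)
      then show ?case using p2 by (simp add: y1_def y2_def y3_def)
    qed
    then show False using j by auto
  qed
  then obtain t where t: "t \<noteq> 0" "\<forall>a. hankel2 (shift_seq a x k) = t * (p0 + p1 * a + p2 * a\<^sup>2) ^ k"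
    using hankel2_shift_seq_eq [OF rec p2 prim] by blast
  have "\<bar>real_of_int (p0 + p1 * a + p2 * a\<^sup>2)\<bar> ^ k \<le> 2 * 4 ^ k * (K * \<epsilon>)" if a: "\<bar>a\<bar> \<le> 1" for a
  proof -
    define y where "y = shift_seq a x k"
    define g0 g1 where "g0 = y 1 - \<zeta> * y 0" and "g1 = y 2 - \<zeta> * y 1"
    have y: "\<bar>y 0\<bar> \<le> 2 ^ k * K" "\<bar>y 1\<bar> \<le> 2 ^ k * K"
      using shift_seq_bounds(1) [OF a K e, of 0 k] shift_seq_bounds(1) [OF a K e, of 1 k] by (simp_all add: y_def)
    have g: "\<bar>g0\<bar> \<le> 2 ^ k * \<epsilon>" "\<bar>g1\<bar> \<le> 2 ^ k * \<epsilon>"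
      using shift_seq_bounds(2) [OF a K e, of 0 k] shift_seq_bounds(2) [OF a K e, of 1 k]
      by (simp_all add: y_def g0_def g1_def numeral_2_eq_2)
    have "\<bar>real_of_int (p0 + p1 * a + p2 * a\<^sup>2)\<bar> ^ k \<le> \<bar>real_of_int t\<bar> * \<bar>real_of_int (p0 + p1 * a + p2 * a\<^sup>2)\<bar> ^ k"
      using t(1) by (simp add: mult_le_cancel_right1 del: of_int_add) linarith
    also have "\<dots> = \<bar>real_of_int (hankel2 y)\<bar>"
      using t(2) by (simp add: y_def abs_mult power_abs del: of_int_add)
    \<comment> \<open>The main terms cancel, leaving an entry times an error twice; the k shifts
      contribute 2^k to each factor, hence 2 * 4^k.\<close>
    also have "real_of_int (hankel2 y) = y 0 * g1 - y 1 * g0"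
      by (simp add: hankel2_def g0_def g1_def algebra_simps)
    also have "\<bar>\<dots>\<bar> \<le> \<bar>real_of_int (y 0)\<bar> * \<bar>g1\<bar> + \<bar>real_of_int (y 1)\<bar> * \<bar>g0\<bar>"
      unfolding abs_mult [symmetric] by linarith
    also have "\<dots> \<le> (2 ^ k * K) * (2 ^ k * \<epsilon>) + (2 ^ k * K) * (2 ^ k * \<epsilon>)"
      using y g K0 e0 by (intro add_mono mult_mono) auto
    also have "\<dots> = 2 * 4 ^ k * (K * \<epsilon>)"
      by (simp add: power_mult_distrib [symmetric] mult_ac) 
    finally show ?thesis .
  qed
  moreover have "p0 * x 0 + p1 * x 1 + p2 * x 2 = 0" using rec [rule_format, of 0] by (simp add: numeral_2_eq_2)
  ultimately show thesis using p2 by (intro that) auto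
qed

text \<open>Interpolation at -1, 0, 1: p1 = (P(1) - P(-1)) / 2 and p2 = (P(1) + P(-1)) / 2 -
  P(0).\<close>

lemma quadratic_coeffs_le:
  fixes p0 p1 p2 :: int
  shows "\<exists>a. \<bar>a\<bar> \<le> 1 \<and> max \<bar>p0\<bar> (max \<bar>p1\<bar> \<bar>p2\<bar>) \<le> 2 * \<bar>p0 + p1 * a + p2 * a\<^sup>2\<bar>"
proof (rule ccontr)
  define m where "m = max \<bar>p0\<bar> (max \<bar>p1\<bar> \<bar>p2\<bar>)"
  assume "\<not> ?thesis"
  then have *: "2 * \<bar>p0 + p1 * a + p2 * a\<^sup>2\<bar> < m" if "\<bar>a\<bar> \<le> 1" for a
    using that unfolding m_def by (meson not_le)
  have **: "2 * \<bar>p0\<bar> < m" "2 * \<bar>p0 + p1 + p2\<bar> < m" "2 * \<bar>p0 - p1 + p2\<bar> < m"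
    using * [of 0] * [of 1] * [of "- 1"] by simp_all
  then have "\<bar>p0\<bar> < m" by linarith
  moreover have "2 * p1 < m" "- (2 * p1) < m" 
    using **(2,3) by (simp_all add: abs_if split: if_splits)
  then have "\<bar>p1\<bar> < m" by linarith
  moreover have "p2 < m" "- p2 < m"
    using ** by (simp_all add: abs_if split: if_splits)
  then have "\<bar>p2\<bar> < m" by linarith
  ultimately have "max \<bar>p0\<bar> (max \<bar>p1\<bar> \<bar>p2\<bar>) < m" by simp
  then show False by (simp only: m_def)
qed

section \<open>From \<lambda>_n > 1/2 to infinite w_2\<close>

text \<open>With X = |x_0| the coefficient bound satisfies H^k <= C X^(1/2), and V = |P(\<zeta>)|
  satisfies V X <= 2 H. Eliminating X leaves V at most a constant times H^(1 - 2 k), with k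
  arbitrary.\<close>

lemma w_exp_2_infinite:
  fixes \<zeta> :: real
  assumes irr: "\<zeta> \<notin> \<rat>" and w1: "w_exp 1 \<zeta> < \<infinity>"
    and lam: "\<forall>n\<ge>1. lam_exp n \<zeta> > ereal (1 / 2)"
    and nquad: "\<forall>(p0 :: int) (p1 :: int) (p2 :: int). p2 \<noteq> (0 :: int) \<longrightarrow> p0 + p1 * \<zeta> + p2 * \<zeta>\<^sup>2 \<noteq> 0"
  shows "w_exp 2 \<zeta> = \<infinity>"
proof (rule ereal_top)
  fix M :: real
  obtain W where W: "w_exp 1 \<zeta> < ereal W" using ereal_dense2 [OF w1] by blast
  \<comment> \<open>k >= W serves to exclude geometric vectors, k >= M to make 2 k - 1 at least
    M.\<close>
  define k where "k = nat \<lceil>max M (max W 1)\<rceil>"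
  have k: "1 \<le> k" "M \<le> real k" "W \<le> real k" unfolding k_def by linarith+
  have "ereal (1 / 2) < lam_exp (k + 2) \<zeta>" using lam by simp
  then obtain l where l: "ereal (1 / 2) < ereal l" "ereal l < lam_exp (k + 2) \<zeta>"
    using ereal_dense2 by blast
  have l2: "1 / 2 < l" "0 < l" using l(1) by simp_all
  \<comment> \<open>Arbitrarily large geometric vectors would give w_1 >= k + (k + 1) l >= W. So
    beyond some \<open>B0\<close> no solution is geometric.\<close>
  have "\<not> (\<forall>B :: real. \<exists>x :: nat \<Rightarrow> int. 1 \<le> \<bar>x 0\<bar> \<and> B \<le> real_of_int \<bar>x 0\<bar> \<and>
      (\<forall>i<k + 1. x 0 * x (Suc i) = x 1 * x i) \<and> \<bar>\<zeta> * x 0 - x 1\<bar> \<le> real_of_int \<bar>x 0\<bar> powr (- l))" (is "\<not> ?ex")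
  proof
    assume ?ex
    then have "ereal (real (k + 1) - 1 + real (k + 1) * l) \<le> w_exp 1 \<zeta>"
      using l2(2) by (intro w_exp_1_ge_of_geometric [OF irr]) (simp, simp, rule spec)
    moreover have "0 \<le> real (k + 1) * l" using l2(2) by simp
    then have "W \<le> real (k + 1) - 1 + real (k + 1) * l" using k(3) by linarith
    then have "ereal W \<le> ereal (real (k + 1) - 1 + real (k + 1) * l)" by simp
    ultimately have "ereal W \<le> w_exp 1 \<zeta>" by (rule order_trans [rotated])
    then show False using W by (simp add: not_less [symmetric] del: One_nat_def)
  qed
  then obtain B0 :: real where B0: "\<not> (\<exists>x :: nat \<Rightarrow> int. 1 \<le> \<bar>x 0\<bar> \<and> B0 \<le> real_of_int \<bar>x 0\<bar> \<and>
      (\<forall>i<k + 1. x 0 * x (Suc i) = x 1 * x i) \<and> \<bar>\<zeta> * x 0 - x 1\<bar> \<le> real_of_int \<bar>x 0\<bar> powr (- l))"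
    by blast
  define Z where "Z = 1 + \<bar>\<zeta>\<bar>"
  have Z1: "1 \<le> Z" by (simp add: Z_def)
  define Kc where "Kc = Z ^ (k + 2) + 1"
  have Kc1: "1 \<le> Kc" using Z1 by (simp add: Kc_def)
  \<comment> \<open>A lower bound for |\<zeta>|^i over all indices that occur; |x_0| >= 2 / c keeps
    x_i nonzero, as its error is at most 1.\<close>
  define c where "c = min 1 \<bar>\<zeta>\<bar> ^ (k + 2)"
  have "\<zeta> \<noteq> 0" using irr by auto
  then have c0: "0 < c" by (simp add: c_def)
  \<comment> \<open>The factor 2^k compares H^k with |P(a)|^k; the rest is the bound of
    \<open>hankel_quadratic\<close> without its powers of X.\<close>
  define C where "C = 2 ^ k * (2 * 4 ^ k * (Kc * Z))"
  have C0: "0 < C" using Kc1 Z1 by (simp add: C_def)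
  have "ereal (2 * real k - 1) \<le> w_exp 2 \<zeta>"
  proof (rule w_exp_geI)
    fix \<epsilon> :: real assume \<epsilon>: "0 < \<epsilon>"
    have "\<exists>B\<ge>1. \<forall>H\<ge>B. H powr (- (2 * l - 1)) < 1 / (6 * Kc * Z\<^sup>2)"
      using l2 Kc1 Z1 by (intro powr_minus_eventually_small) auto
    then obtain B1 where B1: "1 \<le> B1" "\<forall>H\<ge>B1. H powr (- (2 * l - 1)) < 1 / (6 * Kc * Z\<^sup>2)" by blast
    have "\<exists>B\<ge>1. \<forall>H\<ge>B. H powr (- (1 / 2)) < \<epsilon> / (2 * C)"
      using \<epsilon> C0 by (intro powr_minus_eventually_small) auto
    then obtain B2 where B2: "1 \<le> B2" "\<forall>H\<ge>B2. H powr (- (1 / 2)) < \<epsilon> / (2 * C)" by blast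
    have n1: "1 \<le> k + 2" by simp
    obtain x :: "nat \<Rightarrow> int" where x: "1 \<le> \<bar>x 0\<bar>" "max (max B0 B1) (max B2 (2 / c)) \<le> real_of_int \<bar>x 0\<bar>"
       "\<forall>i\<in>{1..k + 2}. \<bar>\<zeta> ^ i * x 0 - x i\<bar> \<le> real_of_int \<bar>x 0\<bar> powr (- l)"
      using lam_exp_gtD [OF irr n1 l2(2) l(2)] by blast
    define X where "X = real_of_int \<bar>x 0\<bar>"
    have X: "1 \<le> X" "B0 \<le> X" "B1 \<le> X" "B2 \<le> X" "2 / c \<le> X" using x(1,2) by (auto simp: X_def)
    define e where "e = (\<lambda>i. x i - \<zeta> ^ i * x 0)"
    have e: "\<bar>e i\<bar> \<le> X powr (- l)" if "i \<le> k + 2" for i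
      using x(3) that by (cases "i = 0") (auto simp: e_def X_def abs_minus_commute)
    have Xl1: "X powr (- l) \<le> 1"
      using X(1) l2 by (simp add: powr_minus ge_one_powr_ge_zero inverse_le_1_iff)
    have e1: "\<bar>e i\<bar> \<le> 1" if "i \<le> k + 2" for i using e [OF that] Xl1 by linarith
    have xe: "x i = \<zeta> ^ i * x 0 + e i" for i by (simp add: e_def)
    have xz: "\<bar>\<zeta> ^ i * x 0\<bar> = \<bar>\<zeta>\<bar> ^ i * X" for i by (simp add: X_def abs_mult power_abs)
    have K: "\<forall>i\<le>k + 2. \<bar>real_of_int (x i)\<bar> \<le> Kc * X"
    proof (intro allI impI)
      fix i assume i: "i \<le> k + 2"
      have "\<bar>\<zeta>\<bar> ^ i \<le> Z ^ i" by (intro power_mono) (auto simp: Z_def)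
      also have "\<dots> \<le> Z ^ (k + 2)" using Z1 i by (intro power_increasing) auto
      finally have "\<bar>\<zeta>\<bar> ^ i * X \<le> Z ^ (k + 2) * X" using X(1) by (intro mult_right_mono) auto
      then show "\<bar>real_of_int (x i)\<bar> \<le> Kc * X"
        using e1 [OF i] X(1) xz [of i] unfolding xe [of i] Kc_def distrib_right by linarith
    qed
    have f: "\<forall>i<k + 2. \<bar>x (Suc i) - \<zeta> * x i\<bar> \<le> Z * X powr (- l)"
    proof (intro allI impI)
      fix i assume i: "i < k + 2"
      have "x (Suc i) - \<zeta> * x i = e (Suc i) - \<zeta> * e i" by (simp add: e_def algebra_simps)
      also have "\<bar>\<dots>\<bar> \<le> \<bar>e (Suc i)\<bar> + \<bar>\<zeta>\<bar> * \<bar>e i\<bar>" unfolding abs_mult [symmetric] by linarith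
      also have "\<dots> \<le> X powr (- l) + \<bar>\<zeta>\<bar> * X powr (- l)"
        using e [of "Suc i"] e [of i] i by (intro add_mono mult_left_mono) auto
      finally show "\<bar>x (Suc i) - \<zeta> * x i\<bar> \<le> Z * X powr (- l)" by (simp add: Z_def algebra_simps)
    qed
    have small: "6 * (Kc * X) * (Z * X powr (- l))\<^sup>2 < 1"
    proof -
      have "X * (X powr (- l))\<^sup>2 = X powr 1 * (X powr (- l) * X powr (- l))" using X(1) by (simp add: power2_eq_square)
      also have "\<dots> = X powr (- (2 * l - 1))" by (simp only: powr_add [symmetric]) simp
      finally have "6 * (Kc * X) * (Z * X powr (- l))\<^sup>2 = 6 * Kc * Z\<^sup>2 * X powr (- (2 * l - 1))"
        by (simp add: power_mult_distrib mult_ac)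
      also have "\<dots> < 6 * Kc * Z\<^sup>2 * (1 / (6 * Kc * Z\<^sup>2))"
        using B1(2) X(3) Kc1 Z1 by (intro mult_strict_left_mono) auto
      also have "\<dots> = 1" using Kc1 Z1 by simp
      finally show ?thesis .
    qed
    have nz: "x i \<noteq> 0" if i: "i \<le> k" for i
    proof
      assume "x i = 0"
      have "c \<le> min 1 \<bar>\<zeta>\<bar> ^ i" unfolding c_def using i by (intro power_decreasing) auto
      also have "\<dots> \<le> \<bar>\<zeta>\<bar> ^ i" by (intro power_mono) auto
      finally have "c * X \<le> \<bar>\<zeta>\<bar> ^ i * X" using X(1) by (intro mult_right_mono) auto
      moreover have "2 \<le> c * X" using X(5) c0 by (simp add: field_simps)
      ultimately show False using xe [of i] \<open>x i = 0\<close> e1 [of i] i xz [of i] by simp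
    qed
    have ngeo: "\<not> (\<forall>i<k + 1. x 0 * x (Suc i) = x 1 * x i)"
    proof
      assume geo: "\<forall>i<k + 1. x 0 * x (Suc i) = x 1 * x i"
      have "\<bar>\<zeta> * x 0 - x 1\<bar> \<le> real_of_int \<bar>x 0\<bar> powr (- l)"
        using x(3) [rule_format, of 1] by simp
      then show False using B0 geo x(1) X(2) unfolding X_def by blast
    qed
    obtain p0 p1 p2 :: int where p2: "p2 \<noteq> 0" and root: "p0 * x 0 + p1 * x 1 + p2 * x 2 = 0"
      and val: "\<forall>a. \<bar>a\<bar> \<le> 1 \<longrightarrow> \<bar>real_of_int (p0 + p1 * a + p2 * a\<^sup>2)\<bar> ^ k
         \<le> 2 * 4 ^ k * ((Kc * X) * (Z * X powr (- l)))"
      by (rule hankel_quadratic [OF k(1) K f small nz ngeo])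
    define H where "H = real_of_int (max \<bar>p0\<bar> (max \<bar>p1\<bar> \<bar>p2\<bar>))"
    have pH: "\<bar>real_of_int p0\<bar> \<le> H" "\<bar>real_of_int p1\<bar> \<le> H" "\<bar>real_of_int p2\<bar> \<le> H"
      unfolding H_def by (simp_all add: le_max_iff_disj)
    have "1 \<le> \<bar>real_of_int p2\<bar>" using p2 by linarith
    then have "1 \<le> H" using pH(3) by linarith
    note H = pH this
    obtain a where a: "\<bar>a\<bar> \<le> 1" "max \<bar>p0\<bar> (max \<bar>p1\<bar> \<bar>p2\<bar>) \<le> 2 * \<bar>p0 + p1 * a + p2 * a\<^sup>2\<bar>"
      using quadratic_coeffs_le by blast
    have "H \<le> 2 * \<bar>real_of_int (p0 + p1 * a + p2 * a\<^sup>2)\<bar>" unfolding H_def using a(2) by linarith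
    then have "H ^ k \<le> (2 * \<bar>real_of_int (p0 + p1 * a + p2 * a\<^sup>2)\<bar>) ^ k" using H(4) by (intro power_mono) auto
    also have "\<dots> = 2 ^ k * \<bar>real_of_int (p0 + p1 * a + p2 * a\<^sup>2)\<bar> ^ k" by (rule power_mult_distrib)
    also have "\<dots> \<le> 2 ^ k * (2 * 4 ^ k * ((Kc * X) * (Z * X powr (- l))))"
      using val a(1) by (intro mult_left_mono) auto
    also have "\<dots> = C * (X * X powr (- l))" by (simp add: C_def mult_ac)
    also have "X * X powr (- l) = X powr (1 - l)" using X(1) by (simp add: powr_diff powr_minus field_simps)
    also have "C * X powr (1 - l) \<le> C * X powr (1 / 2)" using X(1) l2 C0 by (intro mult_left_mono powr_mono) auto
    finally have Hk: "H ^ k \<le> C * X powr (1 / 2)" .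
    define V where "V = \<bar>p0 + p1 * \<zeta> + p2 * \<zeta>\<^sup>2\<bar>"
    have V0: "0 < V" using nquad p2 by (simp add: V_def)
    have "real_of_int (p0 * x 0 + p1 * x 1 + p2 * x 2) = 0" using root by (simp only: of_int_0)
    \<comment> \<open>Substitute x_i = \<zeta>^i x_0 + e_i into the recurrence at index 0, where e_0
      = 0.\<close>
    then have "(p0 + p1 * \<zeta> + p2 * \<zeta>\<^sup>2) * x 0 = - (p1 * e 1 + p2 * e 2)"
      by (simp add: e_def algebra_simps)
    then have "V * X = \<bar>p1 * e 1 + p2 * e 2\<bar>"
      unfolding V_def X_def of_int_abs abs_mult [symmetric] by simp
    also have "\<dots> \<le> \<bar>real_of_int p1\<bar> * \<bar>e 1\<bar> + \<bar>real_of_int p2\<bar> * \<bar>e 2\<bar>"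
      unfolding abs_mult [symmetric] by (rule abs_triangle_ineq)
    also have "\<dots> \<le> H * 1 + H * 1" using H e1 [of 1] e1 [of 2] by (intro add_mono mult_mono) auto
    finally have VX: "V * X \<le> 2 * H" by simp
    have XX: "X powr (1 / 2) * X powr (1 / 2) = X" using X(1) by (simp flip: powr_add)
    have "V < \<epsilon>"
    proof -
      have "H \<le> H ^ k" using H(4) k(1) by (metis power_increasing power_one_right)
      then have "V * X \<le> 2 * (C * X powr (1 / 2))" using VX Hk by linarith
      then have "(V * X powr (1 / 2)) * X powr (1 / 2) \<le> (2 * C) * X powr (1 / 2)"
        using XX by (simp add: mult.assoc)
      then have "V * X powr (1 / 2) \<le> 2 * C" using X(1) by simp
      then have "V \<le> 2 * C * X powr (- (1 / 2))" using X(1) by (simp add: powr_minus field_simps)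
      also have "\<dots> < 2 * C * (\<epsilon> / (2 * C))" using B2(2) X(4) C0 by (intro mult_strict_left_mono) auto
      also have "\<dots> = \<epsilon>" using C0 by simp
      finally show ?thesis .
    qed
    have "(H ^ k)\<^sup>2 \<le> (C * X powr (1 / 2))\<^sup>2" using Hk H(4) by (intro power_mono) auto
    also have "\<dots> = C\<^sup>2 * X" using XX by (simp add: power_mult_distrib power2_eq_square)
    finally have Hk2: "(H ^ k)\<^sup>2 \<le> C\<^sup>2 * X" .
    have "V * (H ^ k)\<^sup>2 \<le> V * (C\<^sup>2 * X)" using Hk2 V0 by (intro mult_left_mono) auto
    also have "\<dots> = C\<^sup>2 * (V * X)" by simp
    also have "\<dots> \<le> C\<^sup>2 * (2 * H)" using VX by (intro mult_left_mono) auto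
    finally have "V * (H ^ k)\<^sup>2 \<le> 2 * C\<^sup>2 * H" by simp
    then have "V \<le> 2 * C\<^sup>2 * H / (H ^ k)\<^sup>2" using H(4) by (subst pos_le_divide_eq) auto
    moreover have "H powr (- (2 * real k - 1)) = H / (H ^ k)\<^sup>2"
    proof -
      have "H powr (- (2 * real k - 1)) = H powr (1 - real (2 * k))" by simp
      also have "\<dots> = H / H ^ (2 * k)" using H(4) by (simp only: powr_diff powr_realpow) simp
      finally show ?thesis by (simp add: power_mult [symmetric] mult.commute)
    qed
    ultimately have Vfin: "V \<le> 2 * C\<^sup>2 * H powr (- (2 * real k - 1))" by simp
    define P where "P = [:p0, p1, p2:]"
    have deg: "degree P \<le> 2" by (simp add: P_def)
    have Pval: "\<bar>poly (map_poly of_int P) \<zeta>\<bar> = V"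
      using poly_of_int_degree2 [OF deg, of \<zeta>] by (simp add: P_def V_def numeral_2_eq_2)
    have "height P \<le> max \<bar>p0\<bar> (max \<bar>p1\<bar> \<bar>p2\<bar>)"
      by (auto simp: height_le_iff P_def coeff_pCons split: nat.splits)
    then have hH: "real_of_int (height P) \<le> H" unfolding H_def by (simp only: of_int_le_iff)
    have h1: "1 \<le> height P" using p2 by (intro height_ge_1) (simp add: P_def)
    have "H powr (- (2 * real k - 1)) \<le> real_of_int (height P) powr (- (2 * real k - 1))"
      using hH h1 k(1) by (intro powr_mono2') auto
    then have "2 * C\<^sup>2 * H powr (- (2 * real k - 1)) \<le> 2 * C\<^sup>2 * real_of_int (height P) powr (- (2 * real k - 1))"
      by (intro mult_left_mono) auto
    then show "\<exists>P :: int poly. degree P \<le> 2 \<and> 0 < \<bar>poly (map_poly of_int P) \<zeta>\<bar> \<and>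
         \<bar>poly (map_poly of_int P) \<zeta>\<bar> < \<epsilon> \<and>
         \<bar>poly (map_poly of_int P) \<zeta>\<bar> \<le> 2 * C\<^sup>2 * real_of_int (height P) powr (- (2 * real k - 1))"
      using deg Pval V0 \<open>V < \<epsilon>\<close> Vfin by (intro exI [of _ P]) auto
  qed
  moreover have "ereal M \<le> ereal (2 * real k - 1)" using k by simp
  ultimately show "ereal M \<le> w_exp 2 \<zeta>" by (rule order_trans [rotated])
qed

section \<open>The joint spectrum\<close>

lemma lam_exp_rational:
  assumes "\<zeta> \<in> \<rat>" and n: "1 \<le> n"
  shows "lam_exp n \<zeta> = \<infinity>"
proof (rule ereal_top)
  fix M :: real
  obtain a b :: int where ab: "0 < b" "\<zeta> = a / b" using assms by (meson Rats_cases')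
  show "ereal M \<le> lam_exp n \<zeta>"
  proof (rule lam_exp_geI)
    fix B :: real
    define t where "t = max 1 \<lceil>B\<rceil>"
    define v where "v = (\<lambda>i. t * (b ^ (n - i) * a ^ i))"
    have bn: "1 \<le> b ^ n" using ab(1) by simp
    have v0: "\<bar>v 0\<bar> = t * b ^ n" using ab(1) by (simp add: v_def t_def abs_mult)
    have "t * 1 \<le> t * b ^ n" using bn by (intro mult_left_mono) (auto simp: t_def)
    then have t: "t \<le> \<bar>v 0\<bar>" using v0 by simp
    have "\<zeta> ^ i * v 0 - v i = 0" if i: "i \<in> {1..n}" for i
    proof -
      have "real_of_int b ^ n = b ^ (n - i) * b ^ i" using i by (simp flip: power_add)
      then show ?thesis using ab(1) by (simp add: v_def ab(2) power_divide)
    qed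
    moreover have "1 \<le> \<bar>v 0\<bar>" using t by (simp add: t_def)
    moreover have "B \<le> real_of_int \<bar>v 0\<bar>" using t unfolding t_def by linarith
    ultimately show "\<exists>v :: nat \<Rightarrow> int. 1 \<le> \<bar>v 0\<bar> \<and> B \<le> real_of_int \<bar>v 0\<bar> \<and>
       (\<forall>i\<in>{1..n}. \<bar>\<zeta> ^ i * v 0 - v i\<bar> \<le> 0 * real_of_int \<bar>v 0\<bar> powr (- M))"
      by (intro exI [of _ v]) simp
  qed
qed

lemma lam_exp_w_exp_1_infinite:
  assumes n: "1 \<le> n" and w1: "w_exp 1 \<zeta> = \<infinity>"
  shows "lam_exp n \<zeta> = \<infinity>"
proof (rule ereal_top)
  fix M :: real
  define w where "w = max 1 (real n * M + real n - 1)"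
  have "ereal ((w + 1 - real n) / real n) \<le> lam_exp n \<zeta>"
    by (rule lam_exp_ge_w_exp_1 [OF n]) (simp add: w_def, simp only: w1, simp)
  moreover have "M \<le> (w + 1 - real n) / real n" using n by (simp add: w_def field_simps)
  ultimately show "ereal M \<le> lam_exp n \<zeta>" by (meson ereal_less_eq(3) order_trans)
qed

text \<open>Geometric vectors give the lower bound (w + 1 - n) / n, small quadratic polynomials the
  lower bound 1, and vanishing minors exclude anything larger. So \<lambda>_n depends on \<zeta>
  only through w_1.\<close>

lemma lam_exp_of_small_quadratics:
  fixes \<zeta> w :: real
  assumes irr: "\<zeta> \<notin> \<rat>" and n: "1 \<le> n" and w: "w_exp 1 \<zeta> = ereal w" and sq: "small_quadratics \<zeta>"
  shows "lam_exp n \<zeta> = ereal (max 1 ((w + 1 - real n) / real n))" and "lam_exp_j n 2 \<zeta> = 1"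
proof -
  have w1: "1 \<le> w" using w_exp_1_ge_1 [OF irr] w by simp
  have "1 \<le> lam_exp_j n 2 \<zeta>" using w by (intro lam_exp_2_ge_1 [OF irr n _ sq]) simp
  then show two: "lam_exp_j n 2 \<zeta> = 1" using lam_exp_2_le_1 [OF n] by (rule antisym [rotated])
  have lo1: "1 \<le> lam_exp n \<zeta>" using lam_exp_2_le [of n \<zeta>] two by simp
  have lo2: "ereal ((w + 1 - real n) / real n) \<le> lam_exp n \<zeta>"
  proof (rule dense_le)
    fix y assume "y < ereal ((w + 1 - real n) / real n)"
    then obtain z where z: "y < ereal z" "z < (w + 1 - real n) / real n"
      using ereal_dense2 by force
    define w' where "w' = max (w / 2) (real n * z + real n - 1)"
    have "real n * z + real n - 1 < w" using z(2) n by (simp add: field_simps)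
    then have "ereal ((w' + 1 - real n) / real n) \<le> lam_exp n \<zeta>"
      using w1 w by (intro lam_exp_ge_w_exp_1 [OF n]) (auto simp: w'_def less_max_iff_disj)
    moreover have "z \<le> (w' + 1 - real n) / real n" using n by (simp add: w'_def field_simps)
    ultimately show "y \<le> lam_exp n \<zeta>" using z(1) by (meson ereal_less_eq(3) less_imp_le order_trans)
  qed
  have "ereal (max 1 ((w + 1 - real n) / real n)) \<le> lam_exp n \<zeta>"
    using lo1 lo2 by (simp add: max_def one_ereal_def)
  moreover have "lam_exp n \<zeta> \<le> ereal (max 1 ((w + 1 - real n) / real n))"
    using w by (intro lam_exp_le [OF irr n]) simp
  ultimately show "lam_exp n \<zeta> = ereal (max 1 ((w + 1 - real n) / real n))" by (rule antisym [rotated])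
qed

text \<open>The condition n <= (w + 1) / 2 is equivalent to (w + 1 - n) / n >= 1, so the case
  distinction at the floor is a maximum with 1.\<close>

lemma U2_seq_eq:
  assumes "1 \<le> n"
  shows "U2_seq w n = ereal (max 1 ((w + 1 - real n) / real n))"
proof -
  have "int n \<le> \<lfloor>(w + 1) / 2\<rfloor> \<longleftrightarrow> real n \<le> (w + 1) / 2" by (simp add: le_floor_iff)
  also have "\<dots> \<longleftrightarrow> 1 \<le> (w + 1 - real n) / real n" using assms by (simp add: field_simps)
  finally show ?thesis using assms by (simp add: U2_seq_def max_def one_ereal_def)
qed

lemma lam_seq_of_small_quadratics:
  fixes \<zeta> w :: real
  assumes "\<zeta> \<notin> \<rat>" "w_exp 1 \<zeta> = ereal w" "small_quadratics \<zeta>"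
  shows "lam_seq \<zeta> = U2_seq w"
proof
  fix n show "lam_seq \<zeta> n = U2_seq w n"
  proof (cases "1 \<le> n")
    case True
    then show ?thesis
      using lam_exp_of_small_quadratics(1) [OF assms(1) True assms(2,3)] U2_seq_eq [OF True]
      by (simp add: lam_seq_def)
  next
    case False
    then show ?thesis by (simp add: lam_seq_def U2_seq_def)
  qed
qed

lemma U2_numberD:
  assumes "U2_number \<zeta>"
  shows "\<zeta> \<notin> \<rat>" and "small_quadratics \<zeta>" and "\<exists>w\<ge>1. w_exp 1 \<zeta> = ereal w"
proof -
  have w: "w_exp 1 \<zeta> < \<infinity>" "w_exp 2 \<zeta> = \<infinity>" using assms by (auto simp: U2_number_def)
  show irr: "\<zeta> \<notin> \<rat>" using w_exp_rational_le_0 [of \<zeta> 2] w(2) by auto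
  show "small_quadratics \<zeta>" by (rule small_quadratics_of_w_exp_2 [OF irr w])
  show "\<exists>w\<ge>1. w_exp 1 \<zeta> = ereal w"
    using w(1) w_exp_1_ge_1 [OF irr] by (cases "w_exp 1 \<zeta>") auto
qed

lemma U2_seq_set_eq: "{U2_seq w | w. 1 \<le> w} = {lam_seq \<zeta> | \<zeta>. U2_number \<zeta>}"
proof (intro equalityI subsetI)
  fix s assume "s \<in> {U2_seq w | w. 1 \<le> w}"
  then obtain w where w: "s = U2_seq w" "1 \<le> w" by blast
  obtain \<zeta> where \<zeta>: "U2_number \<zeta>" "w_exp 1 \<zeta> = ereal w" using U2_number_exists [OF w(2)] by blast
  then have "lam_seq \<zeta> = s" using lam_seq_of_small_quadratics U2_numberD w(1) by blast
  then show "s \<in> {lam_seq \<zeta> | \<zeta>. U2_number \<zeta>}" using \<zeta>(1) by blast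
next
  fix s assume "s \<in> {lam_seq \<zeta> | \<zeta>. U2_number \<zeta>}"
  then obtain \<zeta> where \<zeta>: "s = lam_seq \<zeta>" "U2_number \<zeta>" by blast
  obtain w where w: "1 \<le> w" "w_exp 1 \<zeta> = ereal w" using U2_numberD(3) [OF \<zeta>(2)] by blast
  then have "s = U2_seq w" using lam_seq_of_small_quadratics U2_numberD(1,2) [OF \<zeta>(2)] \<zeta>(1) by simp
  then show "s \<in> {U2_seq w | w. 1 \<le> w}" using w(1) by blast
qed

text \<open>Quadratic irrationals need a case of their own, since the polynomials found for them
  might vanish at \<zeta>. They have w_1 = 1 and give the constant sequence 1, which is already
  \<open>U2_seq 1\<close>.\<close>

lemma lam_seq_gt_half:
  assumes gt: "\<forall>n\<ge>1. lam_seq \<zeta> n > ereal (1 / 2)"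
  shows "lam_seq \<zeta> \<in> {U2_seq w | w. 1 \<le> w} \<union> {\<lambda>n\<in>{1..}. \<infinity>}"
proof -
  have lam: "\<forall>n\<ge>1. lam_exp n \<zeta> > ereal (1 / 2)" using gt by (simp add: lam_seq_def)
  consider (rat) "\<zeta> \<in> \<rat>" | (liouville) "\<zeta> \<notin> \<rat>" "w_exp 1 \<zeta> = \<infinity>"
    | (quad) "\<zeta> \<notin> \<rat>" "\<exists>(p0 :: int) (p1 :: int) (p2 :: int). p2 \<noteq> (0 :: int) \<and> p0 + p1 * \<zeta> + p2 * \<zeta>\<^sup>2 = 0"
    | (other) "\<zeta> \<notin> \<rat>" "w_exp 1 \<zeta> < \<infinity>"
        "\<forall>(p0 :: int) (p1 :: int) (p2 :: int). p2 \<noteq> (0 :: int) \<longrightarrow> p0 + p1 * \<zeta> + p2 * \<zeta>\<^sup>2 \<noteq> 0"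
    by (metis ereal_infty_less(1))
  then show ?thesis
  proof cases
    case rat
    then have "lam_seq \<zeta> = (\<lambda>n\<in>{1..}. \<infinity>)" by (auto simp: lam_seq_def lam_exp_rational)
    then show ?thesis by simp
  next
    case liouville
    then have "lam_seq \<zeta> = (\<lambda>n\<in>{1..}. \<infinity>)" by (auto simp: lam_seq_def lam_exp_w_exp_1_infinite)
    then show ?thesis by simp
  next
    case quad
    then obtain p0 p1 p2 :: int where p: "p2 \<noteq> 0" "p0 + p1 * \<zeta> + p2 * \<zeta>\<^sup>2 = 0" by blast
    have "w_exp 1 \<zeta> = ereal 1"
      using w_exp_1_quadratic [OF quad(1) p] w_exp_1_ge_1 [OF quad(1)] by (simp add: one_ereal_def antisym)
    then have "lam_seq \<zeta> = U2_seq 1"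
      using quad(1) small_quadratics_of_root [OF p] by (intro lam_seq_of_small_quadratics)
    then show ?thesis by blast
  next
    case other
    have "w_exp 2 \<zeta> = \<infinity>" by (rule w_exp_2_infinite [OF other(1,2) lam other(3)])
    then have "U2_number \<zeta>" using other(2) by (simp add: U2_number_def)
    then show ?thesis unfolding U2_seq_set_eq by blast
  qed
qed

theorem theorem4p1:
  shows "(\<forall>(\<zeta>::real) (w::real). U2_number \<zeta> \<and> w_exp 1 \<zeta> = ereal w \<and> 1 \<le> w \<longrightarrow>
        (\<forall>n::nat. 1 \<le> n \<and> real n \<le> (w + 1) / 2 \<longrightarrow>
            lam_exp n \<zeta> = ereal ((w + 1 - real n) / real n)) \<and>
        (\<forall>n::nat. 1 \<le> n \<and> (w + 1) / 2 \<le> real n \<longrightarrow>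
            lam_exp n \<zeta> = 1 \<and> lam_exp_j n 2 \<zeta> = 1) \<and>
        (w = 1 \<longrightarrow> (\<forall>n\<ge>1. lam_exp n \<zeta> = 1)))
    \<and> {U2_seq w | w. 1 \<le> w} = {lam_seq \<zeta> | \<zeta>. U2_number \<zeta>}
    \<and> {U2_seq w | w. 1 \<le> w} \<subseteq> joint_spectrum
    \<and> {U2_seq w | w. 1 \<le> w} \<union> {\<lambda>n\<in>{1..}. \<infinity>}
        = {s \<in> joint_spectrum. \<forall>n\<ge>1. s n > ereal (1 / 2)}"
proof (intro conjI)
  show "\<forall>(\<zeta>::real) (w::real). U2_number \<zeta> \<and> w_exp 1 \<zeta> = ereal w \<and> 1 \<le> w \<longrightarrow>
        (\<forall>n::nat. 1 \<le> n \<and> real n \<le> (w + 1) / 2 \<longrightarrow>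
            lam_exp n \<zeta> = ereal ((w + 1 - real n) / real n)) \<and>
        (\<forall>n::nat. 1 \<le> n \<and> (w + 1) / 2 \<le> real n \<longrightarrow>
            lam_exp n \<zeta> = 1 \<and> lam_exp_j n 2 \<zeta> = 1) \<and>
        (w = 1 \<longrightarrow> (\<forall>n\<ge>1. lam_exp n \<zeta> = 1))"
  proof (intro allI impI, elim conjE)
    fix \<zeta> w :: real assume U: "U2_number \<zeta>" "w_exp 1 \<zeta> = ereal w"
    have lam: "lam_exp n \<zeta> = ereal (max 1 ((w + 1 - real n) / real n))" "lam_exp_j n 2 \<zeta> = 1" if "1 \<le> n" for n
      using lam_exp_of_small_quadratics [OF U2_numberD(1) [OF U(1)] that U(2) U2_numberD(2) [OF U(1)]] .
    have "lam_exp n \<zeta> = ereal ((w + 1 - real n) / real n)" if "1 \<le> n" "real n \<le> (w + 1) / 2" for n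
    proof -
      have "1 \<le> (w + 1 - real n) / real n" using that by (simp add: field_simps)
      then show ?thesis using lam(1) [OF that(1)] by (simp add: max_def)
    qed
    moreover have one: "lam_exp n \<zeta> = 1" if "1 \<le> n" "(w + 1) / 2 \<le> real n" for n
    proof -
      have "(w + 1 - real n) / real n \<le> 1" using that by (simp add: field_simps)
      then show ?thesis using lam(1) [OF that(1)] by (simp add: max_def one_ereal_def)
    qed
    moreover have "lam_exp n \<zeta> = 1" if "w = 1" "1 \<le> n" for n using one [of n] that by simp
    ultimately show "(\<forall>n::nat. 1 \<le> n \<and> real n \<le> (w + 1) / 2 \<longrightarrow>
            lam_exp n \<zeta> = ereal ((w + 1 - real n) / real n)) \<and>
        (\<forall>n::nat. 1 \<le> n \<and> (w + 1) / 2 \<le> real n \<longrightarrow>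
            lam_exp n \<zeta> = 1 \<and> lam_exp_j n 2 \<zeta> = 1) \<and>
        (w = 1 \<longrightarrow> (\<forall>n\<ge>1. lam_exp n \<zeta> = 1))"
      using lam(2) by blast
  qed
  show "{U2_seq w | w. 1 \<le> w} = {lam_seq \<zeta> | \<zeta>. U2_number \<zeta>}" by (rule U2_seq_set_eq)
  show sub: "{U2_seq w | w. 1 \<le> w} \<subseteq> joint_spectrum"
    unfolding U2_seq_set_eq joint_spectrum_def by blast
  show "{U2_seq w | w. 1 \<le> w} \<union> {\<lambda>n\<in>{1..}. \<infinity>}
        = {s \<in> joint_spectrum. \<forall>n\<ge>1. s n > ereal (1 / 2)}" (is "?L = ?R")
  proof
    show "?R \<subseteq> ?L" using lam_seq_gt_half unfolding joint_spectrum_def by blast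
    have "U2_seq w n > ereal (1 / 2)" if "1 \<le> n" for w n
      unfolding U2_seq_eq [OF that] by (simp add: less_max_iff_disj)
    moreover have "(\<lambda>n\<in>{1..}. \<infinity>) = lam_seq 0" by (auto simp: lam_seq_def lam_exp_rational)
    then have "(\<lambda>n\<in>{1..}. \<infinity>) \<in> joint_spectrum" unfolding joint_spectrum_def by blast
    ultimately show "?L \<subseteq> ?R" using sub by auto
  qed
qed

end
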